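(* Assume Conditions (B1), (B2'), (B3') and (C1+) stated in the context. Then: (i) For fixed $n$, $$\|\widehat{\underline r}_R-\widehat{\underline r}_{\mathrm{add}}\|_2=O(R^{-1})$$ holds with probability tending to $1$ for increasing $n$. Formally, this means $$P\Big[\limsup_{R\to\infty} R\,\|\widehat{\underline r}_R-\widehat{\underline r}_{\mathrm{add}}\|_2<\infty\Big]\longrightarrow 1\quad\text{as } n\to\infty .$$ (ii) For $n\to\infty$, $$\|\widehat{\underline r}_R-\widehat{\underline r}_{\mathrm{add}}\|_2=O_P\big(R^{-1}\|\mathcal S_*\|_{2,\sup}\big).$$ The regression function is not assumed to be additive.
   Context: **Data and kernel.** $(\underline{\mathbf X}_i,\varepsilon_i)$, $i=1,\dots,n$, are i.i.d., $\underline{\mathbf X}_i\in[0,1]^d$ with density $f$; $\varepsilon_i$ has mean $0$, variance $\sigma^2$ and is independent of $\underline{\mathbf X}_i$; $Y_i=r^{\mathrm{true}}(\underline{\mathbf X}_i)+\varepsilon_i$. Bandwidths $h_1,\dots,h_d>0$ (depending on $n$) are of the same order (their ratios stay bounded away from $0$ and $\infty$). From a univariate kernel $K\ge 0$ one forms the product kernel, rescaled at the boundary so that $\int_{[0,1]^d}K_h(\underline{\mathbf X}_i,\underline{\mathbf x})\,d\underline{\mathbf x}=1$ for all $\underline{\mathbf X}_i\in[0,1]^d$: $$K_h(\underline{\mathbf X}_i,\underline{\mathbf x})=\prod_{k=1}^d \frac{K((X_{i,k}-x_k)/h_k)}{\int_0^1K((X_{i,k}-t)/h_k)\,dt}.$$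 **Spaces and operators.** $\mathcal F_{\mathrm{full}}$ is the space of $\underline r=(r^0,\dots,r^d)$ with $r^\ell:[0,1]^d\to\mathbb R$ square integrable, $\|\underline r\|_2^2=\sum_{\ell=0}^d\int r^\ell(\underline{\mathbf x})^2d\underline{\mathbf x}$. $\mathcal F_{\mathrm{add}}\subset\mathcal F_{\mathrm{full}}$ consists of those $\underline r$ for which $r^0$ is additive (a sum of functions of single coordinates) and, for $k=1,\dots,d$, $r^k(\underline{\mathbf x})$ depends only on $x_k$. $\mathcal P_{\mathrm{add}}$ is the $\|\cdot\|_2$-orthogonal projection of $\mathcal F_{\mathrm{full}}$ onto $\mathcal F_{\mathrm{add}}$; $\mathcal I$ is the identity. With $u_{i,0}(\underline{\mathbf x})=1$ and $u_{i,k}(\underline{\mathbf x})=(X_{i,k}-x_k)/h_k$ for $k\ge1$, let $S_{\ell,l}(\underline{\mathbf x})=\frac1n\sum_iK_h(\underline{\mathbf X}_i,\underline{\mathbf x})u_{i,\ell}(\underline{\mathbf x})u_{i,l}(\underline{\mathbf x})$, $\mathbf S(\underline{\mathbf x})=(S_{\ell,l}(\underline{\mathbf x}))_{\ell,l=0}^d$, and let $\mathcal S_*:\mathcal F_{\mathrm{full}}\to\mathcal F_{\mathrm{full}}$ be the pointwise multiplication $(\mathcal S_*\underline r)(\underline{\mathbf x})=\mathbf S(\underline{\mathbf x})\underline r(\underline{\mathbf x})$. $\|\cdot\|_{2,\sup}$ is the operator norm induced by $\|\cdot\|_2$. **Estimators.** For $\underline r\in\mathcal F_{\mathrm{full}}$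 put $$Q(\underline r)=\int_{[0,1]^d}\frac1n\sum_{i=1}^n\Big[Y_i-r^0(\underline{\mathbf x})-\sum_{k=1}^dr^k(\underline{\mathbf x})\tfrac{X_{i,k}-x_k}{h_k}\Big]^2K_h(\underline{\mathbf X}_i,\underline{\mathbf x})\,d\underline{\mathbf x}.$$ $\widehat{\underline r}_{\mathrm{add}}$ is the minimizer of $Q$ over $\mathcal F_{\mathrm{add}}$, and for a penalty parameter $R>0$, $\widehat{\underline r}_R$ is the minimizer over $\mathcal F_{\mathrm{full}}$ of $Q(\underline r)+R\|(\mathcal I-\mathcal P_{\mathrm{add}})\underline r\|_2^2$. (Under the conditions below these are well defined with probability tending to $1$.) **Conditions.** (B1) $K$ is bounded, nonnegative, has compact support $[-C_1,C_1]$, is symmetric about zero and Lipschitz continuous. (B2') $f$ has support $[0,1]^d$ and is bounded away from zero and infinity on $[0,1]^d$. (B3') $\mathbb E[|Y|^\theta]<\infty$ for some $\theta>5/2$. (C1+) $h_k\to0$ and $h_k$ is of order $n^{-1/5}$ or larger, i.e. $\liminf_n n^{1/5}h_k>0$, $k=1,\dots,d$. *)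

theory Defs
  imports "HOL-Probability.Probability"
begin

text \<open>
  A tuple (r^0, ..., r^d) of functions on the unit cube is a single function into
  \<^typ>\<open>real ^ 'd option\<close>: the component None is r^0 and the component Some k is r^k. Functions are
  total on \<^typ>\<open>real ^ 'd\<close>; only their values on the cube matter, and L2-functions that
  agree almost everywhere are identified through the seminorm l2_norm rather than by a quotient.
\<close>

abbreviation unit_cube :: "(real ^ 'd) set"
  where "unit_cube \<equiv> cbox 0 1"

abbreviation cube_measure :: "(real ^ 'd) measure"
  where "cube_measure \<equiv> restrict_space lborel unit_cube"

type_synonym 'd tuple_fun = "real ^ 'd \<Rightarrow> real ^ 'd option"

definition F_full :: "('d::finite) tuple_fun set"
  where "F_full = {r. \<forall>l. (\<lambda>x. r x $ l) \<in> borel_measurable cube_measure \<and>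
                        integrable cube_measure (\<lambda>x. (r x $ l)\<^sup>2)}"

definition l2_inner :: "('d::finite) tuple_fun \<Rightarrow> 'd tuple_fun \<Rightarrow> real"
  where "l2_inner r q = (\<Sum>l\<in>UNIV. LINT x|cube_measure. r x $ l * q x $ l)"

definition l2_norm :: "('d::finite) tuple_fun \<Rightarrow> real"
  where "l2_norm r = sqrt (\<Sum>l\<in>UNIV. LINT x|cube_measure. (r x $ l)\<^sup>2)"

definition F_add :: "('d::finite) tuple_fun set"
  where "F_add = {r \<in> F_full.
     (\<exists>g :: 'd \<Rightarrow> real \<Rightarrow> real. AE x in cube_measure. r x $ None = (\<Sum>k\<in>UNIV. g k (x $ k))) \<and>
     (\<forall>k. \<exists>g :: real \<Rightarrow> real. AE x in cube_measure. r x $ Some k = g (x $ k))}"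

text \<open>The orthogonal projection, determined up to a null set.\<close>

definition P_add :: "('d::finite) tuple_fun \<Rightarrow> 'd tuple_fun"
  where "P_add r = (SOME p. p \<in> F_add \<and> (\<forall>q\<in>F_add. l2_inner (\<lambda>x. r x - p x) q = 0))"

definition op_norm :: "(('d::finite) tuple_fun \<Rightarrow> 'd tuple_fun) \<Rightarrow> real"
  where "op_norm A = (SUP r\<in>{r \<in> F_full. l2_norm r \<le> 1}. l2_norm (A r))"

definition K_prod :: "(real \<Rightarrow> real) \<Rightarrow> real ^ 'd \<Rightarrow> real ^ 'd \<Rightarrow> real ^ ('d::finite) \<Rightarrow> real"
  where "K_prod K h z x =
    (\<Prod>k\<in>UNIV. K ((z $ k - x $ k) / h $ k) / (LBINT t:{0..1}. K ((z $ k - t) / h $ k)))"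

definition u_vec :: "real ^ 'd \<Rightarrow> real ^ 'd \<Rightarrow> real ^ ('d::finite) \<Rightarrow> real ^ 'd option"
  where "u_vec h z x = (\<chi> l. case l of None \<Rightarrow> 1 | Some k \<Rightarrow> (z $ k - x $ k) / h $ k)"

text \<open>
  In the following, n is the sample size, h the bandwidth vector, and X, Y give the observed
  (non-random) sample, whose entries have the indices 1, ..., n.
\<close>

definition S_mat ::
  "nat \<Rightarrow> (real \<Rightarrow> real) \<Rightarrow> real ^ 'd \<Rightarrow> (nat \<Rightarrow> real ^ 'd) \<Rightarrow> real ^ ('d::finite) \<Rightarrow> real ^ 'd option ^ 'd option"
  where "S_mat n K h X x = (\<chi> l m.
    1 / real n * (\<Sum>i=1..n. K_prod K h (X i) x * u_vec h (X i) x $ l * u_vec h (X i) x $ m))"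

definition S_op ::
  "nat \<Rightarrow> (real \<Rightarrow> real) \<Rightarrow> real ^ 'd \<Rightarrow> (nat \<Rightarrow> real ^ 'd) \<Rightarrow> ('d::finite) tuple_fun \<Rightarrow> 'd tuple_fun"
  where "S_op n K h X r = (\<lambda>x. S_mat n K h X x *v r x)"

definition Q_loss ::
  "nat \<Rightarrow> (real \<Rightarrow> real) \<Rightarrow> real ^ 'd \<Rightarrow> (nat \<Rightarrow> real ^ 'd) \<Rightarrow> (nat \<Rightarrow> real) \<Rightarrow> ('d::finite) tuple_fun \<Rightarrow> real"
  where "Q_loss n K h X Y r = (LINT x|cube_measure. 1 / real n * (\<Sum>i=1..n.
    (Y i - r x $ None - (\<Sum>k\<in>UNIV. r x $ Some k * ((X i $ k - x $ k) / h $ k)))\<^sup>2 * K_prod K h (X i) x))"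

definition Q_pen ::
  "nat \<Rightarrow> (real \<Rightarrow> real) \<Rightarrow> real ^ 'd \<Rightarrow> (nat \<Rightarrow> real ^ 'd) \<Rightarrow> (nat \<Rightarrow> real) \<Rightarrow> real \<Rightarrow> ('d::finite) tuple_fun \<Rightarrow> real"
  where "Q_pen n K h X Y R r =
    Q_loss n K h X Y r + R * (l2_norm (\<lambda>x. r x - P_add r x))\<^sup>2"

definition r_add ::
  "nat \<Rightarrow> (real \<Rightarrow> real) \<Rightarrow> real ^ 'd \<Rightarrow> (nat \<Rightarrow> real ^ 'd) \<Rightarrow> (nat \<Rightarrow> real) \<Rightarrow> ('d::finite) tuple_fun"
  where "r_add n K h X Y = arg_min (Q_loss n K h X Y) (\<lambda>r. r \<in> F_add)"

definition r_pen ::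
  "nat \<Rightarrow> (real \<Rightarrow> real) \<Rightarrow> real ^ 'd \<Rightarrow> (nat \<Rightarrow> real ^ 'd) \<Rightarrow> (nat \<Rightarrow> real) \<Rightarrow> real \<Rightarrow> ('d::finite) tuple_fun"
  where "r_pen n K h X Y R = arg_min (Q_pen n K h X Y R) (\<lambda>r. r \<in> F_full)"

text \<open>
  arg_min is a choice operator, so "the minimizer" is meaningful only if a minimizer exists and
  is unique up to a null set.
\<close>

definition has_unique_min :: "(('d::finite) tuple_fun \<Rightarrow> real) \<Rightarrow> 'd tuple_fun set \<Rightarrow> bool"
  where "has_unique_min J F \<longleftrightarrow>
    (\<exists>r. is_arg_min J (\<lambda>r. r \<in> F) r) \<and>
    (\<forall>r q. is_arg_min J (\<lambda>r. r \<in> F) r \<longrightarrow> is_arg_min J (\<lambda>r. r \<in> F) q \<longrightarrow> l2_norm (\<lambda>x. r x - q x) = 0)"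

definition estimators_defined ::
  "nat \<Rightarrow> (real \<Rightarrow> real) \<Rightarrow> real ^ ('d::finite) \<Rightarrow> (nat \<Rightarrow> real ^ 'd) \<Rightarrow> (nat \<Rightarrow> real) \<Rightarrow> bool"
  where "estimators_defined n K h X Y \<longleftrightarrow>
    has_unique_min (Q_loss n K h X Y) F_add \<and>
    (\<forall>R>0. has_unique_min (Q_pen n K h X Y R) F_full)"

definition estimator_dist ::
  "nat \<Rightarrow> (real \<Rightarrow> real) \<Rightarrow> real ^ ('d::finite) \<Rightarrow> (nat \<Rightarrow> real ^ 'd) \<Rightarrow> (nat \<Rightarrow> real) \<Rightarrow> real \<Rightarrow> real"
  where "estimator_dist n K h X Y R =
    l2_norm (\<lambda>x. r_pen n K h X Y R x - r_add n K h X Y x)"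

text \<open>
  Events about the estimators need not be measurable where the minimizers are not unique, since the
  choice made there may depend on the sample point arbitrarily. Their probability is therefore
  taken as inner probability, which is the ordinary one for measurable events.
\<close>

definition inner_prob :: "'a measure \<Rightarrow> 'a set \<Rightarrow> real"
  where "inner_prob M E = (SUP A\<in>{A \<in> sets M. A \<subseteq> E}. measure M A)"

lemma (in prob_space) inner_prob_eq_prob:
  assumes "E \<in> events"
  shows "inner_prob M E = prob E"
  unfolding inner_prob_def
  by (rule cSup_eq_maximum) (use assms in \<open>auto intro: finite_measure_mono\<close>)

definition big_OP :: "'a measure \<Rightarrow> (nat \<Rightarrow> 'a \<Rightarrow> real) \<Rightarrow> (nat \<Rightarrow> 'a \<Rightarrow> real) \<Rightarrow> bool"
  where "big_OP M Z W \<longleftrightarrow> (\<forall>\<eta>>0. \<exists>C. \<forall>\<^sub>F n in sequentially.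
    inner_prob M {\<omega> \<in> space M. \<bar>Z n \<omega>\<bar> \<le> C * \<bar>W n \<omega>\<bar>} \<ge> 1 - \<eta>)"

end

theory Submission
  imports Defs
begin

text \<open>
  Write B for the quadratic form a \<mapsto> Q_loss a with responses 0, S for its operator and P for the
  projection onto the additive tuples. Everything rests on the bound c |a|^2 \<le> B a for all
  additive a, which holds with probability tending to 1 for a constant c > 0 that does not depend on n.

  Given this bound, let q = (I - P) r_R and p = P r_R - r_add. The normal equations of the penalized
  problem in direction q give R |q|^2 \<le> sqrt (Q 0) sqrt (B q), where Q 0 is the mean of the Y_i^2;
  those of both problems in direction p give that p and p + q are B-orthogonal, so B p \<le> B q. As
  c \<le> |S| and B q \<le> |S| |q|^2, this yields |p + q| \<le> 2 sqrt (Q 0 / c) |S| / R for every R > 0,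
  which contains both claims.

  For the bound, the mean of B is coercive on all tuples, because the density is bounded below. On
  additive tuples B splits into terms that involve only one or two coordinates. Terms in one
  coordinate are controlled by the uniform norm of a kernel average (Chebyshev's inequality on a
  grid), terms in two coordinates by its L2 norm, i.e. the Hilbert-Schmidt norm. These crude
  bounds only need n h^4 \<rightarrow> \<infinity>, irrespective of the dimension.
\<close>

section \<open>Square-integrable functions\<close>

text \<open>Coercivity cannot be asked of all tuples: for bandwidths of order n^(-1/5) and d > 5 the
  kernel windows of the sample cover a vanishing fraction of the cube, and \<open>S_mat\<close> is
  zero off them. Additivity helps through the boundary rescaling: each kernel factor integrates to
  exactly 1 in its coordinate, so a term in one or two components sees only the kernel factors of
  its own coordinates. In one coordinate, a grid of about h^(-2) points, each with variance of order
  h^(-2)/n, costs h^(-4)/n; in two, the kernel is of order h^(-2) and its integrated variance again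
  of order h^(-4)/n. Both are of order n^(-1/5) at the smallest admissible bandwidth.

  A second obstacle is that the summands in \<open>F_add\<close> are arbitrary functions. Measurable
  ones, with L2 norm at most twice that of the tuple, arise by integrating out all coordinates but
  one; the same device shows that \<open>F_add\<close> is closed, on which the projection and the
  minimizers rely.

  One event serves all R > 0 at once, so the second claim allows any positive sequence R n.\<close>

definition sq_integrable :: "'a measure \<Rightarrow> ('a \<Rightarrow> real) \<Rightarrow> bool"
  where "sq_integrable M f \<longleftrightarrow> f \<in> borel_measurable M \<and> integrable M (\<lambda>x. (f x)\<^sup>2)"

lemma sq_integrable_measurable: "sq_integrable M f \<Longrightarrow> f \<in> borel_measurable M"
  by (simp add: sq_integrable_def)

lemma sq_integrableD: "sq_integrable M f \<Longrightarrow> integrable M (\<lambda>x. (f x)\<^sup>2)"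
  by (simp add: sq_integrable_def)

lemma sq_integrable_0: "sq_integrable M (\<lambda>x. 0)"
  by (simp add: sq_integrable_def)

lemma abs_mult_le_sum_squares: "\<bar>a * b\<bar> \<le> a\<^sup>2 + (b::real)\<^sup>2"
proof -
  have "2 * (\<bar>a\<bar> * \<bar>b\<bar>) \<le> a\<^sup>2 + b\<^sup>2"
    using sum_squares_bound[of "\<bar>a\<bar>" "\<bar>b\<bar>"] by (simp add: mult.assoc)
  moreover have "0 \<le> \<bar>a\<bar> * \<bar>b\<bar>"
    by (rule mult_nonneg_nonneg) auto
  ultimately show ?thesis
    unfolding abs_mult by linarith
qed

lemma integrable_mult_sq:
  assumes "sq_integrable M f" "sq_integrable M g"
  shows "integrable M (\<lambda>x. f x * g x)"
proof (rule Bochner_Integration.integrable_bound)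
  show "integrable M (\<lambda>x. (f x)\<^sup>2 + (g x)\<^sup>2)"
    using assms by (simp add: sq_integrable_def)
  show "(\<lambda>x. f x * g x) \<in> borel_measurable M"
    using assms[THEN sq_integrable_measurable] by simp
  show "AE x in M. norm (f x * g x) \<le> norm ((f x)\<^sup>2 + (g x)\<^sup>2)"
    using abs_mult_le_sum_squares by auto
qed

lemma sq_integrable_bound:
  assumes "sq_integrable M f" "g \<in> borel_measurable M" "AE x in M. \<bar>g x\<bar> \<le> C * \<bar>f x\<bar>"
  shows "sq_integrable M g"
  unfolding sq_integrable_def
proof
  show "integrable M (\<lambda>x. (g x)\<^sup>2)"
  proof (rule Bochner_Integration.integrable_bound)
    show "integrable M (\<lambda>x. C\<^sup>2 * (f x)\<^sup>2)"
      using assms by (simp add: sq_integrable_def)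
    show "AE x in M. norm ((g x)\<^sup>2) \<le> norm (C\<^sup>2 * (f x)\<^sup>2)"
      using assms(3)
    proof eventually_elim
      case (elim x)
      then have "\<bar>g x\<bar>\<^sup>2 \<le> (C * \<bar>f x\<bar>)\<^sup>2"
        by (intro power_mono) auto
      then show ?case
        by (simp add: power_mult_distrib)
    qed
  qed (use assms in simp)
qed fact

lemma sq_integrable_cmult: "sq_integrable M f \<Longrightarrow> sq_integrable M (\<lambda>x. c * f x)"
  by (rule sq_integrable_bound[where C = "\<bar>c\<bar>"])
    (auto simp: abs_mult dest: sq_integrable_measurable)

lemma sq_integrable_add:
  assumes "sq_integrable M f" "sq_integrable M g"
  shows "sq_integrable M (\<lambda>x. f x + g x)"
  unfolding sq_integrable_def
proof
  show "(\<lambda>x. f x + g x) \<in> borel_measurable M"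
    using assms[THEN sq_integrable_measurable] by simp
  show "integrable M (\<lambda>x. (f x + g x)\<^sup>2)"
    using integrable_mult_sq[OF assms] sq_integrableD[OF assms(1)] sq_integrableD[OF assms(2)]
    by (simp add: power2_sum mult.assoc)
qed

lemma sq_integrable_diff:
  assumes "sq_integrable M f" "sq_integrable M g"
  shows "sq_integrable M (\<lambda>x. f x - g x)"
  using sq_integrable_add[OF assms(1) sq_integrable_cmult[OF assms(2), of "-1"]] by simp

lemma sq_integrable_sum:
  assumes "\<And>i. i \<in> I \<Longrightarrow> sq_integrable M (f i)"
  shows "sq_integrable M (\<lambda>x. \<Sum>i\<in>I. f i x)"
proof (cases "finite I")
  case True
  then show ?thesis
    using assms by (induction I) (auto intro: sq_integrable_add sq_integrable_0)
qed (simp add: sq_integrable_0)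

lemma (in finite_measure) sq_integrable_const: "sq_integrable M (\<lambda>x. c)"
  by (simp add: sq_integrable_def)

lemma (in finite_measure) sq_integrable_integrable: "sq_integrable M f \<Longrightarrow> integrable M f"
  unfolding sq_integrable_def by (blast intro: square_integrable_imp_integrable)

text \<open>The discriminant of a nonnegative quadratic polynomial in t. It is behind the
  Cauchy-Schwarz inequalities below and, with \<open>A = 0\<close>, behind the stationarity of
  minimizers.\<close>

lemma nonneg_quadratic_discriminant:
  fixes A B C :: real
  assumes "\<And>t. 0 \<le> A + 2 * t * B + t\<^sup>2 * C" "0 \<le> C"
  shows "B\<^sup>2 \<le> A * C"
proof (cases "C = 0")
  case True
  have "B = 0"
  proof (rule ccontr)
    assume "B \<noteq> 0"
    \<comment> \<open>At this t the expression \<open>A + 2 * t * B\<close> is -1.\<close>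
    then show False
      using assms(1)[of "- (A + 1) / (2 * B)"] True by (simp add: field_simps)
  qed
  then show ?thesis
    using True by simp
next
  case False
  have "0 \<le> A + 2 * (- B / C) * B + (- B / C)\<^sup>2 * C"
    by (rule assms(1))
  also have "\<dots> = A - B\<^sup>2 / C"
    using False by (simp add: field_simps power2_eq_square)
  finally show ?thesis
    using False assms(2) by (simp add: field_simps)
qed

lemma integral_cauchy_schwarz:
  assumes "sq_integrable M f" "sq_integrable M g"
  shows "(LINT x|M. f x * g x)\<^sup>2 \<le> (LINT x|M. (f x)\<^sup>2) * (LINT x|M. (g x)\<^sup>2)"
proof (rule nonneg_quadratic_discriminant)
  fix t :: real
  have "(LINT x|M. (f x)\<^sup>2) + 2 * t * (LINT x|M. f x * g x) + t\<^sup>2 * (LINT x|M. (g x)\<^sup>2)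
      = (LINT x|M. (f x)\<^sup>2 + (2 * t) * (f x * g x) + t\<^sup>2 * (g x)\<^sup>2)"
    using integrable_mult_sq[OF assms] assms by (simp add: sq_integrable_def)
  also have "\<dots> = (LINT x|M. (f x + t * g x)\<^sup>2)"
    by (intro Bochner_Integration.integral_cong) (simp_all add: power2_eq_square algebra_simps)
  finally show "0 \<le> (LINT x|M. (f x)\<^sup>2) + 2 * t * (LINT x|M. f x * g x) + t\<^sup>2 * (LINT x|M. (g x)\<^sup>2)"
    by simp
qed simp

lemma (in prob_space) square_integral_le:
  assumes "sq_integrable M f"
  shows "(LINT x|M. f x)\<^sup>2 \<le> (LINT x|M. (f x)\<^sup>2)"
  using integral_cauchy_schwarz[OF assms sq_integrable_const[of 1]] by (simp add: prob_space)

lemma ennreal_integral_square: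
  assumes "sq_integrable M f"
  shows "ennreal (LINT x|M. (f x)\<^sup>2) = (\<integral>\<^sup>+x. ennreal ((f x)\<^sup>2) \<partial>M)"
  using assms by (simp add: sq_integrable_def nn_integral_eq_integral)

text \<open>
  Riesz-Fischer for geometrically fast Cauchy sequences: the increments are summable in
  L1, hence almost everywhere, and Fatou's lemma controls the L2 distance to the limit.
\<close>

lemma (in prob_space) sq_integrable_complete:
  fixes f :: "nat \<Rightarrow> 'a \<Rightarrow> real"
  assumes f: "\<And>n. sq_integrable M (f n)"
    and cauchy: "\<And>n m. n \<le> m \<Longrightarrow> (LINT x|M. (f m x - f n x)\<^sup>2) \<le> C * (1 / 4) ^ n"
  shows "\<exists>g. sq_integrable M g \<and> (\<forall>n. (LINT x|M. (f n x - g x)\<^sup>2) \<le> C * (1 / 4) ^ n)"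
proof -
  have C: "0 \<le> C"
    using cauchy[of 0 0] by simp
  have [measurable]: "f n \<in> borel_measurable M" for n
    using f by (simp add: sq_integrable_def)
  have d: "sq_integrable M (\<lambda>x. f m x - f n x)" for m n
    using f by (intro sq_integrable_diff)
  have l1: "(LINT x|M. \<bar>f (Suc n) x - f n x\<bar>) \<le> sqrt C * (1 / 2) ^ n" for n
  proof -
    have "(LINT x|M. \<bar>f (Suc n) x - f n x\<bar>)\<^sup>2 \<le> (LINT x|M. \<bar>f (Suc n) x - f n x\<bar>\<^sup>2)"
      by (intro square_integral_le sq_integrable_bound[OF d[of "Suc n" n], where C = 1]) auto
    also have "\<dots> \<le> C * (1 / 4) ^ n"
      using cauchy[of n "Suc n"] by simp
    also have "\<dots> = (sqrt C * (1 / 2) ^ n)\<^sup>2"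
    proof -
      have "(1 / 4 :: real) ^ n = ((1 / 2) ^ n)\<^sup>2"
        by (simp only: power2_eq_square power_mult_distrib[symmetric]) simp
      then show ?thesis
        using C by (simp only: power_mult_distrib real_sqrt_pow2)
    qed
    finally show ?thesis
      using C by (rule_tac power2_le_imp_le) auto
  qed
  have "AE x in M. summable (\<lambda>n. \<bar>f (Suc n) x - f n x\<bar>)"
  proof -
    have "(\<integral>\<^sup>+x. (\<Sum>n. ennreal \<bar>f (Suc n) x - f n x\<bar>) \<partial>M)
        = (\<Sum>n. \<integral>\<^sup>+x. ennreal \<bar>f (Suc n) x - f n x\<bar> \<partial>M)"
      by (rule nn_integral_suminf) auto
    also have "\<dots> = (\<Sum>n. ennreal (LINT x|M. \<bar>f (Suc n) x - f n x\<bar>))"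
      by (intro suminf_cong nn_integral_eq_integral) (auto intro!: integrable_abs sq_integrable_integrable[OF d])
    also have "\<dots> \<le> (\<Sum>n. ennreal (sqrt C * (1 / 2) ^ n))"
      by (intro suminf_le ennreal_leI l1) auto
    also have "\<dots> = ennreal (\<Sum>n. sqrt C * (1 / 2) ^ n)"
      using C by (intro suminf_ennreal2) (auto intro!: summable_mult summable_geometric)
    finally have "(\<integral>\<^sup>+x. (\<Sum>n. ennreal \<bar>f (Suc n) x - f n x\<bar>) \<partial>M) \<noteq> \<infinity>"
      by (auto simp: top_unique)
    then have "AE x in M. (\<Sum>n. ennreal \<bar>f (Suc n) x - f n x\<bar>) \<noteq> \<infinity>"
      by (intro nn_integral_PInf_AE) auto
    then show ?thesis
      by eventually_elim (auto intro: summable_suminf_not_top)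
  qed
  then have conv: "AE x in M. convergent (\<lambda>n. f n x)"
  proof eventually_elim
    case (elim x)
    then have "summable (\<lambda>n. f (Suc n) x - f n x)"
      by (rule summable_rabs_cancel)
    then have "convergent (\<lambda>n. \<Sum>i<n. f (Suc i) x - f i x)"
      by (simp add: summable_iff_convergent)
    then have "convergent (\<lambda>n. f n x - f 0 x)"
      by (simp only: sum_lessThan_telescope[of "\<lambda>i. f i x"])
    then show ?case
      by (simp add: convergent_diff_const_right_iff)
  qed
  define g where "g x = lim (\<lambda>n. f n x)" for x
  have [measurable]: "g \<in> borel_measurable M"
    unfolding g_def by simp
  have fatou: "(\<integral>\<^sup>+x. ennreal ((f n x - g x)\<^sup>2) \<partial>M) \<le> ennreal (C * (1 / 4) ^ n)" for n
  proof -
    have "(\<integral>\<^sup>+x. ennreal ((f n x - g x)\<^sup>2) \<partial>M)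
        = (\<integral>\<^sup>+x. liminf (\<lambda>m. ennreal ((f n x - f m x)\<^sup>2)) \<partial>M)"
    proof (rule nn_integral_cong_AE)
      show "AE x in M. ennreal ((f n x - g x)\<^sup>2) = liminf (\<lambda>m. ennreal ((f n x - f m x)\<^sup>2))"
        using conv
      proof eventually_elim
        case (elim x)
        then have "(\<lambda>m. f m x) \<longlonglongrightarrow> g x"
          by (simp add: g_def convergent_LIMSEQ_iff)
        then have "(\<lambda>m. ennreal ((f n x - f m x)\<^sup>2)) \<longlonglongrightarrow> ennreal ((f n x - g x)\<^sup>2)"
          by (intro tendsto_ennrealI tendsto_intros)
        then show ?case
          by (intro lim_imp_Liminf[symmetric]) auto
      qed
    qed
    also have "\<dots> \<le> liminf (\<lambda>m. \<integral>\<^sup>+x. ennreal ((f n x - f m x)\<^sup>2) \<partial>M)"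
      by (rule nn_integral_liminf) auto
    also have "\<dots> \<le> liminf (\<lambda>m. ennreal (C * (1 / 4) ^ n))"
    proof (rule Liminf_mono, rule eventually_sequentiallyI[of n])
      fix m assume "n \<le> m"
      have "(\<integral>\<^sup>+x. ennreal ((f n x - f m x)\<^sup>2) \<partial>M) = ennreal (LINT x|M. (f m x - f n x)\<^sup>2)"
        by (simp add: ennreal_integral_square[OF d] power2_commute)
      also have "\<dots> \<le> ennreal (C * (1 / 4) ^ n)"
        by (intro ennreal_leI cauchy \<open>n \<le> m\<close>)
      finally show "(\<integral>\<^sup>+x. ennreal ((f n x - f m x)\<^sup>2) \<partial>M) \<le> ennreal (C * (1 / 4) ^ n)" .
    qed
    finally show ?thesis
      by (simp add: Liminf_const)
  qed
  have sq: "sq_integrable M (\<lambda>x. f n x - g x)" for n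
    unfolding sq_integrable_def
    using le_less_trans[OF fatou[of n] ennreal_less_top]
    by (auto intro!: integrableI_nonneg simp: top.not_eq_extremum)
  \<comment> \<open>Fatou's lemma controls only the differences from g, so g is recovered from
    \<open>f 0\<close>.\<close>
  have "sq_integrable M (\<lambda>x. f 0 x - (f 0 x - g x))"
    by (intro sq_integrable_diff f sq)
  then have "sq_integrable M g"
    by simp
  moreover have "(LINT x|M. (f n x - g x)\<^sup>2) \<le> C * (1 / 4) ^ n" for n
    using fatou[of n] C by (simp add: ennreal_integral_square[OF sq, symmetric])
  ultimately show ?thesis
    by blast
qed

section \<open>Quadratic minimization over closed subspaces\<close>

lemma emeasure_unit_cube: "emeasure lborel (unit_cube :: (real ^ 'd::finite) set) = 1"
proof -
  have "(\<Prod>b\<in>Basis. (1 - 0 :: real ^ 'd) \<bullet> b) = 1"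
    by (intro prod.neutral) (auto simp: Basis_vec_def inner_axis)
  then show ?thesis
    by (subst emeasure_lborel_cbox) (auto simp: Basis_vec_def inner_axis)
qed

lemma prob_space_cube: "prob_space (cube_measure :: (real ^ 'd::finite) measure)"
  by (rule prob_spaceI) (simp add: emeasure_restrict_space emeasure_unit_cube space_restrict_space)

interpretation cube: prob_space "cube_measure :: (real ^ 'd::finite) measure"
  by (rule prob_space_cube)

lemma F_full_iff: "r \<in> F_full \<longleftrightarrow> (\<forall>l. sq_integrable cube_measure (\<lambda>x. r x $ l))"
  by (simp add: F_full_def sq_integrable_def)

lemma F_full_axpy: "r \<in> F_full \<Longrightarrow> a \<in> F_full \<Longrightarrow> (\<lambda>x. r x + t *\<^sub>R a x) \<in> F_full"
  by (auto simp: F_full_iff intro!: sq_integrable_add sq_integrable_cmult)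

lemma F_full_diff: "r \<in> F_full \<Longrightarrow> a \<in> F_full \<Longrightarrow> (\<lambda>x. r x - a x) \<in> F_full"
  by (auto simp: F_full_iff intro!: sq_integrable_diff)

lemma F_full_0: "(\<lambda>x. 0) \<in> F_full"
  by (simp add: F_full_iff sq_integrable_0)

lemma l2_norm_nonneg: "0 \<le> l2_norm r"
  by (simp add: l2_norm_def sum_nonneg)

lemma l2_inner_commute: "l2_inner r q = l2_inner q r"
  by (simp add: l2_inner_def mult.commute)

lemma l2_norm_square: "(l2_norm r)\<^sup>2 = l2_inner r r"
  by (simp add: l2_norm_def l2_inner_def sum_nonneg power2_eq_square)

lemma l2_inner_axpy_left:
  assumes "r \<in> F_full" "a \<in> F_full" "q \<in> F_full"
  shows "l2_inner (\<lambda>x. r x + t *\<^sub>R a x) q = l2_inner r q + t * l2_inner a q"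
proof -
  have "integrable cube_measure (\<lambda>x. r x $ l * q x $ l)"
    "integrable cube_measure (\<lambda>x. a x $ l * q x $ l)" for l
    using assms by (auto simp: F_full_iff intro: integrable_mult_sq)
  then show ?thesis
    by (simp add: l2_inner_def distrib_right mult.assoc sum.distrib sum_distrib_left)
qed

lemma l2_inner_axpy_right:
  assumes "r \<in> F_full" "a \<in> F_full" "q \<in> F_full"
  shows "l2_inner q (\<lambda>x. r x + t *\<^sub>R a x) = l2_inner q r + t * l2_inner q a"
  using l2_inner_axpy_left[OF assms] by (simp add: l2_inner_commute)

lemma l2_norm_axpy:
  assumes "r \<in> F_full" "a \<in> F_full"
  shows "(l2_norm (\<lambda>x. r x + t *\<^sub>R a x))\<^sup>2
    = (l2_norm r)\<^sup>2 + 2 * t * l2_inner r a + t\<^sup>2 * (l2_norm a)\<^sup>2"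
  using assms unfolding l2_norm_square
  by (simp add: l2_inner_axpy_left l2_inner_axpy_right F_full_axpy
      l2_inner_commute[of a r] power2_eq_square algebra_simps)

lemma l2_norm_minus_commute: "l2_norm (\<lambda>x. r x - q x) = l2_norm (\<lambda>x. q x - r x)"
  by (simp add: l2_norm_def power2_commute)

lemma l2_cauchy_schwarz:
  assumes "r \<in> F_full" "a \<in> F_full"
  shows "\<bar>l2_inner r a\<bar> \<le> l2_norm r * l2_norm a"
proof -
  have "(l2_inner r a)\<^sup>2 \<le> (l2_norm r)\<^sup>2 * (l2_norm a)\<^sup>2"
  proof (rule nonneg_quadratic_discriminant)
    fix t :: real
    show "0 \<le> (l2_norm r)\<^sup>2 + 2 * t * l2_inner r a + t\<^sup>2 * (l2_norm a)\<^sup>2"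
      unfolding l2_norm_axpy[OF assms, symmetric] by simp
  qed simp
  then have "\<bar>l2_inner r a\<bar>\<^sup>2 \<le> (l2_norm r * l2_norm a)\<^sup>2"
    by (simp add: power_mult_distrib)
  then show ?thesis
    by (rule power2_le_imp_le) (simp add: l2_norm_nonneg)
qed

lemma l2_norm_triangle:
  assumes "r \<in> F_full" "a \<in> F_full"
  shows "l2_norm (\<lambda>x. r x + a x) \<le> l2_norm r + l2_norm a"
proof (rule power2_le_imp_le)
  have "(l2_norm (\<lambda>x. r x + a x))\<^sup>2 = (l2_norm r)\<^sup>2 + 2 * l2_inner r a + (l2_norm a)\<^sup>2"
    using l2_norm_axpy[OF assms, of 1] by simp
  also have "\<dots> \<le> (l2_norm r)\<^sup>2 + 2 * (l2_norm r * l2_norm a) + (l2_norm a)\<^sup>2"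
    using l2_cauchy_schwarz[OF assms] by simp
  finally show "(l2_norm (\<lambda>x. r x + a x))\<^sup>2 \<le> (l2_norm r + l2_norm a)\<^sup>2"
    by (simp add: power2_sum)
qed (simp add: l2_norm_nonneg)

text \<open>The tuple norm dominates each component, so scalar completeness applies to every
  component at the same rate, and there are finitely many of them.\<close>

lemma F_full_complete:
  fixes r :: "nat \<Rightarrow> ('d::finite) tuple_fun"
  assumes r: "\<And>n. r n \<in> F_full"
    and cauchy: "\<And>n m. n \<le> m \<Longrightarrow> (l2_norm (\<lambda>x. r m x - r n x))\<^sup>2 \<le> C * (1 / 4) ^ n"
  shows "\<exists>g\<in>F_full. (\<lambda>n. l2_norm (\<lambda>x. r n x - g x)) \<longlonglongrightarrow> 0"
proof -
  have norm_sq: "(l2_norm q)\<^sup>2 = (\<Sum>l\<in>UNIV. LINT x|cube_measure. (q x $ l)\<^sup>2)" for q :: "'d tuple_fun"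
    by (simp add: l2_norm_def sum_nonneg)
  have "\<forall>l. \<exists>g. sq_integrable cube_measure g \<and>
    (\<forall>n. (LINT x|cube_measure. (r n x $ l - g x)\<^sup>2) \<le> C * (1 / 4) ^ n)"
  proof (intro allI cube.sq_integrable_complete)
    fix l
    show "sq_integrable cube_measure (\<lambda>x. r n x $ l)" for n
      using r by (simp add: F_full_iff)
    fix n m :: nat assume "n \<le> m"
    have "(LINT x|cube_measure. (r m x $ l - r n x $ l)\<^sup>2) \<le> (l2_norm (\<lambda>x. r m x - r n x))\<^sup>2"
      unfolding norm_sq by (simp, rule member_le_sum) auto
    also have "\<dots> \<le> C * (1 / 4) ^ n"
      by (rule cauchy) fact
    finally show "(LINT x|cube_measure. (r m x $ l - r n x $ l)\<^sup>2) \<le> C * (1 / 4) ^ n" .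
  qed
  from choice[OF this] obtain g where g: "\<And>l. sq_integrable cube_measure (g l)"
    "\<And>l n. (LINT x|cube_measure. (r n x $ l - g l x)\<^sup>2) \<le> C * (1 / 4) ^ n"
    by auto
  let ?g = "\<lambda>x. \<chi> l. g l x"
  have "?g \<in> F_full"
    using g by (simp add: F_full_iff)
  moreover have "(\<lambda>n. l2_norm (\<lambda>x. r n x - ?g x)) \<longlonglongrightarrow> 0"
  proof -
    have "(\<lambda>n. (l2_norm (\<lambda>x. r n x - ?g x))\<^sup>2) \<longlonglongrightarrow> 0"
    proof (rule tendsto_sandwich[where f = "\<lambda>_. 0"])
      show "\<forall>\<^sub>F n in sequentially. (l2_norm (\<lambda>x. r n x - ?g x))\<^sup>2
          \<le> (\<Sum>l\<in>(UNIV :: 'd option set). C * (1 / 4) ^ n)"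
        unfolding norm_sq by (intro always_eventually allI sum_mono) (simp add: g)
      have "(\<lambda>n. \<Sum>l\<in>(UNIV :: 'd option set). C * (1 / 4) ^ n) \<longlonglongrightarrow> (\<Sum>l\<in>(UNIV :: 'd option set). C * 0)"
        by (intro tendsto_intros LIMSEQ_power_zero) auto
      then show "(\<lambda>n. \<Sum>l\<in>(UNIV :: 'd option set). C * (1 / 4) ^ n) \<longlonglongrightarrow> 0"
        by simp
    qed auto
    then have "(\<lambda>n. sqrt ((l2_norm (\<lambda>x. r n x - ?g x))\<^sup>2)) \<longlonglongrightarrow> sqrt 0"
      by (intro tendsto_intros)
    then show ?thesis
      by (simp add: l2_norm_nonneg)
  qed
  ultimately show ?thesis
    by (intro bexI[of _ ?g])
qed

text \<open>The limit g has to be in \<open>F_full\<close> because \<open>l2_norm\<close> takes junk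
  values elsewhere: the integral of a nonintegrable function is 0. Constant sequences show that such
  a set is stable under changes on null sets within \<open>F_full\<close>.\<close>

definition closed_subspace :: "('d::finite) tuple_fun set \<Rightarrow> bool"
  where "closed_subspace F \<longleftrightarrow> F \<subseteq> F_full \<and> (\<lambda>x. 0) \<in> F \<and>
    (\<forall>r\<in>F. \<forall>a\<in>F. \<forall>t. (\<lambda>x. r x + t *\<^sub>R a x) \<in> F) \<and>
    (\<forall>r. \<forall>g\<in>F_full. (\<forall>n. r n \<in> F) \<longrightarrow> (\<lambda>n. l2_norm (\<lambda>x. r n x - g x)) \<longlonglongrightarrow> 0 \<longrightarrow> g \<in> F)"

lemma closed_subspace_F_full: "closed_subspace F_full"
  by (auto simp: closed_subspace_def F_full_0 F_full_axpy)

lemma closed_subspaceD: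
  assumes "closed_subspace F"
  shows "r \<in> F \<Longrightarrow> r \<in> F_full" "(\<lambda>x. 0) \<in> F"
    "r \<in> F \<Longrightarrow> a \<in> F \<Longrightarrow> (\<lambda>x. r x + t *\<^sub>R a x) \<in> F"
    "r \<in> F \<Longrightarrow> a \<in> F \<Longrightarrow> (\<lambda>x. r x - a x) \<in> F"
proof -
  show "r \<in> F \<Longrightarrow> r \<in> F_full" "(\<lambda>x. 0) \<in> F"
    using assms by (auto simp: closed_subspace_def)
  show *: "r \<in> F \<Longrightarrow> a \<in> F \<Longrightarrow> (\<lambda>x. r x + t *\<^sub>R a x) \<in> F" for t
    using assms by (auto simp: closed_subspace_def)
  show "r \<in> F \<Longrightarrow> a \<in> F \<Longrightarrow> (\<lambda>x. r x - a x) \<in> F"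
    using *[of "-1"] by simp
qed

lemma closed_subspace_limit:
  assumes "closed_subspace F" "\<And>n. r n \<in> F" "g \<in> F_full"
    and "(\<lambda>n. l2_norm (\<lambda>x. r n x - g x)) \<longlonglongrightarrow> 0"
  shows "g \<in> F"
proof -
  have "\<forall>r. \<forall>g\<in>F_full. (\<forall>n. r n \<in> F) \<longrightarrow> (\<lambda>n. l2_norm (\<lambda>x. r n x - g x)) \<longlonglongrightarrow> 0 \<longrightarrow> g \<in> F"
    using assms(1) by (simp add: closed_subspace_def)
  from this[rule_format, OF assms(3,2,4)] show ?thesis .
qed

text \<open>J is a nonnegative quadratic functional on F with derivative 2 D and Hessian form 2 E.\<close>

definition quadratic_on ::
  "('d::finite) tuple_fun set \<Rightarrow> ('d tuple_fun \<Rightarrow> real) \<Rightarrow> ('d tuple_fun \<Rightarrow> 'd tuple_fun \<Rightarrow> real) \<Rightarrow>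
   ('d tuple_fun \<Rightarrow> real) \<Rightarrow> bool"
  where "quadratic_on F J D E \<longleftrightarrow> (\<forall>r\<in>F. 0 \<le> J r) \<and> (\<forall>a\<in>F. 0 \<le> E a) \<and>
    (\<forall>r\<in>F. \<forall>a\<in>F. \<forall>t. J (\<lambda>x. r x + t *\<^sub>R a x) = J r + 2 * t * D r a + t\<^sup>2 * E a)"

lemma quadratic_onD:
  assumes "quadratic_on F J D E"
  shows "r \<in> F \<Longrightarrow> 0 \<le> J r" "a \<in> F \<Longrightarrow> 0 \<le> E a"
    "r \<in> F \<Longrightarrow> a \<in> F \<Longrightarrow> J (\<lambda>x. r x + t *\<^sub>R a x) = J r + 2 * t * D r a + t\<^sup>2 * E a"
  using assms by (auto simp: quadratic_on_def)

lemma quadratic_on_mono: "quadratic_on F J D E \<Longrightarrow> G \<subseteq> F \<Longrightarrow> quadratic_on G J D E"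
  by (auto simp: quadratic_on_def subset_iff)

text \<open>The polynomial is J along the line through r in direction a. As J need not be
  homogeneous, this bounds the slope of J by its value; applied to the loss it is the source of the
  factor sqrt (Q 0).\<close>

lemma quadratic_cauchy_schwarz:
  assumes "quadratic_on F J D E" "closed_subspace F" "r \<in> F" "a \<in> F"
  shows "(D r a)\<^sup>2 \<le> J r * E a"
proof (rule nonneg_quadratic_discriminant)
  fix t :: real
  have "0 \<le> J (\<lambda>x. r x + t *\<^sub>R a x)"
    by (intro quadratic_onD(1)[OF assms(1)] closed_subspaceD(3)[OF assms(2)] assms)
  then show "0 \<le> J r + 2 * t * D r a + t\<^sup>2 * E a"
    using quadratic_onD(3)[OF assms(1,3,4)] by simp
qed (rule quadratic_onD(2)[OF assms(1,4)])

text \<open>Along the line through r in direction a the increment 2 t D + t^2 E is nonnegative for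
  every t, and the discriminant forces D = 0.\<close>

lemma quadratic_argmin_stationary:
  assumes q: "quadratic_on F J D E" and F: "closed_subspace F"
    and min: "is_arg_min J (\<lambda>r. r \<in> F) r" and a: "a \<in> F"
  shows "D r a = 0"
proof -
  have r: "r \<in> F" and le: "\<And>p. p \<in> F \<Longrightarrow> J r \<le> J p"
    using min by (auto simp: is_arg_min_def not_less)
  have "(D r a)\<^sup>2 \<le> 0 * E a"
  proof (rule nonneg_quadratic_discriminant)
    fix t :: real
    have "J r \<le> J (\<lambda>x. r x + t *\<^sub>R a x)"
      by (intro le closed_subspaceD(3)[OF F] r a)
    then show "0 \<le> 0 + 2 * t * D r a + t\<^sup>2 * E a"
      by (simp add: quadratic_onD(3)[OF q r a])
  qed (rule quadratic_onD(2)[OF q a])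
  then show ?thesis
    by simp
qed

text \<open>This is the parallelogram identity, with J bounded by m at the midpoint of r and s.\<close>

lemma quadratic_near_minimizers:
  assumes q: "quadratic_on F J D E" and F: "closed_subspace F"
    and m: "\<And>p. p \<in> F \<Longrightarrow> m \<le> J p" and r: "r \<in> F" and s: "s \<in> F"
  shows "E (\<lambda>x. s x - r x) \<le> 2 * J r + 2 * J s - 4 * m"
proof -
  let ?a = "\<lambda>x. s x - r x"
  have a: "?a \<in> F"
    by (intro closed_subspaceD(4)[OF F] r s)
  have "m \<le> J (\<lambda>x. r x + (1 / 2) *\<^sub>R ?a x)"
    by (intro m closed_subspaceD(3)[OF F] r a)
  then have "m \<le> J r + D r ?a + (1 / 4) * E ?a"
    unfolding quadratic_onD(3)[OF q r a] by (simp add: power2_eq_square)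
  moreover have "J (\<lambda>x. r x + 1 *\<^sub>R ?a x) = J r + 2 * 1 * D r ?a + 1\<^sup>2 * E ?a"
    by (rule quadratic_onD(3)[OF q r a])
  then have "J s = J r + 2 * D r ?a + E ?a"
    by simp
  ultimately show ?thesis
    by (simp add: field_simps)
qed

text \<open>The direct method. Near-minimizers are Cauchy with respect to E by the parallelogram
  identity, and the lower bound on E carries this over to \<open>l2_norm\<close>. The upper bound on
  E makes J continuous along the sequence, so that the limit attains the infimum.\<close>

theorem quadratic_has_unique_min:
  assumes q: "quadratic_on F J D E" and F: "closed_subspace F"
    and \<gamma>: "\<gamma> > 0" "\<And>a. a \<in> F \<Longrightarrow> \<gamma> * (l2_norm a)\<^sup>2 \<le> E a"
    and C: "\<And>a. a \<in> F \<Longrightarrow> E a \<le> C * (l2_norm a)\<^sup>2"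
  shows "has_unique_min J F"
proof -
  define m where "m = Inf (J ` F)"
  have bdd: "bdd_below (J ` F)"
    using quadratic_onD(1)[OF q] by (auto intro!: bdd_belowI[of _ 0])
  have ne: "J ` F \<noteq> {}"
    using closed_subspaceD(2)[OF F] by auto
  have m: "m \<le> J p" if "p \<in> F" for p
    unfolding m_def using that by (intro cInf_lower bdd) auto
  \<comment> \<open>The excess is chosen to match the geometric rate in
    \<open>F_full_complete\<close>.\<close>
  have "\<exists>r\<in>F. J r < m + (1 / 4) ^ n" for n :: nat
    using cInf_less_iff[OF ne bdd, of "m + (1 / 4) ^ n"] by (auto simp: m_def)
  then obtain r where r: "\<And>n. r n \<in> F" and Jr: "\<And>n. J (r n) < m + (1 / 4) ^ n"
    by metis
  have near: "E (\<lambda>x. r k x - r n x) \<le> 2 * J (r n) + 2 * J (r k) - 4 * m" for n k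
    by (rule quadratic_near_minimizers[OF q F m r r])
  have "(l2_norm (\<lambda>x. r k x - r n x))\<^sup>2 \<le> 4 / \<gamma> * (1 / 4) ^ n" if "n \<le> k" for n k
  proof -
    have "m + (1 / 4) ^ k \<le> m + (1 / 4) ^ n"
      using that by (intro add_left_mono power_decreasing) auto
    then have "J (r k) < m + (1 / 4) ^ n"
      by (rule order_less_le_trans[OF Jr])
    moreover have "2 * J (r n) + 2 * J (r k) - 4 * m \<le> 4 * e"
      if "J (r k) < m + e" "J (r n) < m + e" for e
      using that by linarith
    ultimately have "2 * J (r n) + 2 * J (r k) - 4 * m \<le> 4 * (1 / 4) ^ n"
      using Jr by blast
    with near[of k n] have "E (\<lambda>x. r k x - r n x) \<le> 4 * (1 / 4) ^ n"
      by (rule order_trans)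
    moreover have "\<gamma> * (l2_norm (\<lambda>x. r k x - r n x))\<^sup>2 \<le> E (\<lambda>x. r k x - r n x)"
      by (intro \<gamma> closed_subspaceD(4)[OF F] r)
    ultimately have "\<gamma> * (l2_norm (\<lambda>x. r k x - r n x))\<^sup>2 \<le> 4 * (1 / 4) ^ n"
      by (rule order_trans[rotated])
    then have "(l2_norm (\<lambda>x. r k x - r n x))\<^sup>2 \<le> 4 * (1 / 4) ^ n / \<gamma>"
      using \<gamma>(1) by (simp only: pos_le_divide_eq mult.commute[of \<gamma>])
    then show ?thesis
      by simp
  qed
  then obtain g where g: "g \<in> F_full" and lim: "(\<lambda>n. l2_norm (\<lambda>x. r n x - g x)) \<longlonglongrightarrow> 0"
    using F_full_complete[of r "4 / \<gamma>"] r closed_subspaceD(1)[OF F] by blast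
  have gF: "g \<in> F"
    by (rule closed_subspace_limit[OF F r g lim])
  define e where "e n = E (\<lambda>x. g x - r n x)" for n
  have e_nonneg: "0 \<le> e n" for n
    unfolding e_def by (intro quadratic_onD(2)[OF q] closed_subspaceD(4)[OF F] r gF)
  have e_lim: "e \<longlonglongrightarrow> 0"
  proof (rule tendsto_sandwich[where f = "\<lambda>_. 0"])
    show "\<forall>\<^sub>F n in sequentially. e n \<le> C * (l2_norm (\<lambda>x. r n x - g x))\<^sup>2"
      unfolding e_def using C[OF closed_subspaceD(4)[OF F gF r]]
      by (simp add: l2_norm_minus_commute)
    have "(\<lambda>n. C * (l2_norm (\<lambda>x. r n x - g x))\<^sup>2) \<longlonglongrightarrow> C * 0\<^sup>2"
      by (intro tendsto_intros lim)
    then show "(\<lambda>n. C * (l2_norm (\<lambda>x. r n x - g x))\<^sup>2) \<longlonglongrightarrow> 0"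
      by simp
  qed (auto simp: e_nonneg)
  \<comment> \<open>Expansion of J at \<open>r n\<close> towards g: the slope is at most sqrt (J (r
    n) * e n), and J (r n) \<le> m + 1.\<close>
  have "J g \<le> m + (1 / 4) ^ n + 2 * sqrt ((m + 1) * e n) + e n" for n
  proof -
    let ?a = "\<lambda>x. g x - r n x"
    have a: "?a \<in> F"
      by (intro closed_subspaceD(4)[OF F] r gF)
    have "J (\<lambda>x. r n x + 1 *\<^sub>R ?a x) = J (r n) + 2 * 1 * D (r n) ?a + 1\<^sup>2 * E ?a"
      by (rule quadratic_onD(3)[OF q r a])
    then have "J g = J (r n) + 2 * D (r n) ?a + e n"
      by (simp add: e_def)
    moreover have "D (r n) ?a \<le> sqrt ((m + 1) * e n)"
    proof (rule real_le_rsqrt)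
      have "(1 / 4 :: real) ^ n \<le> 1"
        by (rule power_le_one) auto
      then have "J (r n) \<le> m + 1"
        using Jr[of n] by linarith
      then show "(D (r n) ?a)\<^sup>2 \<le> (m + 1) * e n"
        using quadratic_cauchy_schwarz[OF q F r[of n] a] mult_right_mono[OF _ e_nonneg[of n]]
        by (force simp: e_def)
    qed
    ultimately show ?thesis
      using Jr[of n] by linarith
  qed
  moreover have "(\<lambda>n. m + (1 / 4) ^ n + 2 * sqrt ((m + 1) * e n) + e n)
      \<longlonglongrightarrow> m + 0 + 2 * sqrt ((m + 1) * 0) + 0"
    by (intro tendsto_intros e_lim LIMSEQ_power_zero) auto
  ultimately have Jg: "J g \<le> m"
    by (intro LIMSEQ_le_const[of _ m]) auto
  have "is_arg_min J (\<lambda>r. r \<in> F) g"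
    using gF m Jg by (force simp: is_arg_min_def not_less)
  moreover have "l2_norm (\<lambda>x. p x - s x) = 0"
    if "is_arg_min J (\<lambda>r. r \<in> F) p" "is_arg_min J (\<lambda>r. r \<in> F) s" for p s
  proof -
    have p: "p \<in> F" "J p \<le> m" and s: "s \<in> F" "J s \<le> m"
      using that gF Jg by (auto simp: is_arg_min_def not_less intro: order_trans)
    have "\<gamma> * (l2_norm (\<lambda>x. p x - s x))\<^sup>2 \<le> E (\<lambda>x. p x - s x)"
      by (intro \<gamma> closed_subspaceD(4)[OF F] p s)
    also have "\<dots> \<le> 2 * J s + 2 * J p - 4 * m"
      by (rule quadratic_near_minimizers[OF q F m s(1) p(1)])
    also have "\<dots> \<le> 0"
      using s(2) p(2) by linarith
    finally show ?thesis
      using \<gamma>(1) by (simp add: mult_le_0_iff)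
  qed
  ultimately show ?thesis
    by (auto simp: has_unique_min_def)
qed

section \<open>Lebesgue measure on the unit cube\<close>

abbreviation unit_interval :: "real measure"
  where "unit_interval \<equiv> restrict_space lborel {0..1}"

lemma borel_measurable_vec_lambda:
  fixes f :: "'a \<Rightarrow> 'd::finite \<Rightarrow> real"
  shows "(\<And>k. (\<lambda>x. f x k) \<in> borel_measurable M) \<Longrightarrow> (\<lambda>x. \<chi> k. f x k) \<in> borel_measurable M"
  by (subst borel_measurable_euclidean_space) (auto simp: Basis_vec_def inner_axis)

lemma prod_Basis_cart: "(\<Prod>b\<in>Basis. f ((x :: real ^ 'd::finite) \<bullet> b)) = (\<Prod>k\<in>UNIV. f (x $ k))"
proof -
  have B: "Basis = (\<lambda>k :: 'd. axis k (1 :: real)) ` UNIV"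
    by (auto simp: Basis_vec_def)
  have I: "inj (\<lambda>k :: 'd. axis k (1 :: real))"
    by (auto simp: inj_on_def axis_eq_axis)
  show ?thesis
    unfolding B by (subst prod.reindex[OF I]) (simp add: inner_axis)
qed

text \<open>Both measures agree on boxes. The identification makes the product-measure form of
  Fubini's theorem available for vectors.\<close>

lemma lborel_cart_eq_PiM:
  "lborel = distr (PiM (UNIV :: 'd::finite set) (\<lambda>_. lborel :: real measure)) borel (\<lambda>f. \<chi> k. f k)"
proof (rule lborel_eqI)
  interpret finite_product_sigma_finite "\<lambda>_ :: 'd. lborel :: real measure" UNIV
    by standard auto
  have m: "(\<lambda>f. \<chi> k. f k) \<in> PiM (UNIV :: 'd set) (\<lambda>_. lborel :: real measure) \<rightarrow>\<^sub>M borel"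
    by (rule borel_measurable_vec_lambda) simp
  fix l u :: "real ^ 'd" assume le: "\<And>b. b \<in> Basis \<Longrightarrow> l \<bullet> b \<le> u \<bullet> b"
  have le': "l $ k \<le> u $ k" for k
    using le[of "axis k 1"] by (simp add: inner_axis axis_in_Basis_iff)
  have "emeasure (distr (PiM UNIV (\<lambda>_. lborel)) borel (\<lambda>f. \<chi> k. f k)) (box l u)
      = emeasure (PiM UNIV (\<lambda>_. lborel)) (PiE UNIV (\<lambda>k. {l $ k<..<u $ k}))"
    by (subst emeasure_distr[OF m])
      (auto intro!: arg_cong[where f = "emeasure _"] simp: space_PiM mem_box_cart PiE_def Pi_def extensional_def)
  also have "\<dots> = (\<Prod>k\<in>UNIV. ennreal (u $ k - l $ k))"
    using le' by (subst measure_times) auto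
  also have "\<dots> = ennreal (\<Prod>k\<in>UNIV. (u - l) $ k)"
    using le' by (simp add: prod_ennreal)
  also have "\<dots> = ennreal (\<Prod>b\<in>Basis. (u - l) \<bullet> b)"
    by (simp only: prod_Basis_cart[of "\<lambda>x. x"])
  finally show "emeasure (distr (PiM UNIV (\<lambda>_. lborel)) borel (\<lambda>f. \<chi> k. f k)) (box l u)
      = (\<Prod>b\<in>Basis. (u - l) \<bullet> b)" .
qed simp

lemma indicator_unit_cube:
  "indicator unit_cube (x :: real ^ 'd::finite) = (\<Prod>k\<in>UNIV. indicator {0..1} (x $ k) :: real)"
  by (auto simp: mem_box_cart indicator_def prod_zero_iff)

lemma cube_prod:
  fixes f :: "'d::finite \<Rightarrow> real \<Rightarrow> real"
  assumes f: "\<And>k. integrable unit_interval (f k)"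
  shows "integrable cube_measure (\<lambda>x :: real ^ 'd. \<Prod>k\<in>UNIV. f k (x $ k))" (is ?int)
    and "(LINT x|cube_measure. (\<Prod>k\<in>UNIV. f k ((x :: real ^ 'd) $ k))) = (\<Prod>k\<in>UNIV. LINT t|unit_interval. f k t)" (is ?eq)
proof -
  interpret finite_product_sigma_finite "\<lambda>_ :: 'd. lborel :: real measure" UNIV
    by standard auto
  define g where "g k t = indicator {0..1} t * f k t" for k t
  have g: "integrable lborel (g k)" for k
    using f[of k] by (subst (asm) integrable_restrict_space) (simp_all add: g_def[abs_def])
  have gm [measurable]: "g k \<in> borel_measurable borel" for k
    using borel_measurable_integrable[OF g[of k]] by simp
  have m: "(\<lambda>f. \<chi> k. f k) \<in> PiM (UNIV :: 'd set) (\<lambda>_. lborel :: real measure) \<rightarrow>\<^sub>M borel"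
    by (rule borel_measurable_vec_lambda) simp
  have fg: "indicator unit_cube x * (\<Prod>k\<in>UNIV. f k (x $ k)) = (\<Prod>k\<in>UNIV. g k (x $ k))" for x :: "real ^ 'd"
    by (simp add: indicator_unit_cube g_def prod.distrib)
  have "integrable lborel (\<lambda>x :: real ^ 'd. \<Prod>k\<in>UNIV. g k (x $ k))"
    by (subst lborel_cart_eq_PiM, subst integrable_distr_eq[OF m])
      (auto intro!: product_integrable_prod g)
  then show ?int
    by (subst integrable_restrict_space) (simp_all add: fg)
  have "(LINT x|cube_measure. (\<Prod>k\<in>UNIV. f k ((x :: real ^ 'd) $ k))) = (LINT x|lborel. (\<Prod>k\<in>UNIV. g k ((x :: real ^ 'd) $ k)))"
    by (subst integral_restrict_space) (simp_all add: fg)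
  also have "\<dots> = (LINT f|PiM (UNIV :: 'd set) (\<lambda>_. lborel). (\<Prod>k\<in>UNIV. g k (f k)))"
    by (subst lborel_cart_eq_PiM, subst integral_distr[OF m]) auto
  also have "\<dots> = (\<Prod>k\<in>UNIV. LINT t|lborel. g k t)"
    by (intro product_integral_prod g) auto
  also have "\<dots> = (\<Prod>k\<in>UNIV. LINT t|unit_interval. f k t)"
    by (intro prod.cong refl, subst integral_restrict_space) (simp_all add: g_def[abs_def])
  finally show ?eq .
qed

lemma space_cube: "space cube_measure = unit_cube"
  by (simp add: space_restrict_space)

lemma measurable_cube_component [measurable]: "(\<lambda>x. x $ k) \<in> borel_measurable cube_measure"
  by (rule measurable_restrict_space1) simp

lemma prob_space_unit_interval: "prob_space unit_interval"
  by (rule prob_spaceI) (simp add: emeasure_restrict_space space_restrict_space)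

interpretation unit: prob_space unit_interval
  by (rule prob_space_unit_interval)

lemma measure_unit_interval: "measure unit_interval {0..1} = 1"
  using unit.prob_space by (simp add: space_restrict_space)

text \<open>Serves to factor the measure of a box over complementary sets of coordinates; those
  outside J contribute 1. Open intervals match the generator of open boxes used in
  \<open>distr_mix\<close>.\<close>

lemma measure_cube_box:
  fixes a b :: "real ^ 'd::finite"
  shows "measure cube_measure {x \<in> unit_cube. \<forall>k\<in>J. a $ k < x $ k \<and> x $ k < b $ k}
    = (\<Prod>k\<in>J. LINT t|unit_interval. indicator {a $ k<..<b $ k} t)"
proof -
  let ?A = "{x \<in> unit_cube. \<forall>k\<in>J. a $ k < x $ k \<and> x $ k < b $ k}"
  define f where "f k = (if k \<in> J then indicator {a $ k<..<b $ k} else (\<lambda>t. 1 :: real))" for k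
  have "{x \<in> space cube_measure. \<forall>k\<in>J. a $ k < x $ k \<and> x $ k < b $ k} \<in> sets cube_measure"
    by measurable
  then have A: "?A \<in> sets cube_measure"
    by (simp add: space_cube)
  have m: "f k \<in> borel_measurable unit_interval" for k
    by (auto simp: f_def intro!: measurable_restrict_space1)
  have "measure cube_measure ?A = (LINT x|cube_measure. indicator ?A x)"
    using sets.sets_into_space[OF A] by (simp add: Int_absorb2)
  also have "\<dots> = (LINT x|cube_measure. (\<Prod>k\<in>UNIV. f k (x $ k)))"
    by (intro Bochner_Integration.integral_cong)
      (auto simp: space_cube f_def indicator_def prod_zero_iff intro!: prod.neutral)
  also have "\<dots> = (\<Prod>k\<in>UNIV. LINT t|unit_interval. f k t)"
    by (intro cube_prod unit.integrable_const_bound[where B = 1] m) (auto simp: f_def indicator_def)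
  also have "\<dots> = (\<Prod>k\<in>J. LINT t|unit_interval. f k t)"
    by (rule prod.mono_neutral_right) (auto simp: f_def measure_unit_interval)
  also have "\<dots> = (\<Prod>k\<in>J. LINT t|unit_interval. indicator {a $ k<..<b $ k} t)"
    by (intro prod.cong) (auto simp: f_def)
  finally show ?thesis .
qed

text \<open>Splices two points without leaving the vector type. For two independent uniform points,
  conditioning on the coordinates in J becomes integration over \<open>snd p\<close>.\<close>

definition mix :: "'d set \<Rightarrow> (real ^ 'd) \<times> (real ^ 'd) \<Rightarrow> real ^ 'd::finite"
  where "mix J p = (\<chi> k. if k \<in> J then fst p $ k else snd p $ k)"

lemma mix_nth: "mix J p $ k = (if k \<in> J then fst p $ k else snd p $ k)"
  by (simp add: mix_def)

lemma mix_UNIV: "mix UNIV p = fst p" and mix_empty: "mix {} p = snd p"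
  by (simp_all add: mix_def)

lemma measurable_mix [measurable]: "mix J \<in> cube_measure \<Otimes>\<^sub>M cube_measure \<rightarrow>\<^sub>M cube_measure"
proof (rule measurable_restrict_space2)
  show "mix J \<in> space (cube_measure \<Otimes>\<^sub>M cube_measure) \<rightarrow> unit_cube"
    by (auto simp: space_pair_measure space_cube mix_def mem_box_cart)
  have "mix J \<in> borel_measurable (cube_measure \<Otimes>\<^sub>M cube_measure)"
    unfolding mix_def
    by (intro borel_measurable_vec_lambda) measurable
  then show "mix J \<in> cube_measure \<Otimes>\<^sub>M cube_measure \<rightarrow>\<^sub>M lborel"
    by simp
qed

text \<open>A point spliced from two independent uniform points is again uniform: the preimage of a
  box is a rectangle, whose sides involve the coordinates in J and in its complement,
  respectively.\<close>

lemma distr_mix: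
  fixes J :: "'d::finite set"
  shows "distr (cube_measure \<Otimes>\<^sub>M cube_measure) cube_measure (mix J) = cube_measure"
proof -
  let ?P = "cube_measure \<Otimes>\<^sub>M (cube_measure :: (real ^ 'd) measure)"
  interpret P: pair_prob_space "cube_measure :: (real ^ 'd) measure" "cube_measure :: (real ^ 'd) measure"
    by (simp add: pair_prob_space_def pair_sigma_finite_def cube.sigma_finite_measure_axioms prob_space_cube)
  have id: "(\<lambda>x. x) \<in> cube_measure \<rightarrow>\<^sub>M borel"
    by (rule measurable_restrict_space1) simp
  have mb: "mix J \<in> ?P \<rightarrow>\<^sub>M borel"
    using measurable_compose[OF measurable_mix[of J] id] by simp
  \<comment> \<open>The comparison is made on the whole space, where open boxes form an
    intersection-stable generator with an exhausting sequence.\<close>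
  have eq: "distr ?P borel (mix J) = distr cube_measure borel (\<lambda>x. x)"
  proof (rule measure_eqI_generator_eq)
    let ?E = "range (\<lambda>(a, b). box a b :: (real ^ 'd) set)"
    show "Int_stable ?E"
      by (auto simp: Int_stable_def box_Int_box)
    show "?E \<subseteq> Pow UNIV" "sets (distr ?P borel (mix J)) = sigma_sets UNIV ?E"
      "sets (distr cube_measure borel (\<lambda>x :: real ^ 'd. x)) = sigma_sets UNIV ?E"
      by (simp_all add: borel_eq_box)
    let ?A = "\<lambda>n::nat. box (- (real n *\<^sub>R One)) (real n *\<^sub>R One) :: (real ^ 'd) set"
    show "range ?A \<subseteq> ?E" "(\<Union>i. ?A i) = UNIV"
      unfolding UN_box_eq_UNIV by auto
    interpret D: prob_space "distr ?P borel (mix J)"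
      by (rule P.prob_space_distr[OF mb])
    show "emeasure (distr ?P borel (mix J)) (?A i) \<noteq> \<infinity>" for i
      by simp
    fix X assume "X \<in> ?E"
    then obtain a b where X: "X = box a b"
      by auto
    define B where "B I = {x \<in> unit_cube. \<forall>k\<in>I. a $ k < x $ k \<and> x $ k < b $ k}" for I
    have "{x \<in> space cube_measure. \<forall>k\<in>I. a $ k < x $ k \<and> x $ k < b $ k} \<in> sets cube_measure" for I
      by measurable
    then have B: "B I \<in> sets cube_measure" for I
      by (simp add: space_cube B_def)
    have "emeasure (distr ?P borel (mix J)) X = emeasure ?P (mix J -` X \<inter> space ?P)"
      by (rule emeasure_distr[OF mb]) (simp add: X)
    also have "mix J -` X \<inter> space ?P = B J \<times> B (- J)"
      by (auto simp: X B_def space_pair_measure space_cube mem_box_cart mix_nth split: if_splits)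
    also have "emeasure ?P \<dots> = emeasure cube_measure (B J) * emeasure cube_measure (B (- J))"
      by (rule cube.emeasure_pair_measure_Times[OF B B])
    also have "\<dots> = ennreal (measure cube_measure (B J) * measure cube_measure (B (- J)))"
      by (simp add: cube.emeasure_eq_measure ennreal_mult)
    also have "measure cube_measure (B J) * measure cube_measure (B (- J)) = measure cube_measure (B UNIV)"
      unfolding B_def measure_cube_box by (subst prod.union_disjoint[symmetric]) auto
    also have "ennreal (measure cube_measure (B UNIV)) = emeasure cube_measure (B UNIV)"
      by (simp add: cube.emeasure_eq_measure)
    also have "B UNIV = (\<lambda>x. x) -` X \<inter> space cube_measure"
      by (auto simp: X B_def mem_box_cart space_cube)
    also have "emeasure cube_measure \<dots> = emeasure (distr cube_measure borel (\<lambda>x. x)) X"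
      by (rule emeasure_distr[OF id, symmetric]) (simp add: X)
    finally show "emeasure (distr ?P borel (mix J)) X = emeasure (distr cube_measure borel (\<lambda>x. x)) X" .
  qed
  show ?thesis
  proof (rule measure_eqI)
    fix A assume "A \<in> sets (distr ?P cube_measure (mix J))"
    then have A: "A \<in> sets cube_measure"
      by simp
    then have Ab: "A \<in> sets borel"
      by (simp add: sets_restrict_space_iff)
    have "emeasure (distr ?P cube_measure (mix J)) A = emeasure (distr ?P borel (mix J)) A"
      by (simp add: emeasure_distr[OF mb Ab] emeasure_distr[OF measurable_mix A])
    also have "\<dots> = emeasure cube_measure A"
      using sets.sets_into_space[OF A]
      by (simp add: eq emeasure_distr[OF id Ab] Int_absorb2)
    finally show "emeasure (distr ?P cube_measure (mix J)) A = emeasure cube_measure A" .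
  qed simp
qed

section \<open>Additive functions\<close>

interpretation cube_pair: pair_prob_space "cube_measure :: (real ^ 'd::finite) measure"
    "cube_measure :: (real ^ 'd::finite) measure"
  by (simp add: pair_prob_space_def pair_sigma_finite_def cube.sigma_finite_measure_axioms prob_space_cube)

lemma measure_unit_cube: "measure cube_measure (unit_cube :: (real ^ 'd::finite) set) = 1"
  using prob_space.prob_space[OF prob_space_cube] by (simp add: space_cube)

lemma AE_mix:
  assumes "AE x in cube_measure. P x"
  shows "AE p in cube_measure \<Otimes>\<^sub>M cube_measure. P (mix J p)"
  by (rule AE_distrD[OF measurable_mix]) (simp only: distr_mix assms)

lemma sq_integrable_mix:
  assumes "sq_integrable cube_measure r"
  shows "sq_integrable (cube_measure \<Otimes>\<^sub>M cube_measure) (\<lambda>p. r (mix J p))"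
    and "(LINT p|(cube_measure \<Otimes>\<^sub>M cube_measure). (r (mix J p))\<^sup>2) = (LINT x|cube_measure. (r x)\<^sup>2)"
proof -
  have r [measurable]: "r \<in> borel_measurable cube_measure"
    by (rule sq_integrable_measurable[OF assms])
  have "integrable (distr (cube_measure \<Otimes>\<^sub>M cube_measure) cube_measure (mix J)) (\<lambda>x. (r x)\<^sup>2)"
    using assms by (simp add: distr_mix sq_integrable_def)
  then show "sq_integrable (cube_measure \<Otimes>\<^sub>M cube_measure) (\<lambda>p. r (mix J p))"
    by (simp add: sq_integrable_def integrable_distr_eq)
  have "(LINT x|cube_measure. (r x)\<^sup>2)
      = (LINT x|distr (cube_measure \<Otimes>\<^sub>M cube_measure) cube_measure (mix J). (r x)\<^sup>2)"
    by (simp add: distr_mix)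
  also have "\<dots> = (LINT p|(cube_measure \<Otimes>\<^sub>M cube_measure). (r (mix J p))\<^sup>2)"
    by (rule integral_distr) auto
  finally show "(LINT p|(cube_measure \<Otimes>\<^sub>M cube_measure). (r (mix J p))\<^sup>2) = (LINT x|cube_measure. (r x)\<^sup>2)" ..
qed

text \<open>The index set J lets one notion serve both r^0 (\<open>J = UNIV\<close>) and r^k
  (\<open>J = {k}\<close>). The summands are arbitrary functions, as in
  \<open>F_add\<close>.\<close>

definition additive_on :: "'d set \<Rightarrow> (real ^ 'd::finite \<Rightarrow> real) \<Rightarrow> bool"
  where "additive_on J r \<longleftrightarrow> (\<exists>g. AE x in cube_measure. r x = (\<Sum>k\<in>J. g k (x $ k)))"

text \<open>
  A function is additive iff replacing the coordinates in J of z by those of x, one at a time,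
  changes its value by increments that sum up to r x - r z. Unlike the definition, this condition
  involves no unknown (possibly nonmeasurable) component functions.
\<close>

definition additivity_defect :: "'d set \<Rightarrow> (real ^ 'd::finite \<Rightarrow> real) \<Rightarrow> (real ^ 'd) \<times> (real ^ 'd) \<Rightarrow> real"
  where "additivity_defect J r p = r (fst p) - r (snd p) - (\<Sum>k\<in>J. r (mix {k} p) - r (snd p))"

text \<open>Splicing in coordinate k changes only the summand \<open>g k\<close>, and these changes
  add up. The almost-everywhere representation passes to spliced points by \<open>AE_mix\<close>,
  without measurability of g.\<close>

lemma additivity_defect_AE:
  assumes "additive_on J r"
  shows "AE p in cube_measure \<Otimes>\<^sub>M cube_measure. additivity_defect J r p = 0"
proof -
  obtain g where g: "AE x in cube_measure. r x = (\<Sum>k\<in>J. g k (x $ k))"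
    using assms by (auto simp: additive_on_def)
  have "AE p in cube_measure \<Otimes>\<^sub>M cube_measure. \<forall>k\<in>J. r (mix {k} p) = (\<Sum>j\<in>J. g j (mix {k} p $ j))"
    by (intro AE_finite_allI AE_mix[OF g]) auto
  then show ?thesis
    using AE_mix[OF g, of UNIV] AE_mix[OF g, of "{}"]
  proof eventually_elim
    case (elim p)
    have "r (mix {k} p) - r (snd p) = g k (fst p $ k) - g k (snd p $ k)" if "k \<in> J" for k
    proof -
      have "(\<Sum>j\<in>J. g j (mix {k} p $ j)) = g k (fst p $ k) + (\<Sum>j\<in>J - {k}. g j (snd p $ j))"
        using that by (subst sum.remove[of J k]) (auto simp: mix_nth intro!: sum.cong)
      moreover have "(\<Sum>j\<in>J. g j (snd p $ j)) = g k (snd p $ k) + (\<Sum>j\<in>J - {k}. g j (snd p $ j))"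
        using that by (intro sum.remove) auto
      ultimately show ?thesis
        using elim that by (simp add: mix_empty)
    qed
    then have "(\<Sum>k\<in>J. r (mix {k} p) - r (snd p)) = (\<Sum>k\<in>J. g k (fst p $ k) - g k (snd p $ k))"
      by (intro sum.cong) auto
    then show ?case
      using elim by (simp add: additivity_defect_def mix_empty mix_UNIV sum_subtractf)
  qed
qed

text \<open>Integrating the vanishing defect over z gives r x = m + sum of (e k x - m), where
  \<open>e k\<close> is the conditional mean of r given coordinate k. These means are measurable,
  depend on one coordinate only, and are bounded in L2 by Jensen's inequality.\<close>

lemma additive_components:
  fixes r :: "real ^ 'd::finite \<Rightarrow> real"
  assumes r: "sq_integrable cube_measure r" and J: "J \<noteq> {}"
    and defect: "AE p in cube_measure \<Otimes>\<^sub>M cube_measure. additivity_defect J r p = 0"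
  shows "\<exists>g. (\<forall>k. g k \<in> borel_measurable borel) \<and>
    (\<forall>k. sq_integrable cube_measure (\<lambda>x. g k (x $ k)) \<and>
      (LINT x|cube_measure. (g k (x $ k))\<^sup>2) \<le> 4 * (LINT x|cube_measure. (r x)\<^sup>2)) \<and>
    (AE x in cube_measure. r x = (\<Sum>k\<in>J. g k (x $ k)))"
proof -
  let ?C = "cube_measure :: (real ^ 'd) measure"
  define m where "m = (LINT z|?C. r z)"
  define e where "e k x = (LINT z|?C. r (mix {k} (x, z)))" for k x
  \<comment> \<open>The constants left over, m * (1 - card J) in total, are spread evenly over the
    summands; hence J must be nonempty.\<close>
  define c where "c = 1 - 1 / real (card J)"
  define G where "G k x = e k x - c * m" for k x
  have cJ: "0 < card J"
    using J by (simp add: card_gt_0_iff)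
  have c: "0 \<le> c" "c \<le> 1"
    using cJ by (simp_all add: c_def)
  have rm [measurable]: "r \<in> borel_measurable ?C"
    by (rule sq_integrable_measurable[OF r])
  have mixm: "(\<lambda>p. r (mix {k} p)) \<in> borel_measurable (?C \<Otimes>\<^sub>M ?C)" for k
    by measurable
  have em [measurable]: "e k \<in> borel_measurable ?C" for k
    unfolding e_def by (rule cube.borel_measurable_lebesgue_integral) (simp add: mixm)
  have sq: "AE x in ?C. integrable ?C (\<lambda>z. (r (mix {k} (x, z)))\<^sup>2)" for k
    using sq_integrableD[OF sq_integrable_mix(1)[OF r, of "{k}"]]
    by (rule cube_pair.AE_integrable_fst')
  have sqi: "AE x in ?C. sq_integrable ?C (\<lambda>z. r (mix {k} (x, z)))" for k
    using sq[of k] AE_space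
  proof eventually_elim
    case (elim x)
    have "(\<lambda>z. r (mix {k} (x, z))) \<in> borel_measurable ?C"
      using measurable_Pair2[OF mixm elim(2)] by simp
    with elim(1) show ?case
      by (simp add: sq_integrable_def)
  qed
  have e_sq: "sq_integrable ?C (e k)" "(LINT x|?C. (e k x)\<^sup>2) \<le> (LINT x|?C. (r x)\<^sup>2)" for k
  proof -
    let ?R = "\<lambda>x. LINT z|?C. (r (mix {k} (x, z)))\<^sup>2"
    have R: "integrable ?C ?R"
      using sq_integrableD[OF sq_integrable_mix(1)[OF r, of "{k}"]]
      by (rule cube_pair.integrable_fst')
    have le: "AE x in ?C. (e k x)\<^sup>2 \<le> ?R x"
      using sqi[of k] by eventually_elim (auto simp: e_def intro: cube.square_integral_le)
    have int: "integrable ?C (\<lambda>x. (e k x)\<^sup>2)"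
      using R by (rule Bochner_Integration.integrable_bound) (use le in \<open>auto elim!: eventually_mono\<close>)
    then show "sq_integrable ?C (e k)"
      by (simp add: sq_integrable_def em)
    have "(LINT x|?C. (e k x)\<^sup>2) \<le> (LINT x|?C. ?R x)"
      by (intro integral_mono_AE int R le)
    also have "\<dots> = (LINT p|(?C \<Otimes>\<^sub>M ?C). (r (mix {k} p))\<^sup>2)"
      using cube_pair.integral_fst'[OF sq_integrableD[OF sq_integrable_mix(1)[OF r, of "{k}"]]] by simp
    also have "\<dots> = (LINT x|?C. (r x)\<^sup>2)"
      by (rule sq_integrable_mix[OF r])
    finally show "(LINT x|?C. (e k x)\<^sup>2) \<le> (LINT x|?C. (r x)\<^sup>2)" .
  qed
  have Gm [measurable]: "G k \<in> borel_measurable ?C" for k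
    unfolding G_def by simp
  have G_sq: "sq_integrable ?C (G k)" for k
    unfolding G_def by (intro sq_integrable_diff e_sq cube.sq_integrable_const)
  have G_le: "(LINT x|?C. (G k x)\<^sup>2) \<le> 4 * (LINT x|?C. (r x)\<^sup>2)" for k
  proof -
    \<comment> \<open>Both squares integrate to at most the integral of r^2, whence the factor
      4.\<close>
    have "(G k x)\<^sup>2 \<le> 2 * (e k x)\<^sup>2 + 2 * m\<^sup>2" for x
    proof -
      have "(G k x)\<^sup>2 \<le> 2 * (e k x)\<^sup>2 + 2 * (c * m)\<^sup>2"
        using zero_le_power2[of "e k x + c * m"] by (simp add: G_def power2_eq_square algebra_simps)
      moreover have "(c * m)\<^sup>2 \<le> 1 * m\<^sup>2"
        unfolding power_mult_distrib by (intro mult_right_mono power_le_one c) auto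
      ultimately show ?thesis
        by linarith
    qed
    then have "(LINT x|?C. (G k x)\<^sup>2) \<le> (LINT x|?C. 2 * (e k x)\<^sup>2 + 2 * m\<^sup>2)"
      using sq_integrableD[OF G_sq] sq_integrableD[OF e_sq(1)] by (intro integral_mono) auto
    also have "\<dots> = 2 * (LINT x|?C. (e k x)\<^sup>2) + 2 * m\<^sup>2"
      using sq_integrableD[OF e_sq(1)] by (simp add: measure_unit_cube space_cube)
    also have "\<dots> \<le> 4 * (LINT x|?C. (r x)\<^sup>2)"
      using e_sq(2)[of k] cube.square_integral_le[OF r] by (simp add: m_def)
    finally show ?thesis .
  qed
  \<comment> \<open>Since \<open>G k\<close> depends on its k-th coordinate only, it may be read off
    on the diagonal, which depends measurably on t.\<close>
  define g where "g k t = (if t \<in> {0..1} then G k (\<chi> j. t) else 0)" for k t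
  have gG: "g k (x $ k) = G k x" if "x \<in> unit_cube" for k x
  proof -
    have "mix {k} (\<chi> j. x $ k, z) = mix {k} (x, z)" for z
      by (simp add: mix_def vec_eq_iff)
    then show ?thesis
      using that by (simp add: g_def G_def e_def mem_box_cart)
  qed
  have "g k \<in> borel_measurable borel" for k
  proof -
    have "(\<lambda>t :: real. (\<chi> j. t) :: real ^ 'd) \<in> restrict_space borel {0..1} \<rightarrow>\<^sub>M ?C"
      by (rule measurable_restrict_space2)
        (auto simp: mem_box_cart space_restrict_space intro!: borel_measurable_vec_lambda measurable_restrict_space1)
    then have "(\<lambda>t. G k (\<chi> j. t)) \<in> borel_measurable (restrict_space borel {0..1})"
      by (rule measurable_compose) simp
    moreover have "{t :: real. 0 \<le> t \<and> t \<le> 1} = {0..1}"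
      by auto
    ultimately show ?thesis
      unfolding g_def by (subst measurable_If_restrict_space_iff) auto
  qed
  moreover have "sq_integrable ?C (\<lambda>x. g k (x $ k))
    \<and> (LINT x|?C. (g k (x $ k))\<^sup>2) \<le> 4 * (LINT x|?C. (r x)\<^sup>2)" for k
  proof -
    have "sq_integrable ?C (\<lambda>x. g k (x $ k)) \<longleftrightarrow> sq_integrable ?C (G k)"
      unfolding sq_integrable_def
      by (intro arg_cong2[where f = conj] measurable_cong Bochner_Integration.integrable_cong)
        (auto simp: space_cube gG)
    moreover have "(LINT x|?C. (g k (x $ k))\<^sup>2) = (LINT x|?C. (G k x)\<^sup>2)"
      by (intro Bochner_Integration.integral_cong) (auto simp: space_cube gG)
    ultimately show ?thesis
      using G_sq G_le by simp
  qed
  moreover have "AE x in ?C. r x = (\<Sum>k\<in>J. g k (x $ k))"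
  proof -
    have "AE x in ?C. \<forall>k\<in>J. sq_integrable ?C (\<lambda>z. r (mix {k} (x, z)))"
      by (intro AE_finite_allI sqi) auto
    then show ?thesis
      using cube_pair.AE_pair[OF defect] AE_space
    proof eventually_elim
      case (elim x)
      have ri: "integrable ?C r"
        by (rule cube.sq_integrable_integrable[OF r])
      have mi: "integrable ?C (\<lambda>z. r (mix {k} (x, z)))" if "k \<in> J" for k
        using elim(1) that by (intro cube.sq_integrable_integrable) auto
      have "r x = (LINT z|?C. r x)"
        by (simp add: measure_unit_cube space_cube)
      also have "\<dots> = (LINT z|?C. r z + (\<Sum>k\<in>J. r (mix {k} (x, z)) - r z))"
        using elim(2) ri mi
        by (intro integral_cong_AE)
          (auto simp: additivity_defect_def intro!: borel_measurable_sum borel_measurable_diff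
            borel_measurable_add borel_measurable_integrable)
      also have "\<dots> = m + (\<Sum>k\<in>J. e k x - m)"
        using ri mi by (simp add: m_def e_def)
      also have "\<dots> = (\<Sum>k\<in>J. G k x)"
        using cJ J by (simp add: G_def c_def sum_subtractf sum.distrib algebra_simps)
      also have "\<dots> = (\<Sum>k\<in>J. g k (x $ k))"
        using elim(3) by (intro sum.cong) (simp_all add: gG space_cube)
      finally show ?case .
    qed
  qed
  ultimately show ?thesis
    by (intro exI[of _ g]) blast
qed

text \<open>The defect is a linear combination of spliced copies of r, all with the same L2 norm as
  r. It is therefore L2-continuous in r, which is what the closedness proof needs; the size of the
  constant is immaterial.\<close>

lemma integral_additivity_defect_le:
  fixes r :: "real ^ 'd::finite \<Rightarrow> real"
  assumes r: "sq_integrable cube_measure r"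
  defines "P \<equiv> cube_measure \<Otimes>\<^sub>M cube_measure"
  shows "sq_integrable P (additivity_defect J r)"
    and "(LINT p|P. (additivity_defect J r p)\<^sup>2) \<le> 3 * (1 + (real (card J) + 1)\<^sup>2 + (real (card J))\<^sup>2) * (LINT x|cube_measure. (r x)\<^sup>2)"
proof -
  let ?N = "real (card J)" and ?I = "(LINT x|cube_measure. (r x)\<^sup>2)"
  have s: "sq_integrable P (\<lambda>p. r (mix I p))" "(LINT p|P. (r (mix I p))\<^sup>2) = ?I" for I
    using sq_integrable_mix[OF r] by (simp_all add: P_def)
  have eq: "additivity_defect J r p = r (mix UNIV p) + (?N - 1) * r (mix {} p) - (\<Sum>k\<in>J. r (mix {k} p))" for p
    by (simp add: additivity_defect_def mix_UNIV mix_empty sum_subtractf algebra_simps)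
  show sqd: "sq_integrable P (additivity_defect J r)"
    unfolding eq[abs_def] by (intro sq_integrable_add sq_integrable_diff sq_integrable_cmult sq_integrable_sum s)
  have "(additivity_defect J r p)\<^sup>2 \<le> 3 * ((r (mix UNIV p))\<^sup>2 + (?N + 1)\<^sup>2 * (r (mix {} p))\<^sup>2 + ?N * (\<Sum>k\<in>J. (r (mix {k} p))\<^sup>2))" for p
  proof -
    have three: "(a + b - c)\<^sup>2 \<le> 3 * (a\<^sup>2 + b\<^sup>2 + c\<^sup>2)" for a b c :: real
      using zero_le_power2[of "a - b"] zero_le_power2[of "a + c"] zero_le_power2[of "b + c"]
      by (simp add: power2_eq_square algebra_simps)
    have "((?N - 1) * r (mix {} p))\<^sup>2 \<le> (?N + 1)\<^sup>2 * (r (mix {} p))\<^sup>2"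
      unfolding power_mult_distrib by (intro mult_right_mono) (auto simp: power2_eq_square algebra_simps)
    moreover have "(\<Sum>k\<in>J. r (mix {k} p))\<^sup>2 \<le> ?N * (\<Sum>k\<in>J. (r (mix {k} p))\<^sup>2)"
      using Cauchy_Schwarz_ineq_sum[of "\<lambda>_. 1" "\<lambda>k. r (mix {k} p)" J] by simp
    moreover note three[of "r (mix UNIV p)" "(?N - 1) * r (mix {} p)" "\<Sum>k\<in>J. r (mix {k} p)"]
    ultimately show ?thesis
      unfolding eq distrib_left by linarith
  qed
  then have "(LINT p|P. (additivity_defect J r p)\<^sup>2)
      \<le> (LINT p|P. 3 * ((r (mix UNIV p))\<^sup>2 + (?N + 1)\<^sup>2 * (r (mix {} p))\<^sup>2 + ?N * (\<Sum>k\<in>J. (r (mix {k} p))\<^sup>2)))"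
    using sq_integrableD[OF s(1)] sq_integrableD[OF sqd] by (intro integral_mono) auto
  also have "\<dots> = 3 * (?I + (?N + 1)\<^sup>2 * ?I + ?N * (\<Sum>k\<in>J. ?I))"
    using sq_integrableD[OF s(1)] by (simp add: s(2))
  also have "\<dots> = 3 * (1 + (?N + 1)\<^sup>2 + ?N\<^sup>2) * ?I"
    by (simp add: algebra_simps power2_eq_square)
  finally show "(LINT p|P. (additivity_defect J r p)\<^sup>2) \<le> 3 * (1 + (?N + 1)\<^sup>2 + ?N\<^sup>2) * ?I" .
qed

text \<open>The given summands of \<open>r n\<close> need not converge, or even be measurable, so
  the limit is taken in the defect instead: it vanishes along the sequence, hence for g, and
  \<open>additive_components\<close> converts this back.\<close>

lemma additive_on_closed:
  fixes g :: "real ^ 'd::finite \<Rightarrow> real"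
  assumes r: "\<And>n. sq_integrable cube_measure (r n)" "\<And>n. additive_on J (r n)"
    and g: "sq_integrable cube_measure g" and J: "J \<noteq> {}"
    and lim: "(\<lambda>n. LINT x|cube_measure. (r n x - g x)\<^sup>2) \<longlonglongrightarrow> 0"
  shows "additive_on J g"
proof -
  let ?P = "cube_measure \<Otimes>\<^sub>M cube_measure :: ((real ^ 'd) \<times> (real ^ 'd)) measure"
  let ?c = "3 * (1 + (real (card J) + 1)\<^sup>2 + (real (card J))\<^sup>2)"
  note sqd = integral_additivity_defect_le(1)
  have "(LINT p|?P. (additivity_defect J g p)\<^sup>2) \<le> ?c * (LINT x|cube_measure. (r n x - g x)\<^sup>2)" for n
  proof -
    have "additivity_defect J (\<lambda>x. r n x - g x) p = additivity_defect J (r n) p - additivity_defect J g p" for p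
      by (simp add: additivity_defect_def sum_subtractf sum.distrib algebra_simps)
    then have "(LINT p|?P. (additivity_defect J g p)\<^sup>2) = (LINT p|?P. (additivity_defect J (\<lambda>x. r n x - g x) p)\<^sup>2)"
      using additivity_defect_AE[OF r(2)[of n]] sqd[OF g, of J] sqd[OF r(1)[of n], of J]
      by (intro integral_cong_AE)
        (auto intro!: borel_measurable_power borel_measurable_diff dest: sq_integrable_measurable elim!: eventually_mono)
    also have "\<dots> \<le> ?c * (LINT x|cube_measure. (r n x - g x)\<^sup>2)"
      by (intro integral_additivity_defect_le sq_integrable_diff r g)
    finally show ?thesis .
  qed
  moreover have "(\<lambda>n. ?c * (LINT x|cube_measure. (r n x - g x)\<^sup>2)) \<longlonglongrightarrow> ?c * 0"
    by (intro tendsto_intros lim)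
  ultimately have "(LINT p|?P. (additivity_defect J g p)\<^sup>2) \<le> 0"
    by (intro LIMSEQ_le_const[where X = "\<lambda>n. ?c * (LINT x|cube_measure. (r n x - g x)\<^sup>2)"]) auto
  moreover have "0 \<le> (LINT p|?P. (additivity_defect J g p)\<^sup>2)"
    by simp
  ultimately have "(LINT p|?P. (additivity_defect J g p)\<^sup>2) = 0"
    by (rule antisym)
  then have "AE p in ?P. additivity_defect J g p = 0"
    using integral_nonneg_eq_0_iff_AE[OF sq_integrableD[OF sqd[OF g, of J]]] by simp
  from additive_components[OF g J this] show ?thesis
    unfolding additive_on_def by blast
qed

lemma F_add_iff:
  "r \<in> F_add \<longleftrightarrow> r \<in> F_full \<and> additive_on UNIV (\<lambda>x. r x $ None) \<and> (\<forall>k. additive_on {k} (\<lambda>x. r x $ Some k))"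
proof -
  have "(\<exists>g :: 'a \<Rightarrow> real \<Rightarrow> real. AE x in cube_measure. r x $ Some k = g k (x $ k))
      \<longleftrightarrow> (\<exists>g :: real \<Rightarrow> real. AE x in cube_measure. r x $ Some k = g (x $ k))" for k
  proof
    assume "\<exists>g :: 'a \<Rightarrow> real \<Rightarrow> real. AE x in cube_measure. r x $ Some k = g k (x $ k)"
    then obtain g :: "'a \<Rightarrow> real \<Rightarrow> real" where "AE x in cube_measure. r x $ Some k = g k (x $ k)" ..
    then show "\<exists>g :: real \<Rightarrow> real. AE x in cube_measure. r x $ Some k = g (x $ k)"
      by (intro exI[of _ "g k"])
  next
    assume "\<exists>g :: real \<Rightarrow> real. AE x in cube_measure. r x $ Some k = g (x $ k)"
    then obtain g :: "real \<Rightarrow> real" where "AE x in cube_measure. r x $ Some k = g (x $ k)" ..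
    then show "\<exists>g :: 'a \<Rightarrow> real \<Rightarrow> real. AE x in cube_measure. r x $ Some k = g k (x $ k)"
      by (intro exI[of _ "\<lambda>_. g"])
  qed
  then show ?thesis
    by (simp add: F_add_def additive_on_def)
qed

lemma additive_on_axpy:
  assumes "additive_on J r" "additive_on J a"
  shows "additive_on J (\<lambda>x. r x + t * a x)"
proof -
  obtain g b where "AE x in cube_measure. r x = (\<Sum>k\<in>J. g k (x $ k))"
    "AE x in cube_measure. a x = (\<Sum>k\<in>J. b k (x $ k))"
    using assms by (auto simp: additive_on_def)
  then have "AE x in cube_measure. r x + t * a x = (\<Sum>k\<in>J. g k (x $ k) + t * b k (x $ k))"
    by eventually_elim (simp add: sum.distrib sum_distrib_left)
  then show ?thesis
    unfolding additive_on_def by (intro exI[of _ "\<lambda>k s. g k s + t * b k s"])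
qed

lemma closed_subspace_F_add: "closed_subspace (F_add :: ('d::finite) tuple_fun set)"
proof -
  have "additive_on J (\<lambda>x. 0)" for J :: "'d set"
    unfolding additive_on_def by (intro exI[of _ "\<lambda>_ _. 0"]) simp
  then have "(\<lambda>x. 0) \<in> (F_add :: 'd tuple_fun set)"
    by (simp add: F_add_iff F_full_0)
  moreover have "(\<lambda>x. r x + t *\<^sub>R a x) \<in> F_add" if "r \<in> F_add" "a \<in> F_add" for r a :: "'d tuple_fun" and t
    using that by (simp add: F_add_iff F_full_axpy additive_on_axpy)
  moreover have "F_add \<subseteq> (F_full :: 'd tuple_fun set)"
    by (auto simp: F_add_iff)
  moreover have "g \<in> F_add" if r: "\<And>n. r n \<in> F_add" and g: "g \<in> F_full"
    and lim: "(\<lambda>n. l2_norm (\<lambda>x. r n x - g x)) \<longlonglongrightarrow> 0" for r :: "nat \<Rightarrow> 'd tuple_fun" and g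
  proof -
    have rF: "r n \<in> F_full" for n
      using r by (simp add: F_add_iff)
    have lim_comp: "(\<lambda>n. LINT x|cube_measure. (r n x $ l - g x $ l)\<^sup>2) \<longlonglongrightarrow> 0" for l
    proof (rule tendsto_sandwich[where f = "\<lambda>_. 0"])
      have "(LINT x|cube_measure. (r n x $ l - g x $ l)\<^sup>2) \<le> (l2_norm (\<lambda>x. r n x - g x))\<^sup>2" for n
        unfolding l2_norm_def real_sqrt_pow2[OF sum_nonneg[OF integral_nonneg_AE[OF AE_I2[OF zero_le_power2]]]]
        by (simp, rule member_le_sum) auto
      then show "\<forall>\<^sub>F n in sequentially. (LINT x|cube_measure. (r n x $ l - g x $ l)\<^sup>2) \<le> (l2_norm (\<lambda>x. r n x - g x))\<^sup>2"
        by simp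
      have "(\<lambda>n. (l2_norm (\<lambda>x. r n x - g x))\<^sup>2) \<longlonglongrightarrow> 0\<^sup>2"
        by (intro tendsto_intros lim)
      then show "(\<lambda>n. (l2_norm (\<lambda>x. r n x - g x))\<^sup>2) \<longlonglongrightarrow> 0"
        by simp
    qed auto
    show ?thesis
      unfolding F_add_iff
    proof (intro conjI allI)
      show "additive_on UNIV (\<lambda>x. g x $ None)"
        using r rF g by (intro additive_on_closed[OF _ _ _ _ lim_comp]) (auto simp: F_add_iff F_full_iff)
      show "additive_on {k} (\<lambda>x. g x $ Some k)" for k
        using r rF g by (intro additive_on_closed[OF _ _ _ _ lim_comp]) (auto simp: F_add_iff F_full_iff)
    qed (rule g)
  qed
  ultimately show ?thesis
    unfolding closed_subspace_def by (intro conjI ballI allI impI) blast+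
qed

section \<open>The orthogonal projection onto the additive functions\<close>

lemma quadratic_on_dist:
  assumes "r \<in> F_full"
  shows "quadratic_on F_full (\<lambda>p. (l2_norm (\<lambda>x. r x - p x))\<^sup>2)
    (\<lambda>p a. - l2_inner (\<lambda>x. r x - p x) a) (\<lambda>a. (l2_norm a)\<^sup>2)"
proof -
  have "(l2_norm (\<lambda>x. r x - (p x + t *\<^sub>R a x)))\<^sup>2
      = (l2_norm (\<lambda>x. r x - p x))\<^sup>2 + 2 * t * (- l2_inner (\<lambda>x. r x - p x) a) + t\<^sup>2 * (l2_norm a)\<^sup>2"
    if "p \<in> F_full" "a \<in> F_full" for p a t
  proof -
    have "(\<lambda>x. r x - (p x + t *\<^sub>R a x)) = (\<lambda>x. (r x - p x) + (- t) *\<^sub>R a x)"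
      by (simp add: fun_eq_iff algebra_simps)
    then show ?thesis
      using l2_norm_axpy[OF F_full_diff[OF assms that(1)] that(2), of "- t"] by simp
  qed
  then show ?thesis
    by (simp add: quadratic_on_def)
qed

text \<open>The projection exists as the minimizer of the distance over the closed subspace
  \<open>F_add\<close>; stationarity of this minimizer is orthogonality. This justifies the choice
  in the definition of \<open>P_add\<close>.\<close>

lemma P_add:
  assumes r: "r \<in> F_full"
  shows P_add_mem: "P_add r \<in> F_add"
    and P_add_orthogonal: "q \<in> F_add \<Longrightarrow> l2_inner (\<lambda>x. r x - P_add r x) q = 0"
proof -
  let ?J = "\<lambda>p. (l2_norm (\<lambda>x. r x - p x))\<^sup>2"
  have sub: "F_add \<subseteq> F_full"
    by (auto simp: F_add_iff)
  note q = quadratic_on_mono[OF quadratic_on_dist[OF r] sub]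
  have "has_unique_min ?J F_add"
    by (rule quadratic_has_unique_min[OF q closed_subspace_F_add, of 1 1]) auto
  then obtain p where p: "is_arg_min ?J (\<lambda>r. r \<in> F_add) p"
    by (auto simp: has_unique_min_def)
  have "p \<in> F_add \<and> (\<forall>q\<in>F_add. l2_inner (\<lambda>x. r x - p x) q = 0)"
    using p quadratic_argmin_stationary[OF q closed_subspace_F_add p] by (auto simp: is_arg_min_def)
  then have "P_add r \<in> F_add \<and> (\<forall>q\<in>F_add. l2_inner (\<lambda>x. r x - P_add r x) q = 0)"
    unfolding P_add_def by (rule someI[of "\<lambda>p. p \<in> F_add \<and> (\<forall>q\<in>F_add. l2_inner (\<lambda>x. r x - p x) q = 0)"])
  then show "P_add r \<in> F_add" "q \<in> F_add \<Longrightarrow> l2_inner (\<lambda>x. r x - P_add r x) q = 0"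
    by auto
qed

lemma F_add_imp_F_full: "r \<in> F_add \<Longrightarrow> r \<in> F_full"
  by (simp add: F_add_iff)

lemma perp_F_full: "r \<in> F_full \<Longrightarrow> (\<lambda>x. r x - P_add r x) \<in> F_full"
  by (intro F_full_diff F_add_imp_F_full[OF P_add_mem])

text \<open>P_add is determined, and hence linear, only up to null sets; the squared distance to
  F_add is unaffected by this.\<close>

lemma quadratic_on_perp:
  "quadratic_on F_full (\<lambda>r. (l2_norm (\<lambda>x. r x - P_add r x))\<^sup>2)
    (\<lambda>r a. l2_inner (\<lambda>x. r x - P_add r x) (\<lambda>x. a x - P_add a x))
    (\<lambda>a. (l2_norm (\<lambda>x. a x - P_add a x))\<^sup>2)"
  unfolding quadratic_on_def
proof (intro conjI ballI allI)
  fix r a :: "'a tuple_fun" and t assume r: "r \<in> F_full" and a: "a \<in> F_full"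
  let ?v = "\<lambda>x. r x - P_add r x" and ?w = "\<lambda>x. a x - P_add a x"
  let ?s = "\<lambda>x. r x + t *\<^sub>R a x"
  let ?vw = "\<lambda>x. ?v x + t *\<^sub>R ?w x"
  \<comment> \<open>The failure of \<open>P_add\<close> to be linear. It is additive, and all
    residuals are orthogonal to it, so it has norm zero.\<close>
  define e where "e x = (P_add r x + t *\<^sub>R P_add a x) - P_add ?s x" for x
  have s: "?s \<in> F_full"
    by (intro F_full_axpy r a)
  have e: "e \<in> F_add"
    unfolding e_def by (intro closed_subspaceD(3,4)[OF closed_subspace_F_add] P_add_mem r a s)
  have vw: "?vw \<in> F_full"
    by (intro F_full_axpy perp_F_full r a)
  have eq: "(\<lambda>x. ?s x - P_add ?s x) = (\<lambda>x. ?vw x + 1 *\<^sub>R e x)"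
    by (simp add: fun_eq_iff e_def algebra_simps)
  have 0: "l2_inner ?vw e = 0"
    by (simp add: l2_inner_axpy_left perp_F_full r a F_add_imp_F_full[OF e] P_add_orthogonal[OF _ e])
  have "0 = l2_inner (\<lambda>x. ?s x - P_add ?s x) e"
    by (rule P_add_orthogonal[OF s e, symmetric])
  also have "\<dots> = l2_inner ?vw e + 1 * l2_inner e e"
    unfolding eq by (intro l2_inner_axpy_left vw F_add_imp_F_full[OF e])
  finally have "(l2_norm e)\<^sup>2 = 0"
    by (simp add: 0 l2_norm_square)
  then have "(l2_norm (\<lambda>x. ?s x - P_add ?s x))\<^sup>2 = (l2_norm ?vw)\<^sup>2"
    unfolding eq l2_norm_axpy[OF vw F_add_imp_F_full[OF e]] by (simp add: 0)
  also have "\<dots> = (l2_norm ?v)\<^sup>2 + 2 * t * l2_inner ?v ?w + t\<^sup>2 * (l2_norm ?w)\<^sup>2"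
    by (intro l2_norm_axpy perp_F_full r a)
  finally show "(l2_norm (\<lambda>x. ?s x - P_add ?s x))\<^sup>2
    = (l2_norm ?v)\<^sup>2 + 2 * t * l2_inner ?v ?w + t\<^sup>2 * (l2_norm ?w)\<^sup>2" .
qed auto

lemma l2_norm_pythagoras:
  assumes r: "r \<in> F_full"
  shows "(l2_norm r)\<^sup>2 = (l2_norm (P_add r))\<^sup>2 + (l2_norm (\<lambda>x. r x - P_add r x))\<^sup>2"
proof -
  have P: "P_add r \<in> F_full"
    by (intro F_add_imp_F_full P_add_mem r)
  have "r = (\<lambda>x. (r x - P_add r x) + 1 *\<^sub>R P_add r x)"
    by simp
  then have "(l2_norm r)\<^sup>2 = (l2_norm (\<lambda>x. (r x - P_add r x) + 1 *\<^sub>R P_add r x))\<^sup>2"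
    by simp
  also have "\<dots> = (l2_norm (\<lambda>x. r x - P_add r x))\<^sup>2 + (l2_norm (P_add r))\<^sup>2"
    unfolding l2_norm_axpy[OF perp_F_full[OF r] P] by (simp add: P_add_orthogonal r P_add_mem)
  finally show ?thesis
    by simp
qed

lemma perp_le: "r \<in> F_full \<Longrightarrow> (l2_norm (\<lambda>x. r x - P_add r x))\<^sup>2 \<le> (l2_norm r)\<^sup>2"
  using l2_norm_pythagoras[of r] by simp

lemma perp_F_add:
  assumes "r \<in> F_add"
  shows "l2_norm (\<lambda>x. r x - P_add r x) = 0"
proof -
  have r: "r \<in> F_full"
    by (rule F_add_imp_F_full[OF assms])
  have "(l2_norm (\<lambda>x. r x - P_add r x))\<^sup>2 = 0"
    unfolding l2_norm_square
    by (intro P_add_orthogonal closed_subspaceD(4)[OF closed_subspace_F_add] assms P_add_mem r)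
  then show ?thesis
    by simp
qed

lemma quadratic_on_add_cmult:
  assumes "quadratic_on F J D E" "quadratic_on F J' D' E'" "0 \<le> R"
  shows "quadratic_on F (\<lambda>r. J r + R * J' r) (\<lambda>r a. D r a + R * D' r a) (\<lambda>a. E a + R * E' a)"
  using assms by (simp add: quadratic_on_def algebra_simps)

section \<open>Weighted least squares\<close>

text \<open>Abstracts the loss from its kernel: the weights w will be K_h / n and the regressors u
  the local linear ones. Responses 0 give the quadratic form B.\<close>

definition lsq ::
  "nat set \<Rightarrow> (nat \<Rightarrow> real ^ 'd \<Rightarrow> real) \<Rightarrow> (nat \<Rightarrow> real ^ 'd \<Rightarrow> real ^ 'd option) \<Rightarrow> (nat \<Rightarrow> real) \<Rightarrow>
   ('d::finite) tuple_fun \<Rightarrow> real"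
  where "lsq I w u y r = (LINT x|cube_measure. (\<Sum>i\<in>I. w i x * (y i - r x \<bullet> u i x)\<^sup>2))"

text \<open>Half of the directional derivative of \<open>lsq\<close>, in the normalization of
  \<open>quadratic_on\<close>.\<close>

definition lsq_deriv ::
  "nat set \<Rightarrow> (nat \<Rightarrow> real ^ 'd \<Rightarrow> real) \<Rightarrow> (nat \<Rightarrow> real ^ 'd \<Rightarrow> real ^ 'd option) \<Rightarrow> (nat \<Rightarrow> real) \<Rightarrow>
   ('d::finite) tuple_fun \<Rightarrow> 'd tuple_fun \<Rightarrow> real"
  where "lsq_deriv I w u y r a = - (LINT x|cube_measure. (\<Sum>i\<in>I. w i x * (y i - r x \<bullet> u i x) * (a x \<bullet> u i x)))"

definition design_op ::
  "nat set \<Rightarrow> (nat \<Rightarrow> real ^ 'd \<Rightarrow> real) \<Rightarrow> (nat \<Rightarrow> real ^ 'd \<Rightarrow> real ^ 'd option) \<Rightarrow>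
   ('d::finite) tuple_fun \<Rightarrow> 'd tuple_fun"
  where "design_op I w u r = (\<lambda>x. \<Sum>i\<in>I. (w i x * (r x \<bullet> u i x)) *\<^sub>R u i x)"

text \<open>C and U secure integrability and a finite operator norm. They do not occur in the bound
  on the distance of the estimators and may therefore depend on the sample and on n.\<close>

locale bounded_design =
  fixes I :: "nat set" and w :: "nat \<Rightarrow> real ^ 'd::finite \<Rightarrow> real"
    and u :: "nat \<Rightarrow> real ^ 'd \<Rightarrow> real ^ 'd option" and C U :: real
  assumes finite_I: "finite I"
    and w_measurable: "i \<in> I \<Longrightarrow> w i \<in> borel_measurable cube_measure"
    and w_nonneg: "i \<in> I \<Longrightarrow> x \<in> unit_cube \<Longrightarrow> 0 \<le> w i x"
    and w_le: "i \<in> I \<Longrightarrow> x \<in> unit_cube \<Longrightarrow> w i x \<le> C"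
    and u_measurable: "i \<in> I \<Longrightarrow> (\<lambda>x. u i x $ l) \<in> borel_measurable cube_measure"
    and u_le: "i \<in> I \<Longrightarrow> x \<in> unit_cube \<Longrightarrow> norm (u i x) \<le> U"
begin

lemma sq_integrable_mult_u:
  assumes "sq_integrable cube_measure f" "i \<in> I"
  shows "sq_integrable cube_measure (\<lambda>x. f x * u i x $ l)"
proof (rule sq_integrable_bound[OF assms(1), of _ U])
  show "(\<lambda>x. f x * u i x $ l) \<in> borel_measurable cube_measure"
    by (intro borel_measurable_times sq_integrable_measurable assms u_measurable)
  show "AE x in cube_measure. \<bar>f x * u i x $ l\<bar> \<le> U * \<bar>f x\<bar>"
  proof (rule AE_I2)
    fix x assume "x \<in> space (cube_measure :: (real ^ 'd) measure)"
    then have "\<bar>u i x $ l\<bar> \<le> U"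
      using u_le[OF assms(2), of x] component_le_norm_cart[of "u i x" l] by (simp add: space_cube)
    then show "\<bar>f x * u i x $ l\<bar> \<le> U * \<bar>f x\<bar>"
      unfolding abs_mult mult.commute[of U] by (intro mult_left_mono) auto
  qed
qed

lemma sq_integrable_mult_w:
  assumes "sq_integrable cube_measure f" "i \<in> I"
  shows "sq_integrable cube_measure (\<lambda>x. w i x * f x)"
proof (rule sq_integrable_bound[OF assms(1), of _ C])
  show "(\<lambda>x. w i x * f x) \<in> borel_measurable cube_measure"
    by (intro borel_measurable_times sq_integrable_measurable assms w_measurable)
  show "AE x in cube_measure. \<bar>w i x * f x\<bar> \<le> C * \<bar>f x\<bar>"
    using w_nonneg[OF assms(2)] w_le[OF assms(2)]
    by (intro AE_I2) (simp add: abs_mult space_cube mult_right_mono)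
qed

lemma sq_integrable_lin:
  assumes "r \<in> F_full" "i \<in> I"
  shows "sq_integrable cube_measure (\<lambda>x. r x \<bullet> u i x)"
  unfolding inner_vec_def inner_real_def
  using assms by (intro sq_integrable_sum sq_integrable_mult_u) (auto simp: F_full_iff)

lemma sq_integrable_residual:
  assumes "r \<in> F_full" "i \<in> I"
  shows "sq_integrable cube_measure (\<lambda>x. c - r x \<bullet> u i x)"
  by (intro sq_integrable_diff cube.sq_integrable_const sq_integrable_lin assms)

lemma integrable_weighted:
  assumes "sq_integrable cube_measure f" "sq_integrable cube_measure g" "i \<in> I"
  shows "integrable cube_measure (\<lambda>x. w i x * f x * g x)"
  by (intro integrable_mult_sq sq_integrable_mult_w assms)

lemma integrable_lsq:
  assumes "r \<in> F_full" "i \<in> I"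
  shows "integrable cube_measure (\<lambda>x. w i x * (c - r x \<bullet> u i x)\<^sup>2)"
  using integrable_weighted[OF sq_integrable_residual sq_integrable_residual, OF assms assms assms(2), of c c]
  by (simp add: power2_eq_square mult.assoc)

lemma lsq_nonneg: "0 \<le> lsq I w u y r"
  unfolding lsq_def
  by (intro integral_nonneg_AE AE_I2 sum_nonneg mult_nonneg_nonneg w_nonneg) (auto simp: space_cube)

lemma quadratic_on_lsq:
  "quadratic_on F_full (lsq I w u y) (lsq_deriv I w u y) (lsq I w u (\<lambda>_. 0))"
  unfolding quadratic_on_def
proof (intro conjI ballI allI lsq_nonneg)
  fix r a :: "'d tuple_fun" and t assume r: "r \<in> F_full" and a: "a \<in> F_full"
  have i1: "integrable cube_measure (\<lambda>x. w i x * (y i - r x \<bullet> u i x)\<^sup>2)" if "i \<in> I" for i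
    by (rule integrable_lsq[OF r that])
  have i2: "integrable cube_measure (\<lambda>x. w i x * (a x \<bullet> u i x)\<^sup>2)" if "i \<in> I" for i
    using integrable_lsq[OF a that, of 0] by simp
  have i3: "integrable cube_measure (\<lambda>x. w i x * (y i - r x \<bullet> u i x) * (a x \<bullet> u i x))" if "i \<in> I" for i
    by (intro integrable_weighted sq_integrable_residual sq_integrable_lin r a that)
  have "lsq I w u y (\<lambda>x. r x + t *\<^sub>R a x)
      = (LINT x|cube_measure. (\<Sum>i\<in>I. w i x * (y i - r x \<bullet> u i x)\<^sup>2)
          + (- (2 * t)) * (\<Sum>i\<in>I. w i x * (y i - r x \<bullet> u i x) * (a x \<bullet> u i x))
          + t\<^sup>2 * (\<Sum>i\<in>I. w i x * (a x \<bullet> u i x)\<^sup>2))"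
    unfolding lsq_def sum_distrib_left sum.distrib[symmetric]
    by (intro Bochner_Integration.integral_cong refl sum.cong)
      (simp add: inner_add_left power2_eq_square algebra_simps)
  also have "\<dots> = lsq I w u y r + 2 * t * lsq_deriv I w u y r a + t\<^sup>2 * lsq I w u (\<lambda>_. 0) a"
    unfolding lsq_def lsq_deriv_def using i1 i2 i3 by simp
  finally show "lsq I w u y (\<lambda>x. r x + t *\<^sub>R a x)
      = lsq I w u y r + 2 * t * lsq_deriv I w u y r a + t\<^sup>2 * lsq I w u (\<lambda>_. 0) a" .
qed

text \<open>The responses cancel, so subtracting the normal equations of two estimators in the same
  direction leaves an orthogonality relation for the form B.\<close>

lemma lsq_deriv_diff:
  assumes "r \<in> F_full" "s \<in> F_full" "a \<in> F_full"
  shows "lsq_deriv I w u y r a - lsq_deriv I w u y s a = lsq_deriv I w u (\<lambda>_. 0) (\<lambda>x. r x - s x) a"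
proof -
  have i: "integrable cube_measure (\<lambda>x. \<Sum>i\<in>I. w i x * (y i - r x \<bullet> u i x) * (a x \<bullet> u i x))" if "r \<in> F_full" for r
    by (intro Bochner_Integration.integrable_sum integrable_weighted sq_integrable_residual sq_integrable_lin that assms)
  have "lsq_deriv I w u y r a - lsq_deriv I w u y s a
      = (LINT x|cube_measure. (\<Sum>i\<in>I. w i x * (y i - s x \<bullet> u i x) * (a x \<bullet> u i x))
          - (\<Sum>i\<in>I. w i x * (y i - r x \<bullet> u i x) * (a x \<bullet> u i x)))"
    unfolding lsq_deriv_def using i assms by simp
  also have "\<dots> = lsq_deriv I w u (\<lambda>_. 0) (\<lambda>x. r x - s x) a"
    unfolding lsq_deriv_def integral_minus[symmetric] sum_subtractf[symmetric] sum_negf[symmetric]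
    by (intro Bochner_Integration.integral_cong refl sum.cong) (simp add: inner_diff_left algebra_simps)
  finally show ?thesis .
qed

lemma design_op_F_full: "r \<in> F_full \<Longrightarrow> design_op I w u r \<in> F_full"
  unfolding F_full_iff design_op_def
  by (auto intro!: sq_integrable_sum sq_integrable_mult_u sq_integrable_mult_w sq_integrable_lin simp: F_full_iff)

lemma l2_inner_design_op:
  assumes "r \<in> F_full"
  shows "l2_inner (design_op I w u r) r = lsq I w u (\<lambda>_. 0) r"
proof -
  have "l2_inner (design_op I w u r) r = (LINT x|cube_measure. (\<Sum>l\<in>UNIV. design_op I w u r x $ l * r x $ l))"
    unfolding l2_inner_def using assms design_op_F_full[OF assms]
    by (subst Bochner_Integration.integral_sum) (auto simp: F_full_iff intro: integrable_mult_sq)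
  also have "\<dots> = lsq I w u (\<lambda>_. 0) r"
    unfolding lsq_def
  proof (intro Bochner_Integration.integral_cong refl)
    fix x
    have "(\<Sum>l\<in>UNIV. design_op I w u r x $ l * r x $ l) = design_op I w u r x \<bullet> r x"
      by (simp add: inner_vec_def)
    also have "\<dots> = (\<Sum>i\<in>I. w i x * (0 - r x \<bullet> u i x)\<^sup>2)"
      unfolding design_op_def inner_sum_left
      by (intro sum.cong refl) (simp add: inner_commute[of "r x"] power2_eq_square mult.assoc)
    finally show "(\<Sum>l\<in>UNIV. design_op I w u r x $ l * r x $ l) = (\<Sum>i\<in>I. w i x * (0 - r x \<bullet> u i x)\<^sup>2)" .
  qed
  finally show ?thesis .
qed

text \<open>Makes \<open>op_norm\<close> meaningful: it is a supremum of reals, which needs a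
  bounded set.\<close>

lemma design_op_bounded:
  assumes r: "r \<in> F_full"
  shows "l2_norm (design_op I w u r) \<le> (\<Sum>i\<in>I. C * U\<^sup>2) * l2_norm r"
proof (rule power2_le_imp_le)
  have norm_sq: "(l2_norm q)\<^sup>2 = (LINT x|cube_measure. (norm (q x))\<^sup>2)"
    and norm_int: "integrable cube_measure (\<lambda>x. (norm (q x))\<^sup>2)" if "q \<in> F_full" for q :: "'d tuple_fun"
  proof -
    have eq: "(norm (q x))\<^sup>2 = (\<Sum>l\<in>UNIV. (q x $ l)\<^sup>2)" for x
      by (simp add: norm_vec_def L2_set_def sum_nonneg)
    have i: "integrable cube_measure (\<lambda>x. (q x $ l)\<^sup>2)" for l
      using that by (simp add: F_full_iff sq_integrable_def)
    show "(l2_norm q)\<^sup>2 = (LINT x|cube_measure. (norm (q x))\<^sup>2)"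
      using i by (simp add: eq l2_norm_def sum_nonneg)
    show "integrable cube_measure (\<lambda>x. (norm (q x))\<^sup>2)"
      using i by (simp add: eq)
  qed
  let ?B = "\<Sum>i\<in>I. C * U\<^sup>2"
  have pw: "norm (design_op I w u r x) \<le> ?B * norm (r x)" if x: "x \<in> unit_cube" for x
  proof -
    have "norm (design_op I w u r x) \<le> (\<Sum>i\<in>I. norm ((w i x * (r x \<bullet> u i x)) *\<^sub>R u i x))"
      unfolding design_op_def by (rule norm_sum)
    also have "\<dots> \<le> (\<Sum>i\<in>I. C * U\<^sup>2 * norm (r x))"
    proof (rule sum_mono)
      fix i assume i: "i \<in> I"
      have U: "0 \<le> U"
        using u_le[OF i x] norm_ge_zero order_trans by blast
      have "\<bar>r x \<bullet> u i x\<bar> \<le> norm (r x) * norm (u i x)"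
        by (rule Cauchy_Schwarz_ineq2)
      also have "\<dots> \<le> norm (r x) * U"
        by (intro mult_left_mono u_le i x norm_ge_zero)
      finally have "\<bar>r x \<bullet> u i x\<bar> \<le> norm (r x) * U" .
      then have "w i x * \<bar>r x \<bullet> u i x\<bar> * norm (u i x) \<le> C * (norm (r x) * U) * U"
        using w_nonneg[OF i x] w_le[OF i x] U u_le[OF i x] by (intro mult_mono) auto
      then show "norm ((w i x * (r x \<bullet> u i x)) *\<^sub>R u i x) \<le> C * U\<^sup>2 * norm (r x)"
        using w_nonneg[OF i x] by (simp add: abs_mult power2_eq_square mult.assoc mult.left_commute mult.commute)
    qed
    finally show ?thesis
      by (simp add: sum_distrib_right)
  qed
  have "(l2_norm (design_op I w u r))\<^sup>2 = (LINT x|cube_measure. (norm (design_op I w u r x))\<^sup>2)"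
    by (rule norm_sq[OF design_op_F_full[OF r]])
  also have "\<dots> \<le> (LINT x|cube_measure. ?B\<^sup>2 * (norm (r x))\<^sup>2)"
    unfolding power_mult_distrib[symmetric]
    using norm_int[OF r] by (intro integral_mono norm_int design_op_F_full r power_mono pw)
      (auto simp: power_mult_distrib space_cube)
  also have "\<dots> = (?B * l2_norm r)\<^sup>2"
    using norm_int[OF r] by (simp add: norm_sq[OF r] power_mult_distrib)
  finally show "(l2_norm (design_op I w u r))\<^sup>2 \<le> (?B * l2_norm r)\<^sup>2" .
  show "0 \<le> ?B * l2_norm r"
  proof (intro mult_nonneg_nonneg sum_nonneg l2_norm_nonneg)
    fix i assume i: "i \<in> I"
    have "(0 :: real ^ 'd) \<in> unit_cube"
      by (simp add: mem_box_cart)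
    then show "0 \<le> C"
      using w_nonneg[OF i] w_le[OF i] order_trans by blast
  qed simp
qed

text \<open>B a is the inner product of S a and a; Cauchy-Schwarz and normalization of a give the
  bound.\<close>

lemma lsq_le_op_norm:
  assumes a: "a \<in> F_full"
  shows "lsq I w u (\<lambda>_. 0) a \<le> op_norm (design_op I w u) * (l2_norm a)\<^sup>2"
proof (cases "l2_norm a = 0")
  \<comment> \<open>A null tuple cannot be normalized; here Cauchy-Schwarz alone gives B a \<le>
    0.\<close>
  case True
  then show ?thesis
    using l2_cauchy_schwarz[OF design_op_F_full[OF a] a] by (simp add: l2_inner_design_op[OF a])
next
  case False
  let ?c = "1 / l2_norm a" and ?B = "\<Sum>i\<in>I. C * U\<^sup>2"
  let ?b = "\<lambda>x. ?c *\<^sub>R a x"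
  have n: "0 < l2_norm a"
    using False l2_norm_nonneg[of a] by linarith
  have scale: "l2_norm (\<lambda>x. ?c *\<^sub>R q x) = ?c * l2_norm q" for q :: "'d tuple_fun"
    using n by (simp add: l2_norm_def power_divide real_sqrt_divide flip: sum_divide_distrib)
  have b: "?b \<in> F_full"
    using F_full_axpy[OF F_full_0 a, of ?c] by simp
  have bn: "l2_norm ?b = 1"
    using False by (simp only: scale) simp
  have "l2_norm (design_op I w u ?b) \<le> op_norm (design_op I w u)"
    unfolding op_norm_def
  proof (rule cSUP_upper)
    show "?b \<in> {r \<in> F_full. l2_norm r \<le> 1}"
      using b bn by simp
    show "bdd_above ((\<lambda>r. l2_norm (design_op I w u r)) ` {r \<in> F_full. l2_norm r \<le> 1})"
    proof (rule bdd_aboveI2)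
      fix r :: "'d tuple_fun" assume "r \<in> {r \<in> F_full. l2_norm r \<le> 1}"
      then have r: "r \<in> F_full" "l2_norm r \<le> 1"
        by auto
      have "l2_norm (design_op I w u r) \<le> \<bar>?B\<bar> * l2_norm r"
        by (rule order_trans[OF design_op_bounded[OF r(1)]]) (intro mult_right_mono l2_norm_nonneg abs_ge_self)
      also have "\<dots> \<le> \<bar>?B\<bar> * 1"
        by (intro mult_left_mono r abs_ge_zero)
      finally show "l2_norm (design_op I w u r) \<le> \<bar>?B\<bar>"
        by simp
    qed
  qed
  moreover have "design_op I w u ?b = (\<lambda>x. ?c *\<^sub>R design_op I w u a x)"
    by (simp add: design_op_def fun_eq_iff scaleR_sum_right)
  ultimately have "l2_norm (design_op I w u a) \<le> op_norm (design_op I w u) * l2_norm a"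
    using n by (simp only: scale) (simp add: field_simps)
  then have "l2_norm (design_op I w u a) * l2_norm a \<le> op_norm (design_op I w u) * l2_norm a * l2_norm a"
    by (intro mult_right_mono l2_norm_nonneg)
  then show ?thesis
    using l2_cauchy_schwarz[OF design_op_F_full[OF a] a]
    by (simp add: l2_inner_design_op[OF a] power2_eq_square mult.assoc)
qed

end

section \<open>The distance of the penalized to the additive estimator\<close>

text \<open>An additive tuple of norm 1, on which the lower and the upper bound for B can be
  compared.\<close>

lemma const_F_add:
  defines "e \<equiv> (\<lambda>x. axis None 1) :: ('d::finite) tuple_fun"
  shows "e \<in> F_add" "l2_norm e = 1"
proof -
  have comp: "e x $ l = (if l = None then 1 else 0)" for x l
    by (simp add: e_def axis_def)
  have "e \<in> F_full"
    by (simp add: F_full_iff comp cube.sq_integrable_const)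
  \<comment> \<open>The constant is split evenly among the coordinates in J.\<close>
  moreover have "additive_on J (\<lambda>x. c)" if "J \<noteq> {}" for J :: "'d set" and c
    using that unfolding additive_on_def
    by (intro exI[of _ "\<lambda>_ _. c / real (card J)"]) (simp add: card_gt_0_iff)
  ultimately show "e \<in> F_add"
    by (simp add: F_add_iff comp)
  have "(\<Sum>l\<in>UNIV. LINT x|cube_measure. (e x $ l)\<^sup>2) = (\<Sum>l\<in>(UNIV :: 'd option set). if l = None then 1 else 0)"
    by (intro sum.cong) (auto simp: comp measure_unit_cube space_cube)
  then show "l2_norm e = 1"
    by (simp add: l2_norm_def)
qed

context bounded_design
begin

text \<open>With q the residual of a, the projection is a - q. The parallelogram law for B bounds B
  (a - q), as B (a + q) is nonnegative.\<close>

lemma lsq_P_add_le: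
  assumes "a \<in> F_full"
  shows "lsq I w u (\<lambda>_. 0) (P_add a) \<le> 2 * lsq I w u (\<lambda>_. 0) a + 2 * lsq I w u (\<lambda>_. 0) (\<lambda>x. a x - P_add a x)"
proof -
  let ?B = "lsq I w u (\<lambda>_. 0)" and ?q = "\<lambda>x. a x - P_add a x"
  note q = perp_F_full[OF assms]
  have "?B (\<lambda>x. a x + 1 *\<^sub>R ?q x) + ?B (\<lambda>x. a x + (- 1) *\<^sub>R ?q x) = 2 * ?B a + 2 * ?B ?q"
    unfolding quadratic_onD(3)[OF quadratic_on_lsq assms q] by simp
  moreover have "0 \<le> ?B (\<lambda>x. a x + 1 *\<^sub>R ?q x)"
    by (rule lsq_nonneg)
  ultimately show ?thesis
    by simp
qed

context
  fixes c :: real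
  assumes c: "0 < c"
    and coercive: "\<And>a. a \<in> F_add \<Longrightarrow> c * (l2_norm a)\<^sup>2 \<le> lsq I w u (\<lambda>_. 0) a"
begin

lemma op_norm_ge: "c \<le> op_norm (design_op I w u)"
  using coercive[OF const_F_add(1)] lsq_le_op_norm[OF F_add_imp_F_full[OF const_F_add(1)]]
  by (simp add: const_F_add(2))

lemma has_unique_min_lsq: "has_unique_min (lsq I w u y) F_add"
  by (rule quadratic_has_unique_min[OF quadratic_on_mono[OF quadratic_on_lsq] closed_subspace_F_add c])
    (auto intro: coercive lsq_le_op_norm F_add_imp_F_full)

lemma quadratic_on_pen:
  assumes "0 < R"
  shows "quadratic_on F_full (\<lambda>r. lsq I w u y r + R * (l2_norm (\<lambda>x. r x - P_add r x))\<^sup>2)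
    (\<lambda>r a. lsq_deriv I w u y r a + R * l2_inner (\<lambda>x. r x - P_add r x) (\<lambda>x. a x - P_add a x))
    (\<lambda>a. lsq I w u (\<lambda>_. 0) a + R * (l2_norm (\<lambda>x. a x - P_add a x))\<^sup>2)"
  using assms by (intro quadratic_on_add_cmult quadratic_on_lsq quadratic_on_perp) auto

text \<open>B may degenerate on \<open>F_full\<close>. The penalized form is nevertheless coercive:
  the bound on \<open>F_add\<close> controls the additive part and the penalty the orthogonal part.
  The constant depends on R and on the operator norm, which is harmless for existence and
  uniqueness.\<close>

lemma has_unique_min_pen:
  assumes R: "0 < R"
  shows "has_unique_min (\<lambda>r. lsq I w u y r + R * (l2_norm (\<lambda>x. r x - P_add r x))\<^sup>2) F_full"
proof -
  define op where "op = op_norm (design_op I w u)"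
  \<comment> \<open>Read off from |a|^2 \<le> (2/c) B a + (2 op/c + 1) |q|^2, where |q|^2 is the
    penalty divided by R.\<close>
  define g where "g = 2 / c + (2 * op / c + 1) / R"
  have op: "c \<le> op"
    unfolding op_def by (rule op_norm_ge)
  have g: "0 < g"
    using op c R by (auto simp: g_def intro!: add_pos_pos divide_pos_pos)
  show ?thesis
  proof (rule quadratic_has_unique_min[OF quadratic_on_pen[OF R] closed_subspace_F_full])
    show "0 < 1 / g"
      using g by simp
    fix a :: "'d tuple_fun" assume a: "a \<in> F_full"
    let ?B = "lsq I w u (\<lambda>_. 0)" and ?q = "\<lambda>x. a x - P_add a x"
    let ?E = "?B a + R * (l2_norm ?q)\<^sup>2"
    have "c * (l2_norm (P_add a))\<^sup>2 \<le> 2 * ?B a + 2 * ?B ?q"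
      using coercive[OF P_add_mem[OF a]] lsq_P_add_le[OF a] by (rule order_trans)
    also have "\<dots> \<le> 2 * ?B a + 2 * (op * (l2_norm ?q)\<^sup>2)"
      using lsq_le_op_norm[OF perp_F_full[OF a]] by (simp add: op_def)
    finally have "(l2_norm (P_add a))\<^sup>2 \<le> (2 * ?B a + 2 * (op * (l2_norm ?q)\<^sup>2)) / c"
      using c by (simp add: pos_le_divide_eq mult.commute)
    also have "\<dots> = (2 / c) * ?B a + (2 * op / c) * (l2_norm ?q)\<^sup>2"
      by (simp add: add_divide_distrib)
    finally have "(l2_norm a)\<^sup>2 \<le> (2 / c) * ?B a + (2 * op / c + 1) * (l2_norm ?q)\<^sup>2"
      unfolding l2_norm_pythagoras[OF a] distrib_right by simp
    then have "(l2_norm a)\<^sup>2 \<le> (2 / c) * ?B a + ((2 * op / c + 1) / R) * (R * (l2_norm ?q)\<^sup>2)"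
      using R by simp
    also have "\<dots> \<le> (2 / c) * ?E + ((2 * op / c + 1) / R) * ?E"
      using c op R lsq_nonneg[of "\<lambda>_. 0" a] by (intro add_mono mult_left_mono) auto
    also have "\<dots> = g * ?E"
      by (simp add: g_def distrib_right)
    finally show "1 / g * (l2_norm a)\<^sup>2 \<le> ?E"
      using g by (simp add: field_simps)
    have "?E \<le> op * (l2_norm a)\<^sup>2 + R * (l2_norm a)\<^sup>2"
      using R by (intro add_mono mult_left_mono perp_le a) (auto simp: op_def intro: lsq_le_op_norm a)
    then show "?E \<le> (op + R) * (l2_norm a)\<^sup>2"
      by (simp add: distrib_right)
  qed
qed

theorem penalized_additive_dist:
  assumes R: "0 < R"
    and r_min: "is_arg_min (\<lambda>r. lsq I w u y r + R * (l2_norm (\<lambda>x. r x - P_add r x))\<^sup>2) (\<lambda>r. r \<in> F_full) r"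
    and s_min: "is_arg_min (lsq I w u y) (\<lambda>r. r \<in> F_add) s"
  shows "l2_norm (\<lambda>x. r x - s x) \<le> 2 * sqrt (lsq I w u y (\<lambda>x. 0) / c) * (inverse R * op_norm (design_op I w u))"
proof -
  define op where "op = op_norm (design_op I w u)"
  let ?B = "lsq I w u (\<lambda>_. 0)" and ?Q = "lsq I w u y" and ?D = "lsq_deriv I w u y"
  define q where "q = (\<lambda>x. r x - P_add r x)"
  define p where "p = (\<lambda>x. P_add r x - s x)"
  have op: "c \<le> op"
    unfolding op_def by (rule op_norm_ge)
  have rF: "r \<in> F_full" and sF: "s \<in> F_add"
    using r_min s_min by (auto simp: is_arg_min_def)
  have qF: "q \<in> F_full"
    unfolding q_def by (rule perp_F_full[OF rF])
  have pA: "p \<in> F_add"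
    unfolding p_def by (intro closed_subspaceD(4)[OF closed_subspace_F_add] P_add_mem rF sF)
  have pF: "p \<in> F_full"
    by (rule F_add_imp_F_full[OF pA])
  have q_orth: "l2_inner q a = 0" if "a \<in> F_add" for a
    unfolding q_def by (rule P_add_orthogonal[OF rF that])
  \<comment> \<open>The additive part of a may be restored because q is orthogonal to it. The normal
    equations then contain no projection of a.\<close>
  have q_perp: "l2_inner q (\<lambda>x. a x - P_add a x) = l2_inner q a" if a: "a \<in> F_full" for a
    using l2_inner_axpy_right[OF a F_add_imp_F_full[OF P_add_mem[OF a]] qF, of "-1"]
    by (simp add: q_orth P_add_mem a)
  have stat: "?D r a + R * l2_inner q a = 0" if a: "a \<in> F_full" for a
    using quadratic_argmin_stationary[OF quadratic_on_pen[OF R] closed_subspace_F_full r_min a]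
    by (simp add: q_perp[OF a, unfolded q_def] q_def)

  \<comment> \<open>The competitor will be 0, which is additive and hence not penalized.\<close>
  have r_le: "?Q r + R * (l2_norm (\<lambda>x. r x - P_add r x))\<^sup>2 \<le> ?Q a + R * (l2_norm (\<lambda>x. a x - P_add a x))\<^sup>2"
    if "a \<in> F_full" for a
    using r_min that by (auto simp: is_arg_min_def not_less)
  have "?Q r \<le> ?Q r + R * (l2_norm q)\<^sup>2"
    using R by simp
  also have "\<dots> \<le> ?Q (\<lambda>x. 0) + R * (l2_norm (\<lambda>x. 0 - P_add (\<lambda>x. 0 :: real ^ 'd option) x))\<^sup>2"
    unfolding q_def by (rule r_le[OF F_full_0])
  also have "\<dots> = ?Q (\<lambda>x. 0)"
    by (subst perp_F_add[OF closed_subspaceD(2)[OF closed_subspace_F_add]]) simp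
  finally have Qr: "?Q r \<le> ?Q (\<lambda>x. 0)" .
  have "(R * (l2_norm q)\<^sup>2)\<^sup>2 = (?D r q)\<^sup>2"
    using stat[OF qF] by (simp add: l2_norm_square eq_neg_iff_add_eq_0[symmetric])
  also have "\<dots> \<le> ?Q r * ?B q"
    by (rule quadratic_cauchy_schwarz[OF quadratic_on_lsq closed_subspace_F_full rF qF])
  also have "\<dots> \<le> ?Q (\<lambda>x. 0) * (op * (l2_norm q)\<^sup>2)"
    unfolding op_def by (intro mult_mono Qr lsq_le_op_norm qF lsq_nonneg)
  finally have "(R * l2_norm q)\<^sup>2 * (l2_norm q)\<^sup>2 \<le> (?Q (\<lambda>x. 0) * op) * (l2_norm q)\<^sup>2"
    by (simp add: power2_eq_square mult_ac)
  \<comment> \<open>One factor |q|^2 cancels; this is what yields the rate 1 / R for |q| rather than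
    for its square.\<close>
  then have "l2_norm q = 0 \<or> (R * l2_norm q)\<^sup>2 \<le> ?Q (\<lambda>x. 0) * op"
    by (subst (asm) mult_le_cancel_right) auto
  then have "(R * l2_norm q)\<^sup>2 \<le> ?Q (\<lambda>x. 0) * op"
    using lsq_nonneg[of y "\<lambda>x. 0"] op c by auto
  then have "R * l2_norm q \<le> sqrt (?Q (\<lambda>x. 0) * op)"
    by (rule real_le_rsqrt)
  then have nq: "l2_norm q \<le> inverse R * sqrt (?Q (\<lambda>x. 0) * op)"
    using R by (simp add: field_simps)

  have "?D r p = 0"
    using stat[OF pF] by (simp add: q_orth[OF pA])
  moreover have "?D s p = 0"
    by (rule quadratic_argmin_stationary[OF quadratic_on_mono[OF quadratic_on_lsq] closed_subspace_F_add s_min pA])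
      (auto intro: F_add_imp_F_full)
  ultimately have D0: "lsq_deriv I w u (\<lambda>_. 0) (\<lambda>x. r x - s x) p = 0"
    using lsq_deriv_diff[OF rF F_add_imp_F_full[OF sF] pF, of y] by simp
  \<comment> \<open>In the expansion of B q the cross term is \<open>D0\<close>, so B q = B (r - s)
    + B p.\<close>
  have "q = (\<lambda>x. (r x - s x) + (- 1) *\<^sub>R p x)"
    by (simp add: q_def p_def)
  then have "?B q = ?B (\<lambda>x. r x - s x) + ?B p"
    using quadratic_onD(3)[OF quadratic_on_lsq F_full_diff[OF rF F_add_imp_F_full[OF sF]] pF, of "\<lambda>_. 0" "- 1"]
    by (simp add: D0)
  then have "?B p \<le> ?B q"
    using lsq_nonneg[of "\<lambda>_. 0" "\<lambda>x. r x - s x"] by simp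
  then have "c * (l2_norm p)\<^sup>2 \<le> op * (l2_norm q)\<^sup>2"
    using coercive[OF pA] lsq_le_op_norm[OF qF] by (simp add: op_def)
  then have "(l2_norm p)\<^sup>2 \<le> (op / c) * (l2_norm q)\<^sup>2"
    using c by (simp add: field_simps)
  then have "l2_norm p \<le> sqrt ((op / c) * (l2_norm q)\<^sup>2)"
    by (rule real_le_rsqrt)
  then have np: "l2_norm p \<le> sqrt (op / c) * l2_norm q"
    unfolding real_sqrt_mult by (simp add: l2_norm_nonneg)
  \<comment> \<open>Lets |q| be absorbed into the bound for |p|, at the price of the factor
    2.\<close>
  have "1 \<le> sqrt (op / c)"
    using op c by simp
  then have "l2_norm q \<le> sqrt (op / c) * l2_norm q"
    using mult_right_mono[of 1 "sqrt (op / c)" "l2_norm q"] by (simp add: l2_norm_nonneg)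
  moreover have "l2_norm (\<lambda>x. r x - s x) \<le> l2_norm p + l2_norm q"
    using l2_norm_triangle[OF pF qF] by (simp add: p_def q_def)
  ultimately have "l2_norm (\<lambda>x. r x - s x) \<le> 2 * sqrt (op / c) * l2_norm q"
    using np by linarith
  also have "\<dots> \<le> 2 * sqrt (op / c) * (inverse R * sqrt (?Q (\<lambda>x. 0) * op))"
    using op c by (intro mult_left_mono nq) auto
  \<comment> \<open>One root of the operator norm stems from the bound on q, the other from passing
    from q to p; together they make the bound linear in |S|.\<close>
  also have "\<dots> = 2 * sqrt (?Q (\<lambda>x. 0) / c) * (inverse R * (sqrt op * sqrt op))"
    by (simp add: real_sqrt_mult real_sqrt_divide)
  also have "sqrt op * sqrt op = op"
    using op c by simp
  finally show ?thesis
    by (simp add: op_def)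
qed

end

end

lemma inner_u_vec:
  fixes v :: "real ^ 'd::finite option"
  shows "v \<bullet> u_vec h z x = v $ None + (\<Sum>k\<in>UNIV. v $ Some k * ((z $ k - x $ k) / h $ k))"
  by (simp add: inner_vec_def u_vec_def UNIV_option_conv sum.reindex)

lemma Q_loss_eq_lsq:
  "Q_loss n K h X = lsq {1..n} (\<lambda>i x. K_prod K h (X i) x / real n) (\<lambda>i. u_vec h (X i))"
  unfolding Q_loss_def lsq_def fun_eq_iff inner_u_vec sum_distrib_left
  by (intro allI Bochner_Integration.integral_cong refl sum.cong) (simp add: algebra_simps)

lemma S_op_eq_design_op:
  fixes h :: "real ^ 'd::finite"
  shows "S_op n K h X = design_op {1..n} (\<lambda>i x. K_prod K h (X i) x / real n) (\<lambda>i. u_vec h (X i))"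
proof (intro ext)
  fix r :: "'d tuple_fun" and x
  let ?u = "\<lambda>i. u_vec h (X i) x" and ?K = "\<lambda>i. K_prod K h (X i) x / real n"
  have "S_op n K h X r x $ l = (\<Sum>m\<in>UNIV. \<Sum>i=1..n. ?K i * ?u i $ l * (r x $ m * ?u i $ m))" for l
    unfolding S_op_def S_mat_def matrix_vector_mult_def vec_lambda_beta sum_distrib_left sum_distrib_right
    by (intro sum.cong refl) (simp add: mult_ac)
  also have "\<dots> l = (\<Sum>i=1..n. ?K i * ?u i $ l * (r x \<bullet> ?u i))" for l
    unfolding inner_vec_def inner_real_def sum_distrib_left by (rule sum.swap)
  finally have comp: "S_op n K h X r x $ l = (\<Sum>i=1..n. ?K i * ?u i $ l * (r x \<bullet> ?u i))" for l .
  show "S_op n K h X r x = design_op {1..n} (\<lambda>i x. K_prod K h (X i) x / real n) (\<lambda>i. u_vec h (X i)) r x"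
    by (simp add: vec_eq_iff comp design_op_def mult_ac)
qed

lemma is_arg_min_arg_min: "is_arg_min J P r \<Longrightarrow> is_arg_min J P (arg_min J P)"
  unfolding arg_min_def by (rule someI)

text \<open>The abstract bound holds for arbitrary minimizers, in particular for those selected by
  \<open>arg_min\<close>, once existence is known.\<close>

lemma estimator_bound:
  fixes h :: "real ^ 'd::finite"
  assumes design: "bounded_design {1..n} (\<lambda>i x. K_prod K h (X i) x / real n) (\<lambda>i. u_vec h (X i)) C U"
    and c: "0 < c"
    and coercive: "\<And>a. a \<in> F_add \<Longrightarrow> c * (l2_norm a)\<^sup>2 \<le> Q_loss n K h X (\<lambda>_. 0) a"
  shows "estimators_defined n K h X Y"
    and "0 < R \<Longrightarrow> estimator_dist n K h X Y R
      \<le> 2 * sqrt (Q_loss n K h X Y (\<lambda>x. 0) / c) * (inverse R * op_norm (S_op n K h X))"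
    and "0 \<le> op_norm (S_op n K h X)"
proof -
  interpret bounded_design "{1..n}" "\<lambda>i x. K_prod K h (X i) x / real n" "\<lambda>i. u_vec h (X i)" C U
    by (rule design)
  note coercive' = coercive[unfolded Q_loss_eq_lsq]
  have Q_pen_eq: "Q_pen n K h X Y R = (\<lambda>r. Q_loss n K h X Y r + R * (l2_norm (\<lambda>x. r x - P_add r x))\<^sup>2)" for R
    by (simp add: Q_pen_def fun_eq_iff)
  show defined: "estimators_defined n K h X Y"
    unfolding estimators_defined_def Q_pen_eq Q_loss_eq_lsq
    using has_unique_min_lsq[OF c coercive'] has_unique_min_pen[OF c coercive'] by blast
  show "estimator_dist n K h X Y R
      \<le> 2 * sqrt (Q_loss n K h X Y (\<lambda>x. 0) / c) * (inverse R * op_norm (S_op n K h X))" if "0 < R"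
  proof -
    have "is_arg_min (Q_loss n K h X Y) (\<lambda>r. r \<in> F_add) (r_add n K h X Y)"
      "is_arg_min (Q_pen n K h X Y R) (\<lambda>r. r \<in> F_full) (r_pen n K h X Y R)"
      unfolding r_add_def r_pen_def
      using defined that by (auto simp: estimators_defined_def has_unique_min_def intro: is_arg_min_arg_min)
    then show ?thesis
      unfolding estimator_dist_def Q_pen_eq Q_loss_eq_lsq S_op_eq_design_op
      by (intro penalized_additive_dist[OF c coercive' that]) auto
  qed
  show "0 \<le> op_norm (S_op n K h X)"
    using op_norm_ge[OF c coercive'] c by (simp add: S_op_eq_design_op)
qed

section \<open>Boundary-corrected kernels\<close>

text \<open>A single coordinate of a uniform point of the cube is uniform: on Borel sets this is a
  product integral with all factors but one equal to 1.\<close>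

lemma integral_cube_component:
  fixes f :: "real \<Rightarrow> real"
  assumes f: "f \<in> borel_measurable borel"
  shows "integrable cube_measure (\<lambda>x :: real ^ 'd::finite. f (x $ k)) \<longleftrightarrow> integrable unit_interval f"
    and "(LINT x|cube_measure. f ((x :: real ^ 'd) $ k)) = (LINT t|unit_interval. f t)"
proof -
  let ?X = "\<lambda>x :: real ^ 'd. x $ k"
  have id: "(\<lambda>t. t) \<in> unit_interval \<rightarrow>\<^sub>M borel"
    by (rule measurable_restrict_space1) simp
  have "distr cube_measure borel ?X = distr unit_interval borel (\<lambda>t. t)"
  proof (rule measure_eqI)
    fix A assume "A \<in> sets (distr cube_measure borel ?X)"
    then have A [measurable]: "A \<in> sets borel"
      by simp
    define g where "g l = (if l = k then indicator A else (\<lambda>_. 1 :: real))" for l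
    have g: "integrable unit_interval (g l)" for l
      by (intro unit.integrable_const_bound[where B = 1])
        (auto simp: g_def indicator_def intro!: measurable_restrict_space1)
    have m: "?X -` A \<inter> space cube_measure \<in> sets cube_measure"
      by (rule measurable_sets[OF measurable_cube_component A])
    have "measure cube_measure (?X -` A \<inter> space cube_measure)
        = (LINT x|cube_measure. indicator (?X -` A \<inter> space cube_measure) x)"
      by simp
    also have "\<dots> = (LINT x|cube_measure. (\<Prod>l\<in>UNIV. g l ((x :: real ^ 'd) $ l)))"
      by (intro Bochner_Integration.integral_cong)
        (auto simp: g_def indicator_def if_distrib[where f = "\<lambda>f. f _"] cong: if_cong)
    also have "\<dots> = (\<Prod>l\<in>UNIV. LINT t|unit_interval. g l t)"
      by (rule cube_prod(2)[OF g])
    also have "\<dots> = (\<Prod>l\<in>UNIV. if l = k then LINT t|unit_interval. indicator A t else 1)"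
      by (intro prod.cong) (auto simp: g_def measure_unit_interval space_restrict_space)
    also have "\<dots> = measure unit_interval (A \<inter> space unit_interval)"
      by simp
    finally show "emeasure (distr cube_measure borel ?X) A = emeasure (distr unit_interval borel (\<lambda>t. t)) A"
      using m by (simp add: emeasure_distr[OF id] emeasure_distr cube.emeasure_eq_measure unit.emeasure_eq_measure)
  qed simp
  note eq = this
  have "integrable cube_measure (\<lambda>x. f (?X x)) \<longleftrightarrow> integrable (distr cube_measure borel ?X) f"
    by (rule integrable_distr_eq[symmetric]) (auto intro: f)
  also have "\<dots> \<longleftrightarrow> integrable unit_interval f"
    unfolding eq by (rule integrable_distr_eq[OF id f])
  finally show "integrable cube_measure (\<lambda>x. f (?X x)) \<longleftrightarrow> integrable unit_interval f" .
  have "(LINT x|cube_measure. f (?X x)) = integral\<^sup>L (distr cube_measure borel ?X) f"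
    by (rule integral_distr[symmetric]) (auto intro: f)
  also have "\<dots> = (LINT t|unit_interval. f t)"
    unfolding eq by (rule integral_distr[OF id f])
  finally show "(LINT x|cube_measure. f (?X x)) = (LINT t|unit_interval. f t)" .
qed

text \<open>The positivity of K is used only through K \<ge> \<kappa> on an interval strictly to the
  right of 0, and on its mirror image. One-sidedness matters because near the boundary only half of
  a kernel window lies in the unit interval.\<close>

locale smoothing_kernel =
  fixes K :: "real \<Rightarrow> real" and S B L \<alpha> \<beta> \<kappa> :: real
  assumes K_nonneg: "0 \<le> K v"
    and K_le: "K v \<le> B"
    and K_lipschitz: "\<bar>K v - K v'\<bar> \<le> L * \<bar>v - v'\<bar>"
    and S_pos: "0 < S"
    and K_support: "S < \<bar>v\<bar> \<Longrightarrow> K v = 0"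
    and K_even: "K (- v) = K v"
    and \<alpha>_pos: "0 < \<alpha>" and \<alpha>_less_\<beta>: "\<alpha> < \<beta>" and \<kappa>_pos: "0 < \<kappa>"
    and \<kappa>_le: "\<alpha> \<le> v \<Longrightarrow> v \<le> \<beta> \<Longrightarrow> \<kappa> \<le> K v"
begin

definition mass :: "real \<Rightarrow> real \<Rightarrow> real"
  where "mass b z = (LBINT t:{0..1}. K ((z - t) / b))"

text \<open>Cut off for observations z outside of the unit interval, where the mass may be arbitrarily
  small; this makes the bounds below global.\<close>

definition moment_kernel :: "real \<Rightarrow> nat \<Rightarrow> real \<Rightarrow> real \<Rightarrow> real"
  where "moment_kernel b p z s = (if z \<in> {0..1} then K ((z - s) / b) * ((z - s) / b) ^ p / mass b z else 0)"

lemma L_nonneg: "0 \<le> L"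
  using K_lipschitz[of 1 0] abs_ge_zero[of "K 1 - K 0"] by simp

lemma B_nonneg: "0 \<le> B"
  using K_nonneg K_le order_trans by blast

lemma continuous_K: "continuous_on UNIV K"
proof -
  have "L-lipschitz_on UNIV K"
    using K_lipschitz L_nonneg by (intro lipschitz_onI) (auto simp: dist_real_def)
  then show ?thesis
    by (rule lipschitz_on_continuous_on)
qed

lemma K_measurable [measurable]: "K \<in> borel_measurable borel"
  by (rule borel_measurable_continuous_onI[OF continuous_K])

lemma integrable_K: "set_integrable lborel {0..1} (\<lambda>t. K ((z - t) / b))"
  unfolding set_integrable_def
  by (rule integrableI_bounded_set_indicator[where B = B]) (auto simp: K_nonneg K_le)

lemma mass_measurable [measurable]: "mass b \<in> borel_measurable borel"
  unfolding mass_def set_lebesgue_integral_def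
  by (rule lborel.borel_measurable_lebesgue_integral) measurable

text \<open>As \<open>b * \<beta>\<close> is at most 1/2, at least one of the intervals z + b
  [\<alpha>, \<beta>] and z - b [\<alpha>, \<beta>] lies in the unit interval, according to the half
  that contains z.\<close>

lemma mass_ge:
  assumes b: "0 < b" "b * \<beta> \<le> 1 / 2" and z: "z \<in> {0..1}"
  shows "\<kappa> * (\<beta> - \<alpha>) * b \<le> mass b z"
proof -
  define I where "I = (if z \<le> 1 / 2 then {z + b * \<alpha>..z + b * \<beta>} else {z - b * \<beta>..z - b * \<alpha>})"
  have ba: "0 < b * \<alpha>" "b * \<alpha> < b * \<beta>"
    using b(1) \<alpha>_pos \<alpha>_less_\<beta> by simp_all
  have I: "I \<subseteq> {0..1}"
    unfolding I_def using z b(2) ba by (simp only: atLeastAtMost_iff split: if_split) (intro conjI impI subsetI; simp only: atLeastAtMost_iff; linarith)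
  have le: "\<kappa> \<le> K ((z - t) / b)" if "t \<in> I" for t
  proof (cases "z \<le> 1 / 2")
    case True
    then have "\<alpha> \<le> (t - z) / b" "(t - z) / b \<le> \<beta>"
      using that b(1) by (auto simp: I_def pos_le_divide_eq pos_divide_le_eq mult.commute)
    then have "\<kappa> \<le> K (- ((t - z) / b))"
      unfolding K_even by (rule \<kappa>_le)
    then show ?thesis
      by (simp add: minus_divide_left)
  next
    case False
    then have "\<alpha> \<le> (z - t) / b" "(z - t) / b \<le> \<beta>"
      using that b(1) by (auto simp: I_def pos_le_divide_eq pos_divide_le_eq mult.commute)
    then show ?thesis
      by (rule \<kappa>_le)
  qed
  have mI: "measure lborel I = (\<beta> - \<alpha>) * b" "emeasure lborel I < \<infinity>"
    using b(1) \<alpha>_less_\<beta> by (auto simp: I_def algebra_simps)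
  have Is: "I \<in> sets lborel"
    by (simp add: I_def)
  have "\<kappa> * (\<beta> - \<alpha>) * b = (LINT t|lborel. \<kappa> * indicator I t)"
    using mI Is by simp
  also have "\<dots> \<le> (LINT t|lborel. indicator {0..1} t *\<^sub>R K ((z - t) / b))"
  proof (rule integral_mono)
    show "integrable lborel (\<lambda>t. \<kappa> * indicator I t)"
      using mI Is by simp
    show "integrable lborel (\<lambda>t. indicator {0..1} t *\<^sub>R K ((z - t) / b))"
      using integrable_K by (simp add: set_integrable_def)
    show "\<kappa> * indicator I t \<le> indicator {0..1} t *\<^sub>R K ((z - t) / b)" for t
      using I le[of t] K_nonneg by (auto simp: indicator_def)
  qed
  finally show ?thesis
    by (simp add: mass_def set_lebesgue_integral_def)
qed

lemma mass_pos:
  assumes "0 < b" "b * \<beta> \<le> 1 / 2" "z \<in> {0..1}"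
  shows "0 < mass b z"
proof -
  have "0 < \<kappa> * (\<beta> - \<alpha>) * b"
    using assms(1) \<kappa>_pos \<alpha>_less_\<beta> by simp
  also have "\<dots> \<le> mass b z"
    by (rule mass_ge[OF assms])
  finally show ?thesis .
qed

lemma mass_le:
  assumes b: "0 < b"
  shows "mass b z \<le> B * 2 * S * b"
proof -
  have "mass b z \<le> (LINT t|lborel. B * indicator {z - S * b..z + S * b} t)"
    unfolding mass_def set_lebesgue_integral_def
  proof (rule integral_mono)
    show "integrable lborel (\<lambda>t. indicator {0..1} t *\<^sub>R K ((z - t) / b))"
      using integrable_K by (simp add: set_integrable_def)
    show "integrable lborel (\<lambda>t. B * indicator {z - S * b..z + S * b} t)"
      by (intro integrable_mult_right integrable_real_indicator) (auto simp: emeasure_lborel_Icc_eq)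
    fix t
    have "K ((z - t) / b) = 0" if "t \<notin> {z - S * b..z + S * b}"
    proof (rule K_support)
      show "S < \<bar>(z - t) / b\<bar>"
        using that b by (auto simp: abs_divide pos_less_divide_eq)
    qed
    then show "indicator {0..1} t *\<^sub>R K ((z - t) / b) \<le> B * indicator {z - S * b..z + S * b} t"
      using K_le[of "(z - t) / b"] B_nonneg by (auto simp: indicator_def)
  qed
  also have "\<dots> = B * 2 * S * b"
    using S_pos b by simp
  finally show ?thesis .
qed

text \<open>Powers of v are neither bounded nor globally Lipschitz (beyond the first); the compact
  support of K compensates. A single constant serves both bounds to keep the induction
  short.\<close>

lemma power_K_lipschitz:
  "\<exists>A\<ge>0. \<forall>v v'. \<bar>K v * v ^ p\<bar> \<le> A \<and> \<bar>K v * v ^ p - K v' * v' ^ p\<bar> \<le> A * \<bar>v - v'\<bar>"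
proof (induction p)
  case 0
  have "\<bar>K v\<bar> \<le> max B L \<and> \<bar>K v - K v'\<bar> \<le> max B L * \<bar>v - v'\<bar>" for v v'
  proof
    show "\<bar>K v\<bar> \<le> max B L"
      using K_nonneg[of v] K_le[of v] by simp
    have "\<bar>K v - K v'\<bar> \<le> L * \<bar>v - v'\<bar>"
      by (rule K_lipschitz)
    also have "\<dots> \<le> max B L * \<bar>v - v'\<bar>"
      by (intro mult_right_mono) auto
    finally show "\<bar>K v - K v'\<bar> \<le> max B L * \<bar>v - v'\<bar>" .
  qed
  then show ?case
    using L_nonneg by (intro exI[of _ "max B L"]) auto
next
  case (Suc p)
  then obtain A where A: "0 \<le> A" "\<And>v. \<bar>K v * v ^ p\<bar> \<le> A"
    "\<And>v v'. \<bar>K v * v ^ p - K v' * v' ^ p\<bar> \<le> A * \<bar>v - v'\<bar>"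
    by blast
  define G where "G v = K v * v ^ p" for v
  have G: "\<bar>G v\<bar> \<le> A" "\<bar>G v - G v'\<bar> \<le> A * \<bar>v - v'\<bar>" for v v'
    using A by (auto simp: G_def)
  have G0: "G v = 0" if "S < \<bar>v\<bar>" for v
    using K_support[OF that] by (simp add: G_def)
  have bound: "\<bar>G v * v\<bar> \<le> A * S" for v
  proof (cases "S < \<bar>v\<bar>")
    case False
    then show ?thesis
      unfolding abs_mult using G(1)[of v] A(1) by (intro mult_mono) auto
  qed (use G0 A S_pos in auto)
  \<comment> \<open>It suffices that one of the two points lies in [-S, S]: the other case follows
    by symmetry, and if both lie outside, both values are zero.\<close>
  have half: "\<bar>G v * v - G v' * v'\<bar> \<le> (A * S + A) * \<bar>v - v'\<bar>" if "\<bar>v\<bar> \<le> S" for v v'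
  proof -
    have "\<bar>G v * v - G v' * v'\<bar> = \<bar>(G v - G v') * v + G v' * (v - v')\<bar>"
      by (simp add: algebra_simps)
    also have "\<dots> \<le> \<bar>G v - G v'\<bar> * \<bar>v\<bar> + \<bar>G v'\<bar> * \<bar>v - v'\<bar>"
      unfolding abs_mult[symmetric] by (rule abs_triangle_ineq)
    also have "\<dots> \<le> (A * \<bar>v - v'\<bar>) * S + A * \<bar>v - v'\<bar>"
      using G A that by (intro add_mono mult_mono mult_right_mono) auto
    finally show ?thesis
      by (simp add: algebra_simps)
  qed
  have lip: "\<bar>G v * v - G v' * v'\<bar> \<le> (A * S + A) * \<bar>v - v'\<bar>" for v v'
  proof -
    consider "\<bar>v\<bar> \<le> S" | "\<bar>v'\<bar> \<le> S" | "S < \<bar>v\<bar>" "S < \<bar>v'\<bar>"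
      by linarith
    then show ?thesis
    proof cases
      case 1
      then show ?thesis by (rule half)
    next
      case 2
      then show ?thesis
        using half[of v' v] by (simp add: abs_minus_commute)
    next
      case 3
      then show ?thesis
        using A S_pos by (simp add: G0)
    qed
  qed
  have "\<bar>G v * v\<bar> \<le> A * S + A" for v
    using bound[of v] A(1) by linarith
  moreover have "0 \<le> A * S + A"
    using A S_pos by simp
  ultimately show ?case
    using lip by (intro exI[of _ "A * S + A"]) (auto simp: G_def mult_ac)
qed

text \<open>The numerator is bounded, and Lipschitz in s with a constant of order 1 / b; dividing by
  the mass, which is at least of order b, costs one more factor 1 / b. Using \<open>A + 1\<close>
  keeps the constant positive.\<close>

lemma moment_kernel_bounds:
  "\<exists>A>0. \<forall>b z s s'. 0 < b \<longrightarrow> b * \<beta> \<le> 1 / 2 \<longrightarrow>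
    \<bar>moment_kernel b p z s\<bar> \<le> A / b \<and>
    \<bar>moment_kernel b p z s - moment_kernel b p z s'\<bar> \<le> A / b\<^sup>2 * \<bar>s - s'\<bar>"
proof -
  obtain A where A: "0 \<le> A" "\<And>v. \<bar>K v * v ^ p\<bar> \<le> A"
    "\<And>v v'. \<bar>K v * v ^ p - K v' * v' ^ p\<bar> \<le> A * \<bar>v - v'\<bar>"
    using power_K_lipschitz[of p] by blast
  define c where "c = \<kappa> * (\<beta> - \<alpha>)"
  have c: "0 < c"
    using \<kappa>_pos \<alpha>_less_\<beta> by (simp add: c_def)
  have "\<bar>moment_kernel b p z s\<bar> \<le> (A + 1) / c / b \<and>
    \<bar>moment_kernel b p z s - moment_kernel b p z s'\<bar> \<le> (A + 1) / c / b\<^sup>2 * \<bar>s - s'\<bar>"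
    if b: "0 < b" "b * \<beta> \<le> 1 / 2" for b z s s'
  proof (cases "z \<in> {0..1}")
    case True
    have m: "c * b \<le> mass b z" "0 < mass b z"
      using mass_ge[OF b True] mass_pos[OF b True] by (simp_all add: c_def)
    have cb: "0 < c * b"
      using c b by simp
    have "\<bar>moment_kernel b p z s\<bar> = \<bar>K ((z - s) / b) * ((z - s) / b) ^ p\<bar> / mass b z"
      using True m by (simp add: moment_kernel_def)
    also have "\<dots> \<le> (A + 1) / (c * b)"
      using A(1) A(2)[of "(z - s) / b"] m cb by (intro frac_le) auto
    finally have 1: "\<bar>moment_kernel b p z s\<bar> \<le> (A + 1) / c / b"
      by simp
    have "\<bar>moment_kernel b p z s - moment_kernel b p z s'\<bar>
        = \<bar>K ((z - s) / b) * ((z - s) / b) ^ p - K ((z - s') / b) * ((z - s') / b) ^ p\<bar> / mass b z"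
      using True m by (simp add: moment_kernel_def flip: diff_divide_distrib)
    also have "\<dots> \<le> ((A + 1) * \<bar>(z - s) / b - (z - s') / b\<bar>) / (c * b)"
    proof (intro frac_le m cb)
      show "\<bar>K ((z - s) / b) * ((z - s) / b) ^ p - K ((z - s') / b) * ((z - s') / b) ^ p\<bar>
          \<le> (A + 1) * \<bar>(z - s) / b - (z - s') / b\<bar>"
        by (rule order_trans[OF A(3)]) (intro mult_right_mono, auto)
      show "0 \<le> (A + 1) * \<bar>(z - s) / b - (z - s') / b\<bar>"
        using A(1) by simp
    qed
    also have "\<bar>(z - s) / b - (z - s') / b\<bar> = \<bar>s - s'\<bar> / b"
      using b by (simp add: abs_minus_commute flip: diff_divide_distrib)
    finally have 2: "\<bar>moment_kernel b p z s - moment_kernel b p z s'\<bar> \<le> (A + 1) / c / b\<^sup>2 * \<bar>s - s'\<bar>"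
      by (simp add: power2_eq_square mult_ac)
    from 1 2 show ?thesis
      by simp
  next
    case False
    have "0 \<le> (A + 1) / c / b" "0 \<le> (A + 1) / c / b\<^sup>2 * \<bar>s - s'\<bar>"
      using A(1) c b by simp_all
    then show ?thesis
      using False by (simp only: moment_kernel_def if_False) simp
  qed
  moreover have "0 < (A + 1) / c"
    using A(1) c by simp
  ultimately show ?thesis
    by blast
qed

lemma moment_kernel_measurable [measurable]:
  "(\<lambda>q. moment_kernel b p (fst q) (snd q)) \<in> borel_measurable (borel \<Otimes>\<^sub>M borel)"
  unfolding moment_kernel_def by measurable

text \<open>The identity for which the boundary rescaling is made; it removes every coordinate that
  an integrand does not involve.\<close>

lemma moment_kernel_integral:
  assumes "0 < b" "b * \<beta> \<le> 1 / 2" "z \<in> {0..1}"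
  shows "(LINT s|unit_interval. moment_kernel b 0 z s) = 1"
proof -
  have "(LINT s|unit_interval. moment_kernel b 0 z s) = (LINT s|unit_interval. K ((z - s) / b)) / mass b z"
    using assms(3) by (simp add: moment_kernel_def)
  also have "(LINT s|unit_interval. K ((z - s) / b)) = mass b z"
    unfolding mass_def set_lebesgue_integral_def by (subst integral_restrict_space) simp_all
  finally show ?thesis
    using mass_pos[OF assms] by simp
qed

lemma K_prod_eq:
  assumes "z \<in> unit_cube"
  shows "K_prod K h z x = (\<Prod>k\<in>UNIV. moment_kernel (h $ k) 0 (z $ k) (x $ k))"
  using assms by (simp add: K_prod_def moment_kernel_def mass_def mem_box_cart)

lemma moment_kernel_power: "moment_kernel b 0 z s * ((z - s) / b) ^ p = moment_kernel b p z s"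
  by (simp add: moment_kernel_def)

end

locale smoothing_kernel_bandwidth = smoothing_kernel +
  fixes h :: "real ^ 'd::finite"
  assumes h_pos: "0 < h $ k"
    and h_small: "h $ k * \<beta> \<le> 1 / 2"
begin

lemma integrable_moment_kernel_mult:
  assumes f: "integrable unit_interval f"
  shows "integrable unit_interval (\<lambda>s. moment_kernel (h $ k) p z s * f s)"
proof -
  obtain A where A: "0 < A" "\<And>s. \<bar>moment_kernel (h $ k) p z s\<bar> \<le> A / h $ k"
    using moment_kernel_bounds[of p] h_pos[of k] h_small[of k] by blast
  have m: "(\<lambda>s. moment_kernel (h $ k) p z s) \<in> borel_measurable unit_interval"
    by (intro measurable_restrict_space1) (simp add: moment_kernel_def[abs_def])
  show ?thesis
  proof (rule Bochner_Integration.integrable_bound)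
    show "integrable unit_interval (\<lambda>s. (A / h $ k) * f s)"
      using f by simp
    show "(\<lambda>s. moment_kernel (h $ k) p z s * f s) \<in> borel_measurable unit_interval"
      using m f by (intro borel_measurable_times) auto
    show "AE s in unit_interval. norm (moment_kernel (h $ k) p z s * f s) \<le> norm ((A / h $ k) * f s)"
      unfolding norm_mult using A h_pos[of k] by (intro AE_I2 mult_right_mono) auto
  qed
qed

text \<open>The coordinates outside J integrate to 1, which leaves the kernel factors with index in
  J. This reduction is why the later rates do not depend on the dimension.\<close>

lemma K_prod_marginal:
  assumes z: "z \<in> unit_cube" and f: "\<And>k. k \<in> J \<Longrightarrow> integrable unit_interval (f k)"
  shows "integrable cube_measure (\<lambda>x. K_prod K h z x * (\<Prod>k\<in>J. f k (x $ k)))"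
    and "(LINT x|cube_measure. K_prod K h z x * (\<Prod>k\<in>J. f k (x $ k)))
      = (LINT x|cube_measure. (\<Prod>k\<in>J. moment_kernel (h $ k) 0 (z $ k) (x $ k) * f k (x $ k)))"
proof -
  define F where "F k s = moment_kernel (h $ k) 0 (z $ k) s * (if k \<in> J then f k s else 1)" for k s
  define G where "G k s = (if k \<in> J then moment_kernel (h $ k) 0 (z $ k) s * f k s else 1)" for k s
  have eqF: "K_prod K h z x * (\<Prod>k\<in>J. f k (x $ k)) = (\<Prod>k\<in>UNIV. F k (x $ k))" for x
    unfolding K_prod_eq[OF z] F_def prod.distrib
    by (intro arg_cong2[where f = "(*)"] refl prod.mono_neutral_cong_left) auto
  have eqG: "(\<Prod>k\<in>J. moment_kernel (h $ k) 0 (z $ k) (x $ k) * f k (x $ k)) = (\<Prod>k\<in>UNIV. G k (x $ k))" for x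
    unfolding G_def by (intro prod.mono_neutral_cong_left) auto
  have F: "integrable unit_interval (F k)" for k
    unfolding F_def using f[of k] by (intro integrable_moment_kernel_mult, cases "k \<in> J") auto
  have G: "integrable unit_interval (G k)" for k
    unfolding G_def using f[of k] by (cases "k \<in> J") (auto intro!: integrable_moment_kernel_mult)
  have zk: "z $ k \<in> {0..1}" for k
    using z by (simp add: mem_box_cart)
  have int_eq: "(LINT s|unit_interval. F k s) = (LINT s|unit_interval. G k s)" for k
    using moment_kernel_integral[OF h_pos h_small zk, of k]
    by (cases "k \<in> J") (simp_all add: F_def G_def measure_unit_interval space_restrict_space)
  show "integrable cube_measure (\<lambda>x. K_prod K h z x * (\<Prod>k\<in>J. f k (x $ k)))"
    unfolding eqF by (rule cube_prod(1)[OF F])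
  show "(LINT x|cube_measure. K_prod K h z x * (\<Prod>k\<in>J. f k (x $ k)))
      = (LINT x|cube_measure. (\<Prod>k\<in>J. moment_kernel (h $ k) 0 (z $ k) (x $ k) * f k (x $ k)))"
    unfolding eqF eqG cube_prod(2)[OF F] cube_prod(2)[OF G] int_eq ..
qed

end

section \<open>The quadratic form on additive functions\<close>

text \<open>
  The component functions of an additive tuple are indexed by pairs (k, b): (k, False) is the summand
  of r^0 that depends on x_k, and (k, True) is r^k.
\<close>

abbreviation deg :: "'d \<times> bool \<Rightarrow> nat"
  where "deg i \<equiv> of_bool (snd i)"

text \<open>Measurable components together with their L2 bounds. The factor 4 is that of
  \<open>additive_components\<close>; it makes error bounds in terms of the components into bounds
  in terms of the tuple.\<close>

definition has_components :: "('d::finite) tuple_fun \<Rightarrow> ('d \<times> bool \<Rightarrow> real \<Rightarrow> real) \<Rightarrow> bool"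
  where "has_components a \<psi> \<longleftrightarrow>
    (\<forall>i. \<psi> i \<in> borel_measurable borel \<and> sq_integrable unit_interval (\<psi> i) \<and>
      (LINT s|unit_interval. (\<psi> i s)\<^sup>2) \<le> 4 * (l2_norm a)\<^sup>2) \<and>
    (AE x in cube_measure. a x $ None = (\<Sum>k\<in>UNIV. \<psi> (k, False) (x $ k)) \<and>
      (\<forall>k. a x $ Some k = \<psi> (k, True) (x $ k)))"

lemma has_componentsD:
  assumes "has_components a \<psi>"
  shows "\<psi> i \<in> borel_measurable borel" "sq_integrable unit_interval (\<psi> i)"
    "(LINT s|unit_interval. (\<psi> i s)\<^sup>2) \<le> 4 * (l2_norm a)\<^sup>2"
  using assms unfolding has_components_def by blast+

lemma F_add_components:
  fixes a :: "('d::finite) tuple_fun"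
  assumes a: "a \<in> F_add"
  shows "\<exists>\<psi>. has_components a \<psi>"
proof -
  have sq: "sq_integrable cube_measure (\<lambda>x. a x $ l)" for l
    using a by (simp add: F_add_iff F_full_iff)
  have le: "4 * (LINT x|cube_measure. (a x $ l)\<^sup>2) \<le> 4 * (l2_norm a)\<^sup>2" for l
  proof -
    have "(LINT x|cube_measure. (a x $ l)\<^sup>2) \<le> (\<Sum>l\<in>UNIV. LINT x|cube_measure. (a x $ l)\<^sup>2)"
      by (rule member_le_sum) auto
    then show ?thesis
      by (simp add: l2_norm_def sum_nonneg)
  qed
  have comp: "\<exists>g. (\<forall>k. g k \<in> borel_measurable borel \<and> sq_integrable unit_interval (g k) \<and>
      (LINT s|unit_interval. (g k s)\<^sup>2) \<le> 4 * (l2_norm a)\<^sup>2) \<and>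
      (AE x in cube_measure. a x $ l = (\<Sum>k\<in>J. g k (x $ k)))"
    if J: "J \<noteq> {}" and add: "additive_on J (\<lambda>x. a x $ l)" for J :: "'d set" and l
  proof -
    obtain g where gm: "\<And>k. g k \<in> borel_measurable borel"
      and gs: "\<And>k. sq_integrable cube_measure (\<lambda>x :: real ^ 'd. g k (x $ k))"
        "\<And>k. (LINT x|cube_measure. (g k ((x :: real ^ 'd) $ k))\<^sup>2) \<le> 4 * (LINT x|cube_measure. (a x $ l)\<^sup>2)"
      and ae: "AE x in cube_measure. a x $ l = (\<Sum>k\<in>J. g k (x $ k))"
      using additive_components[OF sq J additivity_defect_AE[OF add]] by blast
    have m2: "(\<lambda>s. (g k s)\<^sup>2) \<in> borel_measurable borel" for k
      using gm by simp
    have "sq_integrable unit_interval (g k)" for k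
      using gs(1)[of k] integral_cube_component(1)[OF m2[of k], where k = k] gm
      by (auto simp: sq_integrable_def intro: measurable_restrict_space1)
    moreover have "(LINT s|unit_interval. (g k s)\<^sup>2) \<le> 4 * (l2_norm a)\<^sup>2" for k
      using gs(2)[of k] le[of l] integral_cube_component(2)[OF m2[of k], where k = k] by linarith
    ultimately show ?thesis
      using gm ae by blast
  qed
  have "\<exists>g. (\<forall>k. g k \<in> borel_measurable borel \<and> sq_integrable unit_interval (g k) \<and>
      (LINT s|unit_interval. (g k s)\<^sup>2) \<le> 4 * (l2_norm a)\<^sup>2) \<and>
      (AE x in cube_measure. a x $ None = (\<Sum>k\<in>UNIV. g k (x $ k)))"
    using a by (intro comp) (auto simp: F_add_iff)
  then obtain g where g: "\<And>k. g k \<in> borel_measurable borel \<and> sq_integrable unit_interval (g k) \<and>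
      (LINT s|unit_interval. (g k s)\<^sup>2) \<le> 4 * (l2_norm a)\<^sup>2"
    "AE x in cube_measure. a x $ None = (\<Sum>k\<in>UNIV. g k (x $ k))"
    by blast
  have "\<forall>k. \<exists>b. (b \<in> borel_measurable borel \<and> sq_integrable unit_interval b \<and>
      (LINT s|unit_interval. (b s)\<^sup>2) \<le> 4 * (l2_norm a)\<^sup>2) \<and>
      (AE x in cube_measure. a x $ Some k = b (x $ k))"
  proof
    fix k
    have "additive_on {k} (\<lambda>x. a x $ Some k)"
      using a by (simp add: F_add_iff)
    from comp[OF _ this] show "\<exists>b. (b \<in> borel_measurable borel \<and> sq_integrable unit_interval b \<and>
      (LINT s|unit_interval. (b s)\<^sup>2) \<le> 4 * (l2_norm a)\<^sup>2) \<and>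
      (AE x in cube_measure. a x $ Some k = b (x $ k))"
      by auto
  qed
  from choice[OF this] obtain b where b: "\<And>k. b k \<in> borel_measurable borel \<and> sq_integrable unit_interval (b k) \<and>
      (LINT s|unit_interval. (b k s)\<^sup>2) \<le> 4 * (l2_norm a)\<^sup>2"
    "\<And>k. AE x in cube_measure. a x $ Some k = b k (x $ k)"
    by blast
  define \<psi> where "\<psi> i = (if snd i then b (fst i) else g (fst i))" for i
  have "AE x in cube_measure. \<forall>k. a x $ Some k = b k (x $ k)"
    using b(2) by (intro AE_all_countable[THEN iffD2]) auto
  with g(2) have "AE x in cube_measure. a x $ None = (\<Sum>k\<in>UNIV. \<psi> (k, False) (x $ k)) \<and>
      (\<forall>k. a x $ Some k = \<psi> (k, True) (x $ k))"
    by eventually_elim (simp add: \<psi>_def)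
  moreover have "\<psi> i \<in> borel_measurable borel \<and> sq_integrable unit_interval (\<psi> i) \<and>
      (LINT s|unit_interval. (\<psi> i s)\<^sup>2) \<le> 4 * (l2_norm a)\<^sup>2" for i
    using b(1) g(1) by (simp add: \<psi>_def)
  ultimately show ?thesis
    unfolding has_components_def by blast
qed

context smoothing_kernel_bandwidth
begin

text \<open>The marginal of the product kernel that multiplies the components i and j in B: on a
  common coordinate the degrees of the local linear regressors add up, on distinct ones the kernel
  factors separate.\<close>

definition pair_kernel :: "'d \<times> bool \<Rightarrow> 'd \<times> bool \<Rightarrow> real ^ 'd \<Rightarrow> real ^ 'd \<Rightarrow> real"
  where "pair_kernel i j z x =
    (if fst i = fst j
     then moment_kernel (h $ fst i) (deg i + deg j) (z $ fst i) (x $ fst i)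
     else moment_kernel (h $ fst i) (deg i) (z $ fst i) (x $ fst i)
        * moment_kernel (h $ fst j) (deg j) (z $ fst j) (x $ fst j))"

lemma sq_integrable_component_power:
  assumes "has_components a \<psi>" "z \<in> unit_cube"
  shows "sq_integrable unit_interval (\<lambda>s. \<psi> i s * ((z $ k - s) / h $ k) ^ p)"
proof (rule sq_integrable_bound)
  show "sq_integrable unit_interval (\<psi> i)"
    by (rule has_componentsD[OF assms(1)])
  show "(\<lambda>s. \<psi> i s * ((z $ k - s) / h $ k) ^ p) \<in> borel_measurable unit_interval"
    using has_componentsD(1)[OF assms(1)] by (intro measurable_restrict_space1) simp
  show "AE s in unit_interval. \<bar>\<psi> i s * ((z $ k - s) / h $ k) ^ p\<bar> \<le> (1 / h $ k) ^ p * \<bar>\<psi> i s\<bar>"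
  proof (rule AE_I2)
    fix s assume "s \<in> space unit_interval"
    then have "0 \<le> s" "s \<le> 1" "0 \<le> z $ k" "z $ k \<le> 1"
      using assms(2) by (auto simp: space_restrict_space mem_box_cart)
    then have "\<bar>z $ k - s\<bar> \<le> 1"
      by linarith
    then have "\<bar>(z $ k - s) / h $ k\<bar> \<le> 1 / h $ k"
      using h_pos[of k] by (simp add: abs_divide divide_right_mono)
    then have "\<bar>((z $ k - s) / h $ k)\<bar> ^ p \<le> (1 / h $ k) ^ p"
      by (intro power_mono) auto
    then show "\<bar>\<psi> i s * ((z $ k - s) / h $ k) ^ p\<bar> \<le> (1 / h $ k) ^ p * \<bar>\<psi> i s\<bar>"
      unfolding abs_mult power_abs by (subst mult.commute) (intro mult_right_mono, auto)
  qed
qed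

text \<open>An instance of \<open>K_prod_marginal\<close> with one or two coordinates, after the
  powers of (z - x) / h have been absorbed into the kernel.\<close>

lemma pair_term:
  assumes \<psi>: "has_components a \<psi>" and z: "z \<in> unit_cube"
  defines "t i x \<equiv> \<psi> i (x $ fst i) * ((z $ fst i - x $ fst i) / h $ fst i) ^ deg i"
  shows "integrable cube_measure (\<lambda>x. K_prod K h z x * (t i x * t j x))"
    and "(LINT x|cube_measure. K_prod K h z x * (t i x * t j x))
      = (LINT x|cube_measure. pair_kernel i j z x * (\<psi> i (x $ fst i) * \<psi> j (x $ fst j)))"
proof -
  let ?v = "\<lambda>k s. (z $ k - s) / h $ k"
  note sq = sq_integrable_component_power[OF \<psi> z]
  have "integrable cube_measure (\<lambda>x. K_prod K h z x * (t i x * t j x)) \<and>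
    (LINT x|cube_measure. K_prod K h z x * (t i x * t j x))
      = (LINT x|cube_measure. pair_kernel i j z x * (\<psi> i (x $ fst i) * \<psi> j (x $ fst j)))"
  proof (cases "fst i = fst j")
    case True
    define f where "f k s = (\<psi> i s * ?v k s ^ deg i) * (\<psi> j s * ?v k s ^ deg j)" for k s
    have f: "integrable unit_interval (f k)" for k
      unfolding f_def by (intro integrable_mult_sq sq)
    have t: "t i x * t j x = (\<Prod>k\<in>{fst i}. f k (x $ k))" for x
      using True by (simp add: t_def f_def)
    have g: "pair_kernel i j z x * (\<psi> i (x $ fst i) * \<psi> j (x $ fst j))
        = (\<Prod>k\<in>{fst i}. moment_kernel (h $ k) 0 (z $ k) (x $ k) * f k (x $ k))" for x
      using True by (simp add: pair_kernel_def f_def moment_kernel_power[of _ _ _ "deg i + deg j", symmetric]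
            power_add mult_ac)
    show ?thesis
      unfolding t g using K_prod_marginal[where f = f and J = "{fst i}", OF z f] by simp
  next
    case False
    define f where "f k s = (if k = fst i then \<psi> i s * ?v k s ^ deg i else \<psi> j s * ?v k s ^ deg j)" for k s
    have f: "integrable unit_interval (f k)" for k
      unfolding f_def by (cases "k = fst i") (simp_all only: refl if_True if_False unit.sq_integrable_integrable[OF sq])
    have t: "t i x * t j x = (\<Prod>k\<in>{fst i, fst j}. f k (x $ k))" for x
      using False by (simp add: t_def f_def)
    have g: "pair_kernel i j z x * (\<psi> i (x $ fst i) * \<psi> j (x $ fst j))
        = (\<Prod>k\<in>{fst i, fst j}. moment_kernel (h $ k) 0 (z $ k) (x $ k) * f k (x $ k))" for x
      using False by (simp add: pair_kernel_def f_def moment_kernel_power[of _ _ _ "deg i", symmetric]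
            moment_kernel_power[of _ _ _ "deg j", symmetric] mult_ac)
    show ?thesis
      unfolding t g using K_prod_marginal[where f = f and J = "{fst i, fst j}", OF z f] by simp
  qed
  then show "integrable cube_measure (\<lambda>x. K_prod K h z x * (t i x * t j x))"
    and "(LINT x|cube_measure. K_prod K h z x * (t i x * t j x))
      = (LINT x|cube_measure. pair_kernel i j z x * (\<psi> i (x $ fst i) * \<psi> j (x $ fst j)))"
    by auto
qed

lemma K_prod_measurable:
  "z \<in> unit_cube \<Longrightarrow> (\<lambda>x. K_prod K h z x) \<in> borel_measurable cube_measure"
  unfolding K_prod_eq
  by (intro borel_measurable_prod) (simp add: moment_kernel_def[abs_def])

text \<open>Almost everywhere, the inner product of a and \<open>u_vec\<close> is a sum of one term
  per component, so its square is a double sum to which \<open>pair_term\<close> applies.\<close>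

lemma local_form_expansion:
  fixes a :: "'d tuple_fun"
  assumes \<psi>: "has_components a \<psi>" and z: "z \<in> unit_cube" and aF: "a \<in> F_full"
  shows "integrable cube_measure (\<lambda>x. K_prod K h z x * (a x \<bullet> u_vec h z x)\<^sup>2)"
    and "(LINT x|cube_measure. K_prod K h z x * (a x \<bullet> u_vec h z x)\<^sup>2)
      = (\<Sum>i\<in>UNIV. \<Sum>j\<in>UNIV. LINT x|cube_measure. pair_kernel i j z x * (\<psi> i (x $ fst i) * \<psi> j (x $ fst j)))"
proof -
  define t where "t i x = \<psi> i (x $ fst i) * ((z $ fst i - x $ fst i) / h $ fst i) ^ deg i" for i and x :: "real ^ 'd"
  note tt = pair_term[OF \<psi> z, folded t_def]
  have ae: "AE x in cube_measure. K_prod K h z x * (a x \<bullet> u_vec h z x)\<^sup>2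
      = (\<Sum>i\<in>UNIV. \<Sum>j\<in>UNIV. K_prod K h z x * (t i x * t j x))"
  proof -
    have "AE x in cube_measure. a x $ None = (\<Sum>k\<in>UNIV. \<psi> (k, False) (x $ k)) \<and>
      (\<forall>k. a x $ Some k = \<psi> (k, True) (x $ k))"
      using \<psi> by (simp add: has_components_def)
    then show ?thesis
    proof eventually_elim
      case (elim x)
      have "(\<Sum>i\<in>UNIV. t i x) = (\<Sum>k\<in>UNIV. \<Sum>b\<in>UNIV. t (k, b) x)"
        by (simp add: sum.cartesian_product)
      also have "\<dots> = a x \<bullet> u_vec h z x"
        using elim by (simp add: inner_u_vec UNIV_bool t_def sum.distrib)
      finally have "(a x \<bullet> u_vec h z x)\<^sup>2 = (\<Sum>i\<in>UNIV. \<Sum>j\<in>UNIV. t i x * t j x)"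
        by (simp add: power2_eq_square sum_product[symmetric])
      then show ?case
        by (simp add: sum_distrib_left)
    qed
  qed
  have m: "(\<lambda>x. K_prod K h z x * (a x \<bullet> u_vec h z x)\<^sup>2) \<in> borel_measurable cube_measure"
  proof -
    have "(\<lambda>x. a x $ l * u_vec h z x $ l) \<in> borel_measurable cube_measure" for l
    proof (intro borel_measurable_times)
      show "(\<lambda>x. a x $ l) \<in> borel_measurable cube_measure"
        using aF by (auto simp: F_full_iff intro: sq_integrable_measurable)
      show "(\<lambda>x. u_vec h z x $ l) \<in> borel_measurable cube_measure"
        by (cases l) (simp_all add: u_vec_def)
    qed
    then show ?thesis
      unfolding inner_vec_def inner_real_def
      by (intro borel_measurable_times[OF K_prod_measurable[OF z]] borel_measurable_power borel_measurable_sum)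
  qed
  have int: "integrable cube_measure (\<lambda>x. \<Sum>i\<in>UNIV. \<Sum>j\<in>UNIV. K_prod K h z x * (t i x * t j x))"
    by (intro Bochner_Integration.integrable_sum tt)
  show "integrable cube_measure (\<lambda>x. K_prod K h z x * (a x \<bullet> u_vec h z x)\<^sup>2)"
    using integrable_cong_AE_imp[OF int m] ae by (simp add: eq_commute)
  have "(LINT x|cube_measure. K_prod K h z x * (a x \<bullet> u_vec h z x)\<^sup>2)
      = (LINT x|cube_measure. (\<Sum>i\<in>UNIV. \<Sum>j\<in>UNIV. K_prod K h z x * (t i x * t j x)))"
    by (intro integral_cong_AE m borel_measurable_integrable[OF int] ae)
  also have "\<dots> = (\<Sum>i\<in>UNIV. \<Sum>j\<in>UNIV. LINT x|cube_measure. K_prod K h z x * (t i x * t j x))"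
    by (simp add: Bochner_Integration.integral_sum Bochner_Integration.integrable_sum tt(1))
  finally show "(LINT x|cube_measure. K_prod K h z x * (a x \<bullet> u_vec h z x)\<^sup>2)
      = (\<Sum>i\<in>UNIV. \<Sum>j\<in>UNIV. LINT x|cube_measure. pair_kernel i j z x * (\<psi> i (x $ fst i) * \<psi> j (x $ fst j)))"
    by (simp add: tt(2))
qed

lemma Q_loss_expansion:
  fixes a :: "'d tuple_fun"
  assumes \<psi>: "has_components a \<psi>" and aF: "a \<in> F_full" and X: "\<And>m. m \<in> {1..n} \<Longrightarrow> X m \<in> unit_cube"
  shows "Q_loss n K h X (\<lambda>_. 0) a = 1 / real n * (\<Sum>m=1..n.
    \<Sum>i\<in>UNIV. \<Sum>j\<in>UNIV. LINT x|cube_measure. pair_kernel i j (X m) x * (\<psi> i (x $ fst i) * \<psi> j (x $ fst j)))"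
proof -
  have "Q_loss n K h X (\<lambda>_. 0) a
      = (LINT x|cube_measure. (\<Sum>m=1..n. 1 / real n * (K_prod K h (X m) x * (a x \<bullet> u_vec h (X m) x)\<^sup>2)))"
    unfolding Q_loss_eq_lsq lsq_def by simp
  also have "\<dots> = (\<Sum>m=1..n. 1 / real n * (LINT x|cube_measure. K_prod K h (X m) x * (a x \<bullet> u_vec h (X m) x)\<^sup>2))"
    using local_form_expansion(1)[OF \<psi> X aF] by (subst Bochner_Integration.integral_sum) auto
  also have "\<dots> = 1 / real n * (\<Sum>m=1..n. LINT x|cube_measure. K_prod K h (X m) x * (a x \<bullet> u_vec h (X m) x)\<^sup>2)"
    by (rule sum_distrib_left[symmetric])
  also have "(\<Sum>m=1..n. LINT x|cube_measure. K_prod K h (X m) x * (a x \<bullet> u_vec h (X m) x)\<^sup>2)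
      = (\<Sum>m=1..n. \<Sum>i\<in>UNIV. \<Sum>j\<in>UNIV. LINT x|cube_measure. pair_kernel i j (X m) x * (\<psi> i (x $ fst i) * \<psi> j (x $ fst j)))"
    by (intro sum.cong refl local_form_expansion(2)[OF \<psi> X aF])
  finally show ?thesis .
qed

end

section \<open>The mean of the quadratic form\<close>

text \<open>A nonzero affine function vanishes only on a hyperplane or nowhere, hence not almost
  everywhere on a box. So the quadratic form is positive on the unit sphere, and compactness and
  homogeneity give c. The nonnegative integral spares integrability proofs in later
  substitutions.\<close>

lemma affine_form_coercive:
  assumes "\<alpha> < \<beta>"
  shows "\<exists>c>0. \<forall>v :: real ^ 'd::finite option. ennreal (c * (norm v)\<^sup>2)
    \<le> (\<integral>\<^sup>+y. ennreal (indicator (cbox (\<chi> k. \<alpha>) (\<chi> k. \<beta>)) y * (v $ None + (\<Sum>k\<in>UNIV. v $ Some k * y $ k))\<^sup>2) \<partial>lborel)"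
proof -
  let ?Q = "cbox (\<chi> k. \<alpha>) (\<chi> k. \<beta>) :: (real ^ 'd) set"
  define V where "V l y = (case l of None \<Rightarrow> 1 | Some k \<Rightarrow> y $ k)" for l and y :: "real ^ 'd"
  define A where "A v y = v $ None + (\<Sum>k\<in>UNIV. v $ Some k * y $ k)" for v :: "real ^ 'd option" and y
  define q where "q v = (LINT y|lborel. indicator ?Q y *\<^sub>R (A v y)\<^sup>2)" for v
  have A: "A v y = (\<Sum>l\<in>UNIV. v $ l * V l y)" for v y
    by (simp add: A_def V_def UNIV_option_conv sum.reindex)
  have "continuous_on ?Q (V l)" for l
    by (cases l) (auto simp: V_def intro!: continuous_intros)
  then have iV: "integrable lborel (\<lambda>y. indicator ?Q y *\<^sub>R (V l y * V m y))" for l m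
    by (intro borel_integrable_compact continuous_on_mult) auto
  have sq: "indicator ?Q y *\<^sub>R (A v y)\<^sup>2 = (\<Sum>l\<in>UNIV. \<Sum>m\<in>UNIV. (v $ l * v $ m) * (indicator ?Q y *\<^sub>R (V l y * V m y)))" for v y
    by (simp add: A power2_eq_square sum_product sum_distrib_left mult_ac)
  have iA: "integrable lborel (\<lambda>y. indicator ?Q y *\<^sub>R (A v y)\<^sup>2)" for v
    unfolding sq by (intro Bochner_Integration.integrable_sum integrable_mult_right iV)
  have q: "q v = (\<Sum>l\<in>UNIV. \<Sum>m\<in>UNIV. (v $ l * v $ m) * (LINT y|lborel. indicator ?Q y *\<^sub>R (V l y * V m y)))" for v
    unfolding q_def sq using iV by simp
  have cont: "continuous_on T q" for T
    unfolding q by (intro continuous_intros)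
  have pos: "0 < q v" if "v \<noteq> 0" for v
  proof (rule ccontr)
    assume "\<not> 0 < q v"
    moreover have "0 \<le> q v"
      unfolding q_def by (intro integral_nonneg_AE) auto
    ultimately have "q v = 0"
      by simp
    then have "AE y in lborel. indicator ?Q y *\<^sub>R (A v y)\<^sup>2 = 0"
      using iA unfolding q_def by (subst (asm) integral_nonneg_eq_0_iff_AE) auto
    then have ae: "AE y in lborel. y \<in> ?Q \<longrightarrow> A v y = 0"
      by (auto elim!: eventually_mono)
    define w where "w = (\<chi> k. v $ Some k)"
    let ?H = "{y. w \<bullet> y = - v $ None}"
    \<comment> \<open>Either \<open>?H\<close> is a proper hyperplane, or w = 0 and
      \<open>?H\<close> is empty; both cases are negligible.\<close>
    have "w \<noteq> 0 \<or> - v $ None \<noteq> 0"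
    proof (rule ccontr)
      assume *: "\<not> (w \<noteq> 0 \<or> - v $ None \<noteq> 0)"
      then have "w $ k = 0" for k
        by simp
      then have "v $ l = 0" for l
        using * by (cases l) (simp_all add: w_def)
      then show False
        using that by (simp add: vec_eq_iff)
    qed
    then have "negligible ?H"
      by (rule negligible_hyperplane)
    then have "?H \<in> null_sets lebesgue"
      by (simp add: negligible_iff_null_sets)
    moreover have H: "?H \<in> sets lborel"
      using closed_hyperplane[of w "- v $ None"] by simp
    ultimately have "emeasure lborel ?H = 0"
      by (simp add: null_sets_def emeasure_completion)
    moreover have "emeasure lborel ?Q \<le> emeasure lborel ?H"
    proof (rule emeasure_mono_AE[OF _ H])
      show "AE y in lborel. y \<in> ?Q \<longrightarrow> y \<in> ?H"
        using ae by (auto elim!: eventually_mono simp: A_def w_def inner_vec_def add_eq_0_iff)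
    qed
    moreover have "emeasure lborel ?Q \<noteq> 0"
      using assms by (subst emeasure_lborel_cbox_eq) (auto simp: Basis_vec_def inner_axis ennreal_eq_0_iff prod_zero_iff intro!: prod_pos simp: not_le)
    ultimately show False
      by simp
  qed
  have "axis None 1 \<in> sphere (0 :: real ^ 'd option) 1"
    by simp
  then have "sphere (0 :: real ^ 'd option) 1 \<noteq> {}"
    by blast
  then obtain v0 where v0: "v0 \<in> sphere 0 1" "\<And>v. v \<in> sphere 0 1 \<Longrightarrow> q v0 \<le> q v"
    using continuous_attains_inf[OF compact_sphere _ cont] by blast
  have c: "0 < q v0"
    using v0(1) by (intro pos) auto
  have "ennreal (q v0 * (norm v)\<^sup>2) \<le> (\<integral>\<^sup>+y. ennreal (indicator ?Q y * (A v y)\<^sup>2) \<partial>lborel)" for v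
  proof (cases "v = 0")
    case False
    let ?w = "(1 / norm v) *\<^sub>R v"
    have "q v0 \<le> q ?w"
      using False by (intro v0) auto
    also have "q ?w = (1 / norm v)\<^sup>2 * q v"
      unfolding q sum_distrib_left by (simp add: power2_eq_square mult_ac)
    finally have "q v0 * (norm v)\<^sup>2 \<le> q v"
      using False by (simp add: field_simps)
    then have "ennreal (q v0 * (norm v)\<^sup>2) \<le> ennreal (q v)"
      by (rule ennreal_leI)
    also have "\<dots> = (\<integral>\<^sup>+y. ennreal (indicator ?Q y *\<^sub>R (A v y)\<^sup>2) \<partial>lborel)"
      unfolding q_def by (rule nn_integral_eq_integral[OF iA, symmetric]) auto
    finally show ?thesis
      by simp
  qed simp
  with c show ?thesis
    unfolding A_def by blast
qed

text \<open>Negative entries of c are allowed since the substitution will reflect coordinates,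
  whence the absolute values.\<close>

lemma nn_integral_cart_affine:
  fixes x c :: "real ^ 'd::finite"
  assumes f [measurable]: "f \<in> borel_measurable borel" and c: "\<And>k. c $ k \<noteq> 0"
  shows "(\<integral>\<^sup>+z. f z \<partial>lborel) = ennreal (\<Prod>k\<in>UNIV. \<bar>c $ k\<bar>) * (\<integral>\<^sup>+y. f (\<chi> k. x $ k + c $ k * y $ k) \<partial>lborel)"
proof -
  define T where "T y = x + (\<Sum>j\<in>Basis. ((c \<bullet> j) * (y \<bullet> j)) *\<^sub>R j)" for y
  have T: "T y = (\<chi> k. x $ k + c $ k * y $ k)" for y
  proof (simp add: vec_eq_iff, intro allI)
    fix k :: 'd
    have ax: "axis k (1 :: real) \<in> Basis"
      by (simp add: axis_in_Basis_iff)
    have "T y $ k = T y \<bullet> axis k 1"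
      by (simp add: inner_axis)
    also have "\<dots> = x $ k + c $ k * y $ k"
      unfolding T_def inner_add_left inner_sum_left_Basis[OF ax] by (simp add: inner_axis)
    finally show "T y $ k = x $ k + c $ k * y $ k" .
  qed
  have Tm [measurable]: "T \<in> borel_measurable borel"
    unfolding T_def[abs_def] by measurable
  have nz: "c \<bullet> j \<noteq> 0" if "j \<in> Basis" for j
    using that c by (auto simp: Basis_vec_def inner_axis)
  have "lborel = density (distr lborel borel T) (\<lambda>_. ennreal (\<Prod>j\<in>Basis. \<bar>c \<bullet> j\<bar>))"
    using lborel_affine_euclidean[of "\<lambda>j. c \<bullet> j" x] nz by (simp add: T_def[abs_def])
  then have "(\<integral>\<^sup>+z. f z \<partial>lborel) = (\<integral>\<^sup>+z. f z \<partial>density (distr lborel borel T) (\<lambda>_. ennreal (\<Prod>j\<in>Basis. \<bar>c \<bullet> j\<bar>)))"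
    by simp
  also have "\<dots> = ennreal (\<Prod>j\<in>Basis. \<bar>c \<bullet> j\<bar>) * (\<integral>\<^sup>+y. f (T y) \<partial>lborel)"
    by (simp add: nn_integral_density nn_integral_distr nn_integral_cmult)
  also have "(\<Prod>j\<in>Basis. \<bar>c \<bullet> j\<bar>) = (\<Prod>k\<in>UNIV. \<bar>c $ k\<bar>)"
    by (rule prod_Basis_cart)
  finally show ?thesis
    by (simp add: T)
qed

context smoothing_kernel
begin

text \<open>
  Near the boundary only one side of the kernel window lies in the unit cube; reflecting the
  coordinates of the window accordingly always leaves a box on which K is bounded away from 0.
\<close>

lemma local_form_mean_coercive:
  "\<exists>c>0. \<forall>(h :: real ^ 'd::finite) x v. (\<forall>k. 0 < h $ k \<and> h $ k * \<beta> \<le> 1 / 2) \<longrightarrow> x \<in> unit_cube \<longrightarrow>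
    ennreal (c * (norm v)\<^sup>2)
      \<le> (\<integral>\<^sup>+z. ennreal (indicator unit_cube z * (K_prod K h z x * (v \<bullet> u_vec h z x)\<^sup>2)) \<partial>lborel)"
proof -
  let ?Q = "cbox (\<chi> k. \<alpha>) (\<chi> k. \<beta>) :: (real ^ 'd) set"
  obtain c where c: "0 < c" "\<And>v :: real ^ 'd option. ennreal (c * (norm v)\<^sup>2)
    \<le> (\<integral>\<^sup>+y. ennreal (indicator ?Q y * (v $ None + (\<Sum>k\<in>UNIV. v $ Some k * y $ k))\<^sup>2) \<partial>lborel)"
    using affine_form_coercive[OF \<alpha>_less_\<beta>] by blast
  \<comment> \<open>The lower bound of K over the upper bound \<open>mass_le\<close> of the
    denominator, with the bandwidth divided out.\<close>
  define \<rho> where "\<rho> = \<kappa> / (B * 2 * S)"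
  have B: "0 < B"
    using \<kappa>_pos \<kappa>_le[of \<alpha>] K_le[of \<alpha>] \<alpha>_less_\<beta> by simp
  have \<rho>: "0 < \<rho>"
    using B S_pos \<kappa>_pos by (simp add: \<rho>_def)
  have "ennreal (\<rho> ^ CARD('d) * c * (norm v)\<^sup>2)
      \<le> (\<integral>\<^sup>+z. ennreal (indicator unit_cube z * (K_prod K h z x * (v \<bullet> u_vec h z x)\<^sup>2)) \<partial>lborel)"
    if h: "\<And>k. 0 < h $ k" "\<And>k. h $ k * \<beta> \<le> 1 / 2" and x: "x \<in> unit_cube"
    for h x :: "real ^ 'd" and v
  proof -
    define \<sigma> :: "'d \<Rightarrow> real" where "\<sigma> k = (if x $ k \<le> 1 / 2 then 1 else - 1)" for k
    define b where "b = (\<chi> k. h $ k * \<sigma> k)"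
    \<comment> \<open>Reflecting coordinates amounts to flipping the signs of slopes of the affine
      function, which preserves the norm.\<close>
    define w where "w = (\<chi> l. case l of None \<Rightarrow> v $ None | Some k \<Rightarrow> \<sigma> k * v $ Some k)"
    define T where "T y = (\<chi> k. x $ k + b $ k * y $ k)" for y :: "real ^ 'd"
    have hne: "h $ k \<noteq> 0" "\<bar>h $ k\<bar> = h $ k" for k
      using h(1)[of k] by auto
    have sx: "0 \<le> x $ k" "x $ k \<le> 1" for k
      using x by (simp_all add: mem_box_cart)
    have "norm w = norm v"
    proof -
      have "\<bar>w $ l\<bar> = \<bar>v $ l\<bar>" for l
        by (cases l) (simp_all add: w_def \<sigma>_def abs_mult)
      then show ?thesis
        by (simp add: norm_vec_def)
    qed
    have lower: "(\<Prod>k\<in>UNIV. \<rho> / h $ k) * (indicator ?Q y * (w $ None + (\<Sum>k\<in>UNIV. w $ Some k * y $ k))\<^sup>2)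
        \<le> indicator unit_cube (T y) * (K_prod K h (T y) x * (v \<bullet> u_vec h (T y) x)\<^sup>2)" for y
    proof (cases "y \<in> ?Q")
      case False
      have "0 \<le> K_prod K h (T y) x" if "T y \<in> unit_cube"
      proof -
        have "T y $ k \<in> {0..1}" for k
          using that by (simp add: mem_box_cart)
        then have "0 \<le> K ((T y $ k - x $ k) / h $ k) / mass (h $ k) (T y $ k)" for k
          using mass_pos[OF h(1,2)] by (intro divide_nonneg_nonneg K_nonneg) (simp add: less_imp_le)
        then show ?thesis
          unfolding K_prod_def mass_def[symmetric] by (intro prod_nonneg) auto
      qed
      then show ?thesis
        using False by (auto simp: indicator_def)
    next
      case True
      then have y: "\<alpha> \<le> y $ k" "y $ k \<le> \<beta>" for k
        by (simp_all add: mem_box_cart)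
      have Tk: "T y $ k - x $ k = h $ k * (\<sigma> k * y $ k)" for k
        by (simp add: T_def b_def)
      have hy: "0 \<le> h $ k * y $ k" "h $ k * y $ k \<le> 1 / 2" for k
      proof -
        show "0 \<le> h $ k * y $ k"
          using h(1)[of k] y(1)[of k] \<alpha>_pos by (intro mult_nonneg_nonneg) auto
        have "h $ k * y $ k \<le> h $ k * \<beta>"
          using h(1)[of k] y(2)[of k] by (intro mult_left_mono) auto
        then show "h $ k * y $ k \<le> 1 / 2"
          using h(2)[of k] by linarith
      qed
      have TQ: "T y $ k \<in> {0..1}" for k
        using hy[of k] sx[of k] by (auto simp: T_def b_def \<sigma>_def)
      have "\<rho> / h $ k \<le> K ((T y $ k - x $ k) / h $ k) / mass (h $ k) (T y $ k)" for k
      proof -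
        have "K ((T y $ k - x $ k) / h $ k) = K (\<sigma> k * y $ k)"
          using h(1)[of k] by (simp add: Tk)
        also have "\<dots> = K (y $ k)"
          by (simp add: \<sigma>_def K_even)
        finally have "\<kappa> \<le> K ((T y $ k - x $ k) / h $ k)"
          using \<kappa>_le[OF y] by simp
        then have "\<kappa> / (B * 2 * S * h $ k) \<le> K ((T y $ k - x $ k) / h $ k) / mass (h $ k) (T y $ k)"
          using \<kappa>_pos by (intro frac_le mass_le mass_pos h TQ) auto
        then show ?thesis
          by (simp add: \<rho>_def)
      qed
      then have "(\<Prod>k\<in>UNIV. \<rho> / h $ k) \<le> K_prod K h (T y) x"
        unfolding K_prod_def mass_def[symmetric] using \<rho> h(1) by (intro prod_mono) (simp add: less_imp_le)
      moreover have "v \<bullet> u_vec h (T y) x = w $ None + (\<Sum>k\<in>UNIV. w $ Some k * y $ k)"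
        unfolding inner_u_vec Tk using h(1) by (simp add: w_def less_imp_neq[symmetric] mult_ac)
      moreover have "T y \<in> unit_cube"
        using TQ by (simp add: mem_box_cart)
      ultimately show ?thesis
        using True by (simp add: mult_right_mono)
    qed
    have m: "(\<lambda>z. indicator unit_cube z * (K_prod K h z x * (v \<bullet> u_vec h z x)\<^sup>2)) \<in> borel_measurable borel"
      unfolding K_prod_def mass_def[symmetric] inner_u_vec by measurable
    have P: "0 \<le> (\<Prod>k\<in>UNIV. \<rho> / h $ k)"
      using \<rho> h(1) by (intro prod_nonneg) (simp add: less_imp_le)
    have "ennreal (\<rho> ^ CARD('d) * c * (norm v)\<^sup>2) = ennreal (\<Prod>k\<in>UNIV. \<bar>b $ k\<bar>) * (ennreal (\<Prod>k\<in>UNIV. \<rho> / h $ k) * ennreal (c * (norm w)\<^sup>2))"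
    proof -
      \<comment> \<open>The Jacobian cancels the factors 1 / h of the kernel, so the constant is
        free of the bandwidth.\<close>
      have "(\<Prod>k\<in>UNIV. \<bar>b $ k\<bar>) * (\<Prod>k\<in>UNIV. \<rho> / h $ k) = (\<Prod>k\<in>(UNIV :: 'd set). \<rho>)"
        unfolding prod.distrib[symmetric]
        using hne by (intro prod.cong) (auto simp: b_def \<sigma>_def abs_mult)
      then have "(\<Prod>k\<in>UNIV. \<bar>b $ k\<bar>) * ((\<Prod>k\<in>UNIV. \<rho> / h $ k) * (c * (norm w)\<^sup>2)) = \<rho> ^ CARD('d) * c * (norm v)\<^sup>2"
        by (simp add: \<open>norm w = norm v\<close> mult.assoc[symmetric])
      moreover have "ennreal (p * (q * r)) = ennreal p * (ennreal q * ennreal r)"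
        if "0 \<le> p" "0 \<le> q" "0 \<le> r" for p q r :: real
        using that by (simp add: ennreal_mult)
      moreover have "0 \<le> (\<Prod>k\<in>UNIV. \<bar>b $ k\<bar>)" "0 \<le> c * (norm w)\<^sup>2"
        using c(1) by (auto intro: prod_nonneg)
      ultimately show ?thesis
        using P by metis
    qed
    also have "\<dots> \<le> ennreal (\<Prod>k\<in>UNIV. \<bar>b $ k\<bar>) * (ennreal (\<Prod>k\<in>UNIV. \<rho> / h $ k)
        * (\<integral>\<^sup>+y. ennreal (indicator ?Q y * (w $ None + (\<Sum>k\<in>UNIV. w $ Some k * y $ k))\<^sup>2) \<partial>lborel))"
      by (intro mult_left_mono c) auto
    also have "\<dots> = ennreal (\<Prod>k\<in>UNIV. \<bar>b $ k\<bar>)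
        * (\<integral>\<^sup>+y. ennreal ((\<Prod>k\<in>UNIV. \<rho> / h $ k) * (indicator ?Q y * (w $ None + (\<Sum>k\<in>UNIV. w $ Some k * y $ k))\<^sup>2)) \<partial>lborel)"
      using P by (subst nn_integral_cmult[symmetric]) (auto simp: ennreal_mult'')
    also have "\<dots> \<le> ennreal (\<Prod>k\<in>UNIV. \<bar>b $ k\<bar>)
        * (\<integral>\<^sup>+y. ennreal (indicator unit_cube (T y) * (K_prod K h (T y) x * (v \<bullet> u_vec h (T y) x)\<^sup>2)) \<partial>lborel)"
      by (intro mult_left_mono nn_integral_mono ennreal_leI lower) auto
    also have "\<dots> = (\<integral>\<^sup>+z. ennreal (indicator unit_cube z * (K_prod K h z x * (v \<bullet> u_vec h z x)\<^sup>2)) \<partial>lborel)"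
      unfolding T_def using m h(1)
      by (intro nn_integral_cart_affine[symmetric]) (auto simp: b_def \<sigma>_def less_imp_neq[symmetric])
    finally show ?thesis .
  qed
  moreover have "0 < \<rho> ^ CARD('d) * c"
    using \<rho> c(1) by simp
  ultimately show ?thesis
    by blast
qed

text \<open>The local bound is integrated over x, and Tonelli's theorem exchanges x with the
  observation z, whose density is at least c on the cube. The constant depends neither on a nor on
  the bandwidth.\<close>

lemma form_mean_coercive:
  fixes g :: "real ^ 'd::finite \<Rightarrow> ennreal"
  assumes g: "g \<in> borel_measurable borel" "0 < c" "\<And>z. z \<in> unit_cube \<Longrightarrow> ennreal c \<le> g z"
  shows "\<exists>c0>0. \<forall>h a. (\<forall>k. 0 < h $ k \<and> h $ k * \<beta> \<le> 1 / 2) \<longrightarrow> a \<in> F_full \<longrightarrow>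
    ennreal (c0 * (l2_norm a)\<^sup>2)
      \<le> (\<integral>\<^sup>+z. (\<integral>\<^sup>+x. ennreal (K_prod K h z x * (a x \<bullet> u_vec h z x)\<^sup>2) \<partial>cube_measure) \<partial>density lborel g)"
proof -
  obtain c1 where c1: "0 < c1" "\<And>(h :: real ^ 'd) x v. (\<And>k. 0 < h $ k) \<Longrightarrow> (\<And>k. h $ k * \<beta> \<le> 1 / 2) \<Longrightarrow> x \<in> unit_cube \<Longrightarrow>
    ennreal (c1 * (norm v)\<^sup>2)
      \<le> (\<integral>\<^sup>+z. ennreal (indicator unit_cube z * (K_prod K h z x * (v \<bullet> u_vec h z x)\<^sup>2)) \<partial>lborel)"
    using local_form_mean_coercive[where 'd = 'd] by blast
  have "ennreal (c * c1 * (l2_norm a)\<^sup>2)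
      \<le> (\<integral>\<^sup>+z. (\<integral>\<^sup>+x. ennreal (K_prod K h z x * (a x \<bullet> u_vec h z x)\<^sup>2) \<partial>cube_measure) \<partial>density lborel g)"
    if h: "\<And>k. 0 < h $ k" "\<And>k. h $ k * \<beta> \<le> 1 / 2" and a: "a \<in> F_full" for h :: "real ^ 'd" and a
  proof -
    interpret P: pair_sigma_finite "lborel :: (real ^ 'd) measure" "cube_measure :: (real ^ 'd) measure"
      by (simp add: pair_sigma_finite_def lborel.sigma_finite_measure_axioms cube.sigma_finite_measure_axioms)
    have am [measurable]: "(\<lambda>x. a x $ l) \<in> borel_measurable cube_measure" for l
      using a by (auto simp: F_full_iff intro: sq_integrable_measurable)
    let ?P = "lborel \<Otimes>\<^sub>M cube_measure :: ((real ^ 'd) \<times> (real ^ 'd)) measure"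
    have sm [measurable]: "(\<lambda>p. snd p $ k) \<in> borel_measurable ?P" for k
      by (rule measurable_compose[OF measurable_snd measurable_cube_component])
    have fm [measurable]: "(\<lambda>p. fst p $ k) \<in> borel_measurable ?P" for k
      by (rule measurable_compose[OF measurable_fst]) simp
    have asm [measurable]: "(\<lambda>p. a (snd p) $ l) \<in> borel_measurable ?P" for l
      by (rule measurable_compose[OF measurable_snd am])
    have mm [measurable]: "(\<lambda>p. mass (h $ k) (fst p $ k)) \<in> borel_measurable ?P" for k
      by (rule measurable_compose[OF fm mass_measurable])
    have F [measurable]: "(\<lambda>p. K_prod K h (fst p) (snd p) * (a (snd p) \<bullet> u_vec h (fst p) (snd p))\<^sup>2)
        \<in> borel_measurable (lborel \<Otimes>\<^sub>M cube_measure)"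
      unfolding K_prod_def mass_def[symmetric] inner_u_vec by simp
    have F1: "(\<lambda>z. \<integral>\<^sup>+x. ennreal (K_prod K h z x * (a x \<bullet> u_vec h z x)\<^sup>2) \<partial>cube_measure) \<in> borel_measurable lborel"
      using cube.borel_measurable_nn_integral_fst[OF measurable_compose[OF F measurable_ennreal]] by simp
    have norm_sq: "ennreal ((l2_norm a)\<^sup>2) = (\<integral>\<^sup>+x. ennreal ((norm (a x))\<^sup>2) \<partial>cube_measure)"
    proof -
      have eq: "(norm (a x))\<^sup>2 = (\<Sum>l\<in>UNIV. (a x $ l)\<^sup>2)" for x
        by (simp add: norm_vec_def L2_set_def sum_nonneg)
      have i: "integrable cube_measure (\<lambda>x. (a x $ l)\<^sup>2)" for l
        using a by (simp add: F_full_iff sq_integrable_def)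
      have "(l2_norm a)\<^sup>2 = (LINT x|cube_measure. (norm (a x))\<^sup>2)"
        using i by (simp add: eq l2_norm_def sum_nonneg)
      moreover have "integrable cube_measure (\<lambda>x. (norm (a x))\<^sup>2)"
        using i by (simp add: eq)
      ultimately show ?thesis
        by (simp add: nn_integral_eq_integral)
    qed
    have nm: "(\<lambda>x. ennreal ((norm (a x))\<^sup>2)) \<in> borel_measurable cube_measure"
      unfolding norm_vec_def L2_set_def by measurable
    have Gm: "(\<lambda>p. ennreal (indicator unit_cube (fst p) * (K_prod K h (fst p) (snd p) * (a (snd p) \<bullet> u_vec h (fst p) (snd p))\<^sup>2)))
        \<in> borel_measurable (lborel \<Otimes>\<^sub>M cube_measure)"
      by measurable
    have "ennreal (c * c1 * (l2_norm a)\<^sup>2) = ennreal c * (ennreal c1 * ennreal ((l2_norm a)\<^sup>2))"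
      using g(2) c1(1) by (simp add: mult.assoc flip: ennreal_mult)
    also have "\<dots> = ennreal c * (\<integral>\<^sup>+x. ennreal (c1 * (norm (a x))\<^sup>2) \<partial>cube_measure)"
      unfolding norm_sq using nm c1(1) by (simp add: nn_integral_cmult[symmetric] ennreal_mult)
    also have "\<dots> \<le> ennreal c * (\<integral>\<^sup>+x. (\<integral>\<^sup>+z. ennreal (indicator unit_cube z * (K_prod K h z x * (a x \<bullet> u_vec h z x)\<^sup>2)) \<partial>lborel) \<partial>cube_measure)"
      by (intro mult_left_mono nn_integral_mono c1(2) h) (auto simp: space_cube)
    also have "\<dots> = ennreal c * (\<integral>\<^sup>+z. (\<integral>\<^sup>+x. ennreal (indicator unit_cube z * (K_prod K h z x * (a x \<bullet> u_vec h z x)\<^sup>2)) \<partial>cube_measure) \<partial>lborel)"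
      using P.Fubini[OF Gm] by simp
    also have "\<dots> = (\<integral>\<^sup>+z. ennreal c * indicator unit_cube z * (\<integral>\<^sup>+x. ennreal (K_prod K h z x * (a x \<bullet> u_vec h z x)\<^sup>2) \<partial>cube_measure) \<partial>lborel)"
      using F1 by (subst nn_integral_cmult[symmetric])
        (auto intro!: nn_integral_cong borel_measurable_times_ennreal simp: indicator_def mult.assoc
          cong: measurable_cong)
    also have "\<dots> \<le> (\<integral>\<^sup>+z. g z * (\<integral>\<^sup>+x. ennreal (K_prod K h z x * (a x \<bullet> u_vec h z x)\<^sup>2) \<partial>cube_measure) \<partial>lborel)"
      by (intro nn_integral_mono mult_right_mono) (auto simp: indicator_def g)
    also have "\<dots> = (\<integral>\<^sup>+z. (\<integral>\<^sup>+x. ennreal (K_prod K h z x * (a x \<bullet> u_vec h z x)\<^sup>2) \<partial>cube_measure) \<partial>density lborel g)"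
      using g(1) F1 by (subst nn_integral_density) auto
    finally show ?thesis .
  qed
  moreover have "0 < c * c1"
    using g(2) c1(1) by simp
  ultimately show ?thesis
    by blast
qed

end

section \<open>Concentration of kernel averages\<close>

definition avg_error :: "nat \<Rightarrow> (nat \<Rightarrow> 'b) \<Rightarrow> 'b measure \<Rightarrow> ('b \<Rightarrow> real) \<Rightarrow> real"
  where "avg_error n Z \<mu> g = 1 / real n * (\<Sum>i=1..n. g (Z i)) - (LINT z|\<mu>. g z)"

locale iid_sample = prob_space M for M :: "'a measure" +
  fixes n :: nat and Z :: "nat \<Rightarrow> 'a \<Rightarrow> 'b" and N \<mu> :: "'b measure"
  assumes n_pos: "0 < n"
    and indep: "indep_vars (\<lambda>_. N) Z {1..n}"
    and distr_Z: "i \<in> {1..n} \<Longrightarrow> distr M N (Z i) = \<mu>"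
begin

lemma Z_measurable: "i \<in> {1..n} \<Longrightarrow> Z i \<in> M \<rightarrow>\<^sub>M N"
  using indep by (auto simp: indep_vars_def)

lemma sets_\<mu>: "sets \<mu> = sets N"
  using distr_Z[of 1] n_pos by (metis atLeastAtMost_iff less_eq_Suc_le One_nat_def order_refl sets_distr)

lemma prob_space_\<mu>: "prob_space \<mu>"
proof -
  have "prob_space (distr M N (Z 1))"
    using n_pos by (intro prob_space_distr Z_measurable) auto
  then show ?thesis
    using distr_Z[of 1] n_pos by simp
qed

lemma bounded_integrable_\<mu>:
  fixes g :: "'b \<Rightarrow> real"
  assumes "g \<in> borel_measurable N" "\<And>z. \<bar>g z\<bar> \<le> B"
  shows "integrable \<mu> g"
proof -
  interpret \<mu>: prob_space \<mu>
    by (rule prob_space_\<mu>)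
  show ?thesis
    by (rule \<mu>.integrable_const_bound[where B = B])
      (use assms in \<open>auto simp: measurable_cong_sets[OF sets_\<mu> refl]\<close>)
qed

lemma avg_error_measurable:
  assumes "g \<in> borel_measurable N"
  shows "(\<lambda>\<omega>. avg_error n (\<lambda>i. Z i \<omega>) \<mu> g) \<in> borel_measurable M"
  unfolding avg_error_def
  by (intro borel_measurable_diff borel_measurable_times borel_measurable_sum borel_measurable_const
      measurable_compose[OF Z_measurable assms])

lemma abs_avg_error_le:
  assumes g: "g \<in> borel_measurable N" "\<And>z. \<bar>g z\<bar> \<le> B"
  shows "\<bar>avg_error n z \<mu> g\<bar> \<le> 2 * B"
proof -
  interpret \<mu>: prob_space \<mu>
    by (rule prob_space_\<mu>)
  have "\<bar>\<Sum>i=1..n. g (z i)\<bar> \<le> (\<Sum>i=1..n. B)"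
    by (rule order_trans[OF sum_abs]) (intro sum_mono g)
  then have "\<bar>1 / real n * (\<Sum>i=1..n. g (z i))\<bar> \<le> B"
    using n_pos by (simp add: abs_mult field_simps)
  moreover have "\<bar>LINT z|\<mu>. g z\<bar> \<le> B"
  proof -
    have "\<bar>LINT z|\<mu>. g z\<bar> \<le> (LINT z|\<mu>. \<bar>g z\<bar>)"
      by (rule integral_abs_bound)
    also have "\<dots> \<le> (LINT z|\<mu>. B)"
      using bounded_integrable_\<mu>[OF g] by (intro integral_mono g(2)) auto
    finally show ?thesis
      by (simp add: \<mu>.prob_space)
  qed
  ultimately show ?thesis
    unfolding avg_error_def by linarith
qed

text \<open>The variance of a mean of independent terms: mixed terms vanish, and each variance is at
  most the second moment.\<close>

lemma expectation_avg_error_square: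
  assumes g: "g \<in> borel_measurable N" "\<And>z. \<bar>g z\<bar> \<le> B"
  shows "expectation (\<lambda>\<omega>. (avg_error n (\<lambda>i. Z i \<omega>) \<mu> g)\<^sup>2) \<le> B\<^sup>2 / real n"
proof -
  interpret \<mu>: prob_space \<mu>
    by (rule prob_space_\<mu>)
  define m where "m = (LINT z|\<mu>. g z)"
  define W where "W i \<omega> = g (Z i \<omega>) - m" for i \<omega>
  have Zm: "Z i \<in> M \<rightarrow>\<^sub>M N" if "i \<in> {1..n}" for i
    by (rule Z_measurable[OF that])
  have gZ: "(\<lambda>\<omega>. g (Z i \<omega>)) \<in> borel_measurable M" if "i \<in> {1..n}" for i
    by (rule measurable_compose[OF Zm[OF that] g(1)])
  have int_g: "integrable M (\<lambda>\<omega>. g (Z i \<omega>))" if "i \<in> {1..n}" for i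
    by (rule integrable_const_bound[where B = B]) (use g gZ[OF that] in auto)
  have m_eq: "m = expectation (\<lambda>\<omega>. g (Z i \<omega>))" if "i \<in> {1..n}" for i
    unfolding m_def distr_Z[OF that, symmetric] by (rule integral_distr[OF Zm[OF that] g(1)])
  have int_W: "integrable M (W i)" if "i \<in> {1..n}" for i
    unfolding W_def using int_g[OF that] by simp
  have EW: "expectation (W i) = 0" if "i \<in> {1..n}" for i
    unfolding W_def using int_g[OF that] m_eq[OF that] by (simp add: prob_space)
  have indep_W: "indep_vars (\<lambda>_. borel) W {1..n}"
    unfolding W_def by (rule indep_vars_compose2[OF indep]) (use g(1) in simp)
  have B: "0 \<le> B"
    using g(2) abs_ge_zero order_trans by blast
  have gW: "\<bar>W i \<omega>\<bar> \<le> B + \<bar>m\<bar>" for i \<omega>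
    using g(2)[of "Z i \<omega>"] by (auto simp: W_def)
  have int_WW: "integrable M (\<lambda>\<omega>. W i \<omega> * W j \<omega>)" if "i \<in> {1..n}" "j \<in> {1..n}" for i j
  proof (rule integrable_const_bound[where B = "(B + \<bar>m\<bar>) * (B + \<bar>m\<bar>)"])
    show "(\<lambda>\<omega>. W i \<omega> * W j \<omega>) \<in> borel_measurable M"
      using int_W[OF that(1)] int_W[OF that(2)] by (intro borel_measurable_times) auto
    show "AE \<omega> in M. norm (W i \<omega> * W j \<omega>) \<le> (B + \<bar>m\<bar>) * (B + \<bar>m\<bar>)"
      using B by (intro AE_I2) (auto simp: abs_mult intro!: mult_mono gW)
  qed
  have off: "expectation (\<lambda>\<omega>. W i \<omega> * W j \<omega>) = 0" if "i \<in> {1..n}" "j \<in> {1..n}" "i \<noteq> j" for i j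
  proof -
    have "indep_vars (\<lambda>_. borel) W {i, j}"
      using that by (intro indep_vars_subset[OF indep_W]) auto
    then have "expectation (\<lambda>\<omega>. \<Prod>k\<in>{i, j}. W k \<omega>) = (\<Prod>k\<in>{i, j}. expectation (W k))"
      using that int_W by (intro indep_vars_lebesgue_integral) auto
    then show ?thesis
      using that EW by simp
  qed
  have diag: "expectation (\<lambda>\<omega>. W i \<omega> * W i \<omega>) \<le> B\<^sup>2" if "i \<in> {1..n}" for i
  proof -
    have g2: "\<bar>(g z)\<^sup>2\<bar> \<le> B\<^sup>2" for z
      using power_mono[OF g(2)[of z] abs_ge_zero, of 2] by simp
    have int2: "integrable M (\<lambda>\<omega>. (g (Z i \<omega>))\<^sup>2)"
      by (rule integrable_const_bound[where B = "B\<^sup>2"]) (use g2 gZ[OF that] in auto)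
    have "W i \<omega> * W i \<omega> = (g (Z i \<omega>))\<^sup>2 - 2 * m * g (Z i \<omega>) + m\<^sup>2" for \<omega>
      by (simp add: W_def power2_eq_square algebra_simps)
    then have "expectation (\<lambda>\<omega>. W i \<omega> * W i \<omega>) = expectation (\<lambda>\<omega>. (g (Z i \<omega>))\<^sup>2) - 2 * m * m + m\<^sup>2"
      using int2 int_g[OF that] m_eq[OF that] by (simp add: prob_space)
    also have "\<dots> \<le> expectation (\<lambda>\<omega>. (g (Z i \<omega>))\<^sup>2)"
      by (simp add: power2_eq_square)
    also have "\<dots> \<le> expectation (\<lambda>\<omega>. B\<^sup>2)"
      using g2 by (intro integral_mono int2) auto
    finally show ?thesis
      by (simp add: prob_space)
  qed
  have "(avg_error n (\<lambda>i. Z i \<omega>) \<mu> g)\<^sup>2 = (1 / real n)\<^sup>2 * (\<Sum>i=1..n. \<Sum>j=1..n. W i \<omega> * W j \<omega>)" for \<omega>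
  proof -
    have "avg_error n (\<lambda>i. Z i \<omega>) \<mu> g = 1 / real n * (\<Sum>i=1..n. W i \<omega>)"
      using n_pos by (simp add: avg_error_def W_def m_def sum_subtractf right_diff_distrib)
    then show ?thesis
      by (simp only: power_mult_distrib) (simp add: power2_eq_square sum_product)
  qed
  then have "expectation (\<lambda>\<omega>. (avg_error n (\<lambda>i. Z i \<omega>) \<mu> g)\<^sup>2)
      = (1 / real n)\<^sup>2 * (\<Sum>i=1..n. \<Sum>j=1..n. expectation (\<lambda>\<omega>. W i \<omega> * W j \<omega>))"
  proof -
    have "expectation (\<lambda>\<omega>. \<Sum>i=1..n. \<Sum>j=1..n. W i \<omega> * W j \<omega>)
        = (\<Sum>i=1..n. expectation (\<lambda>\<omega>. \<Sum>j=1..n. W i \<omega> * W j \<omega>))"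
      by (intro Bochner_Integration.integral_sum Bochner_Integration.integrable_sum int_WW)
    also have "\<dots> = (\<Sum>i=1..n. \<Sum>j=1..n. expectation (\<lambda>\<omega>. W i \<omega> * W j \<omega>))"
      by (intro sum.cong refl Bochner_Integration.integral_sum int_WW)
    moreover assume "\<And>\<omega>. (avg_error n (\<lambda>i. Z i \<omega>) \<mu> g)\<^sup>2 = (1 / real n)\<^sup>2 * (\<Sum>i=1..n. \<Sum>j=1..n. W i \<omega> * W j \<omega>)"
    ultimately show ?thesis
      by (simp only: integral_mult_right_zero)
  qed
  also have "(\<Sum>i=1..n. \<Sum>j=1..n. expectation (\<lambda>\<omega>. W i \<omega> * W j \<omega>)) = (\<Sum>i=1..n. expectation (\<lambda>\<omega>. W i \<omega> * W i \<omega>))"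
  proof (rule sum.cong[OF refl])
    fix i assume i: "i \<in> {1..n}"
    have "(\<Sum>j=1..n. expectation (\<lambda>\<omega>. W i \<omega> * W j \<omega>)) = (\<Sum>j\<in>{i}. expectation (\<lambda>\<omega>. W i \<omega> * W j \<omega>))"
      using i off by (intro sum.mono_neutral_right) auto
    then show "(\<Sum>j=1..n. expectation (\<lambda>\<omega>. W i \<omega> * W j \<omega>)) = expectation (\<lambda>\<omega>. W i \<omega> * W i \<omega>)"
      by simp
  qed
  also have "(1 / real n)\<^sup>2 * (\<Sum>i=1..n. expectation (\<lambda>\<omega>. W i \<omega> * W i \<omega>)) \<le> (1 / real n)\<^sup>2 * (\<Sum>i=1..n. B\<^sup>2)"
    by (intro mult_left_mono sum_mono diag) auto
  also have "\<dots> = B\<^sup>2 / real n"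
    using n_pos by (simp add: power2_eq_square)
  finally show ?thesis .
qed

text \<open>By Fubini's theorem the expected integrated squared error is the integral of the
  pointwise variances, at most B^2 / n; Markov's inequality does the rest. No supremum over y
  occurs, hence no grid.\<close>

lemma L2_concentration:
  fixes Y :: "'c measure"
  assumes Y: "prob_space Y" and G: "(\<lambda>p. G (fst p) (snd p)) \<in> borel_measurable (N \<Otimes>\<^sub>M Y)"
    and B: "\<And>z y. \<bar>G z y\<bar> \<le> B" and \<delta>: "0 < \<delta>"
  shows "\<exists>E\<in>events. 1 - B\<^sup>2 / (real n * \<delta>\<^sup>2) \<le> prob E \<and>
    (\<forall>\<omega>\<in>E. (LINT y|Y. (avg_error n (\<lambda>i. Z i \<omega>) \<mu> (\<lambda>z. G z y))\<^sup>2) \<le> \<delta>\<^sup>2)"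
proof -
  interpret Y: prob_space Y
    by (rule Y)
  interpret \<mu>: prob_space \<mu>
    by (rule prob_space_\<mu>)
  interpret MY: pair_prob_space M Y
    by unfold_locales
  define V where "V \<omega> y = (avg_error n (\<lambda>i. Z i \<omega>) \<mu> (\<lambda>z. G z y))\<^sup>2" for \<omega> y
  have Gy: "(\<lambda>z. G z y) \<in> borel_measurable N" if "y \<in> space Y" for y
    using measurable_Pair1[OF G that] by simp
  have mean: "(\<lambda>y. LINT z|\<mu>. G z y) \<in> borel_measurable Y"
  proof (rule \<mu>.borel_measurable_lebesgue_integral)
    have "(\<lambda>p. G (snd p) (fst p)) \<in> borel_measurable (Y \<Otimes>\<^sub>M \<mu>)"
      using measurable_compose[OF measurable_pair_swap' G]
      by (simp add: split_beta' measurable_cong_sets[OF sets_pair_measure_cong[OF refl sets_\<mu>] refl])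
    then show "(\<lambda>(y, z). G z y) \<in> borel_measurable (Y \<Otimes>\<^sub>M \<mu>)"
      by (simp add: split_beta')
  qed
  have tt: "(\<lambda>p. G (Z i (fst p)) (snd p)) \<in> borel_measurable (M \<Otimes>\<^sub>M Y)" if "i \<in> {1..n}" for i
  proof -
    have "(\<lambda>p. (Z i (fst p), snd p)) \<in> M \<Otimes>\<^sub>M Y \<rightarrow>\<^sub>M N \<Otimes>\<^sub>M Y"
      by (intro measurable_Pair measurable_compose[OF measurable_fst Z_measurable[OF that]] measurable_snd)
    from measurable_compose[OF this G] show ?thesis
      by simp
  qed
  have V: "(\<lambda>p. V (fst p) (snd p)) \<in> borel_measurable (M \<Otimes>\<^sub>M Y)"
    unfolding V_def avg_error_def
    by (intro borel_measurable_power borel_measurable_diff borel_measurable_times borel_measurable_sum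
        borel_measurable_const tt measurable_compose[OF measurable_snd mean])
  have V_le: "V \<omega> y \<le> (2 * B)\<^sup>2" if "y \<in> space Y" for \<omega> y
  proof -
    have "\<bar>avg_error n (\<lambda>i. Z i \<omega>) \<mu> (\<lambda>z. G z y)\<bar>\<^sup>2 \<le> (2 * B)\<^sup>2"
      by (intro power_mono abs_avg_error_le[OF Gy[OF that] B]) auto
    then show ?thesis
      by (simp add: V_def)
  qed
  have V_int: "integrable (M \<Otimes>\<^sub>M Y) (\<lambda>p. V (fst p) (snd p))"
    by (rule MY.integrable_const_bound[where B = "(2 * B)\<^sup>2"])
      (use V V_le in \<open>auto simp: space_pair_measure V_def\<close>)
  define F where "F \<omega> = (LINT y|Y. V \<omega> y)" for \<omega>
  have F: "integrable M F"
    using MY.integrable_fst'[OF V_int] by (simp add: F_def[abs_def])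
  have "expectation F = (LINT y|Y. (LINT \<omega>|M. V \<omega> y))"
    unfolding F_def using V_int by (intro MY.Fubini_integral[symmetric]) (simp add: split_beta')
  also have "\<dots> \<le> (LINT y|Y. B\<^sup>2 / real n)"
  proof (rule integral_mono)
    show "integrable Y (\<lambda>y. LINT \<omega>|M. V \<omega> y)"
      using MY.integrable_snd[of V] V_int by (simp add: split_beta')
    show "(LINT \<omega>|M. V \<omega> y) \<le> B\<^sup>2 / real n" if "y \<in> space Y" for y
      unfolding V_def by (rule expectation_avg_error_square[OF Gy[OF that] B])
  qed simp
  finally have EF: "expectation F \<le> B\<^sup>2 / real n"
    by (simp add: Y.prob_space)
  have F_nonneg: "0 \<le> F \<omega>" for \<omega>
    unfolding F_def V_def by (intro integral_nonneg_AE) auto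
  have Fm [measurable]: "F \<in> borel_measurable M"
    using F by auto
  have "prob {\<omega> \<in> space M. \<delta>\<^sup>2 \<le> F \<omega>} \<le> expectation F / \<delta>\<^sup>2"
    using F F_nonneg \<delta> by (intro integral_Markov_inequality_measure[where A = "space M"]) auto
  also have "\<dots> \<le> B\<^sup>2 / (real n * \<delta>\<^sup>2)"
    using divide_right_mono[OF EF, of "\<delta>\<^sup>2"] by simp
  finally have "prob {\<omega> \<in> space M. \<delta>\<^sup>2 \<le> F \<omega>} \<le> B\<^sup>2 / (real n * \<delta>\<^sup>2)" .
  moreover have "{\<omega> \<in> space M. \<delta>\<^sup>2 \<le> F \<omega>} \<in> events"
    by measurable
  ultimately show ?thesis
    by (intro bexI[of _ "space M - {\<omega> \<in> space M. \<delta>\<^sup>2 \<le> F \<omega>}"])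
      (auto simp: prob_compl F_def V_def)
qed

text \<open>Chebyshev's inequality with tolerance \<delta>/2 at each grid point and a union bound.
  Between grid points the error changes by at most 2 \<Lambda> / m, which the condition on m keeps
  below \<delta>/2.\<close>

lemma uniform_concentration:
  assumes G: "\<And>t. (\<lambda>z. G z t) \<in> borel_measurable N"
    and B: "\<And>z t. \<bar>G z t\<bar> \<le> B" and lip: "\<And>z s t. \<bar>G z s - G z t\<bar> \<le> \<Lambda> * \<bar>s - t\<bar>"
    and \<delta>: "0 < \<delta>" and m: "0 < m" "4 * \<Lambda> \<le> \<delta> * real m"
  shows "\<exists>E\<in>events. 1 - real (m + 1) * (4 * B\<^sup>2 / (real n * \<delta>\<^sup>2)) \<le> prob E \<and>
    (\<forall>\<omega>\<in>E. \<forall>t\<in>{0..1}. \<bar>avg_error n (\<lambda>i. Z i \<omega>) \<mu> (\<lambda>z. G z t)\<bar> \<le> \<delta>)"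
proof -
  interpret \<mu>: prob_space \<mu>
    by (rule prob_space_\<mu>)
  define V where "V \<omega> t = avg_error n (\<lambda>i. Z i \<omega>) \<mu> (\<lambda>z. G z t)" for \<omega> t
  have \<Lambda>: "0 \<le> \<Lambda>"
    using lip[of undefined 1 0] abs_ge_zero order_trans by fastforce
  have Vm: "(\<lambda>\<omega>. V \<omega> t) \<in> borel_measurable M" for t
    unfolding V_def by (rule avg_error_measurable[OF G])
  \<comment> \<open>The sample average and the mean contribute \<Lambda> each.\<close>
  have V_lip: "\<bar>V \<omega> s - V \<omega> t\<bar> \<le> 2 * \<Lambda> * \<bar>s - t\<bar>" for \<omega> s t
  proof -
    have int: "integrable \<mu> (\<lambda>z. G z t)" for t
      by (rule bounded_integrable_\<mu>[OF G B])
    have "V \<omega> s - V \<omega> t = avg_error n (\<lambda>i. Z i \<omega>) \<mu> (\<lambda>z. G z s - G z t)"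
      using int by (simp add: V_def avg_error_def sum_subtractf algebra_simps diff_divide_distrib)
    also have "\<bar>\<dots>\<bar> \<le> 2 * (\<Lambda> * \<bar>s - t\<bar>)"
      by (rule abs_avg_error_le[OF _ lip]) (intro borel_measurable_diff G)
    finally show ?thesis
      by simp
  qed
  define bad where "bad j = {\<omega> \<in> space M. \<delta> / 2 \<le> \<bar>V \<omega> (real j / real m)\<bar>}" for j
  have bad: "bad j \<in> events" for j
    unfolding bad_def using Vm[of "real j / real m"] by measurable
  have pbad: "prob (bad j) \<le> 4 * B\<^sup>2 / (real n * \<delta>\<^sup>2)" for j
  proof -
    let ?t = "real j / real m"
    have V2: "integrable M (\<lambda>\<omega>. (V \<omega> ?t)\<^sup>2)"
    proof (rule integrable_const_bound[where B = "(2 * B)\<^sup>2"])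
      show "AE \<omega> in M. norm ((V \<omega> ?t)\<^sup>2) \<le> (2 * B)\<^sup>2"
        using abs_avg_error_le[OF G B] power_mono[of "\<bar>V _ ?t\<bar>" "2 * B" 2]
        by (auto simp: V_def)
    qed (use Vm in simp)
    have "bad j = {\<omega> \<in> space M. (\<delta> / 2)\<^sup>2 \<le> (V \<omega> ?t)\<^sup>2}"
      using \<delta> abs_le_square_iff[of "\<delta> / 2" "V _ ?t"] by (auto simp: bad_def)
    then have "prob (bad j) \<le> expectation (\<lambda>\<omega>. (V \<omega> ?t)\<^sup>2) / (\<delta> / 2)\<^sup>2"
      using V2 \<delta> integral_Markov_inequality_measure[OF V2, of "space M" "(\<delta> / 2)\<^sup>2"] by simp
    also have "\<dots> \<le> (B\<^sup>2 / real n) / (\<delta> / 2)\<^sup>2"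
      unfolding V_def by (intro divide_right_mono expectation_avg_error_square[OF G B]) auto
    finally show ?thesis
      by (simp add: power_divide mult.commute)
  qed
  let ?E = "space M - (\<Union>j\<in>{..m}. bad j)"
  have "prob (\<Union>j\<in>{..m}. bad j) \<le> (\<Sum>j\<in>{..m}. prob (bad j))"
    by (rule finite_measure_subadditive_finite) (use bad in auto)
  also have "\<dots> \<le> (\<Sum>j\<in>{..m}. 4 * B\<^sup>2 / (real n * \<delta>\<^sup>2))"
    by (intro sum_mono pbad)
  also have "\<dots> = real (m + 1) * (4 * B\<^sup>2 / (real n * \<delta>\<^sup>2))"
    by simp
  finally have "prob (\<Union>j\<in>{..m}. bad j) \<le> real (m + 1) * (4 * B\<^sup>2 / (real n * \<delta>\<^sup>2))" .
  moreover have U: "(\<Union>j\<in>{..m}. bad j) \<in> events"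
    using bad by auto
  ultimately have "1 - real (m + 1) * (4 * B\<^sup>2 / (real n * \<delta>\<^sup>2)) \<le> prob ?E"
    by (simp add: prob_compl)
  moreover have "\<bar>V \<omega> t\<bar> \<le> \<delta>" if \<omega>: "\<omega> \<in> ?E" and t: "t \<in> {0..1}" for \<omega> t
  proof -
    \<comment> \<open>For t = 1 this is m, so the grid has m + 1 points.\<close>
    define j where "j = nat \<lfloor>t * real m\<rfloor>"
    have tm: "0 \<le> t * real m" "t * real m \<le> real m"
      using t by (auto simp: mult_left_le_one_le)
    then have j: "real j \<le> t * real m" "t * real m \<le> real j + 1"
      by (auto simp: j_def)
    then have "j \<le> m"
      using tm by linarith
    then have "\<bar>V \<omega> (real j / real m)\<bar> < \<delta> / 2"
      using \<omega> by (auto simp: bad_def not_le)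
    moreover have "\<bar>V \<omega> t - V \<omega> (real j / real m)\<bar> \<le> \<delta> / 2"
    proof -
      have "\<bar>t - real j / real m\<bar> \<le> 1 / real m"
      proof -
        have "t - real j / real m = (t * real m - real j) / real m"
          using m(1) by (simp add: field_simps)
        then show ?thesis
          using j by (simp only: abs_divide) (simp add: divide_right_mono)
      qed
      then have "2 * \<Lambda> * \<bar>t - real j / real m\<bar> \<le> 2 * \<Lambda> * (1 / real m)"
        using \<Lambda> by (intro mult_left_mono) auto
      also have "\<dots> \<le> \<delta> / 2"
        using m by (simp add: field_simps)
      finally show ?thesis
        using V_lip[of \<omega> t "real j / real m"] by linarith
    qed
    ultimately show ?thesis
      by linarith
  qed
  ultimately show ?thesis
    using U by (intro bexI[of _ ?E]) (auto simp: V_def)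
qed

end

section \<open>Events whose probability tends to 1\<close>

text \<open>The events P n need not be measurable, hence the measurable events E n below them.\<close>

definition whp :: "'a measure \<Rightarrow> (nat \<Rightarrow> 'a \<Rightarrow> bool) \<Rightarrow> bool"
  where "whp M P \<longleftrightarrow> (\<exists>E. (\<forall>n. E n \<in> sets M) \<and> (\<lambda>n. measure M (E n)) \<longlonglongrightarrow> 1 \<and>
    (\<forall>\<^sub>F n in sequentially. \<forall>\<omega>\<in>E n. P n \<omega>))"

lemma whp_mono:
  assumes "whp M P" "\<forall>\<^sub>F n in sequentially. \<forall>\<omega>\<in>space M. P n \<omega> \<longrightarrow> Q n \<omega>"
  shows "whp M Q"
proof -
  obtain E where E: "\<And>n. E n \<in> sets M" "(\<lambda>n. measure M (E n)) \<longlonglongrightarrow> 1"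
    "\<forall>\<^sub>F n in sequentially. \<forall>\<omega>\<in>E n. P n \<omega>"
    using assms(1) by (auto simp: whp_def)
  have "\<forall>\<^sub>F n in sequentially. \<forall>\<omega>\<in>E n. Q n \<omega>"
    using E(3) assms(2)
    by eventually_elim (use E(1)[THEN sets.sets_into_space] in blast)
  then show ?thesis
    using E unfolding whp_def by blast
qed

context prob_space
begin

lemma whpI:
  assumes "\<forall>\<^sub>F n in sequentially. \<exists>E\<in>events. 1 - b n \<le> prob E \<and> (\<forall>\<omega>\<in>E. P n \<omega>)"
    and b: "b \<longlonglongrightarrow> 0"
  shows "whp M P"
proof -
  define good where "good n E \<longleftrightarrow> E \<in> events \<and> 1 - b n \<le> prob E \<and> (\<forall>\<omega>\<in>E. P n \<omega>)" for n E
  \<comment> \<open>The default concerns only finitely many n; it keeps every \<open>E n\<close>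
    measurable and does not affect the limit.\<close>
  define E where "E n = (if \<exists>E. good n E then SOME E. good n E else {})" for n
  have good: "good n (E n)" if "\<exists>E. good n E" for n
    using that by (simp add: E_def someI_ex)
  have ev: "\<forall>\<^sub>F n in sequentially. good n (E n)"
    using assms(1) by eventually_elim (intro good, auto simp: good_def)
  have "E n \<in> events" for n
    using good[of n] by (cases "\<exists>E. good n E") (auto simp: good_def E_def)
  moreover have "(\<lambda>n. prob (E n)) \<longlonglongrightarrow> 1"
  proof (rule tendsto_sandwich[where f = "\<lambda>n. 1 - b n" and h = "\<lambda>_. 1"])
    show "\<forall>\<^sub>F n in sequentially. 1 - b n \<le> prob (E n)"
      using ev by eventually_elim (simp add: good_def)
    have "(\<lambda>n. 1 - b n) \<longlonglongrightarrow> 1 - 0"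
      by (intro tendsto_intros b)
    then show "(\<lambda>n. 1 - b n) \<longlonglongrightarrow> 1"
      by simp
  qed auto
  moreover have "\<forall>\<^sub>F n in sequentially. \<forall>\<omega>\<in>E n. P n \<omega>"
    using ev by eventually_elim (simp add: good_def)
  ultimately show ?thesis
    unfolding whp_def by blast
qed

lemma whp_conj:
  assumes "whp M P" "whp M Q"
  shows "whp M (\<lambda>n \<omega>. P n \<omega> \<and> Q n \<omega>)"
proof -
  obtain E where E: "\<And>n. E n \<in> events" "(\<lambda>n. prob (E n)) \<longlonglongrightarrow> 1" "\<forall>\<^sub>F n in sequentially. \<forall>\<omega>\<in>E n. P n \<omega>"
    using assms(1) by (auto simp: whp_def)
  obtain F where F: "\<And>n. F n \<in> events" "(\<lambda>n. prob (F n)) \<longlonglongrightarrow> 1" "\<forall>\<^sub>F n in sequentially. \<forall>\<omega>\<in>F n. Q n \<omega>"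
    using assms(2) by (auto simp: whp_def)
  show ?thesis
  proof (rule whpI[where b = "\<lambda>n. (1 - prob (E n)) + (1 - prob (F n))"])
    have "(\<lambda>n. (1 - prob (E n)) + (1 - prob (F n))) \<longlonglongrightarrow> (1 - 1) + (1 - 1)"
      by (intro tendsto_intros E F)
    then show "(\<lambda>n. (1 - prob (E n)) + (1 - prob (F n))) \<longlonglongrightarrow> 0"
      by simp
    show "\<forall>\<^sub>F n in sequentially. \<exists>A\<in>events. 1 - ((1 - prob (E n)) + (1 - prob (F n))) \<le> prob A
        \<and> (\<forall>\<omega>\<in>A. P n \<omega> \<and> Q n \<omega>)"
      using E(3) F(3)
    proof eventually_elim
      case (elim n)
      have "prob (E n \<union> F n) = prob (E n) + prob (F n) - prob (E n \<inter> F n)"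
        using finite_measure_Union'[OF E(1) F(1), of n n] finite_measure_Diff'[OF F(1) E(1), of n n]
        by (simp add: Int_commute)
      then show ?case
        using elim E(1) F(1) prob_le_1[of "E n \<union> F n"]
        by (intro bexI[of _ "E n \<inter> F n"]) auto
    qed
  qed
qed

lemma whp_finite_all:
  assumes "finite I" "\<And>i. i \<in> I \<Longrightarrow> whp M (P i)"
  shows "whp M (\<lambda>n \<omega>. \<forall>i\<in>I. P i n \<omega>)"
  using assms
proof (induction I rule: finite_induct)
  case empty
  show ?case
    by (rule whpI[where b = "\<lambda>_. 0"]) (auto intro!: bexI[of _ "space M"] simp: prob_space)
next
  case (insert i I)
  then have "whp M (\<lambda>n \<omega>. P i n \<omega> \<and> (\<forall>i\<in>I. P i n \<omega>))"
    by (intro whp_conj) auto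
  then show ?case
    by simp
qed

lemma whp_AE:
  assumes "\<And>n. AE \<omega> in M. P n \<omega>"
  shows "whp M P"
proof (rule whpI[where b = "\<lambda>_. 0"])
  show "\<forall>\<^sub>F n in sequentially. \<exists>E\<in>events. 1 - 0 \<le> prob E \<and> (\<forall>\<omega>\<in>E. P n \<omega>)"
  proof (intro always_eventually allI)
    fix n
    obtain N where N: "{\<omega> \<in> space M. \<not> P n \<omega>} \<subseteq> N" "N \<in> null_sets M"
      using assms[of n] by (auto elim!: AE_E3 simp: eventually_ae_filter)
    moreover from N(2) have "N \<in> events" "prob N = 0"
      by (auto simp: measure_eq_0_null_sets)
    ultimately show "\<exists>E\<in>events. 1 - 0 \<le> prob E \<and> (\<forall>\<omega>\<in>E. P n \<omega>)"
      by (intro bexI[of _ "space M - N"]) (auto simp: prob_compl)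
  qed
qed simp

lemma inner_prob_ge: "E \<in> events \<Longrightarrow> E \<subseteq> A \<Longrightarrow> prob E \<le> inner_prob M A"
  unfolding inner_prob_def
  by (rule cSUP_upper) (auto intro!: bdd_aboveI2[where M = 1])

lemma inner_prob_le_1: "inner_prob M A \<le> 1"
  unfolding inner_prob_def by (rule cSUP_least) auto

lemma whp_inner_prob:
  assumes "whp M P"
  shows "(\<lambda>n. inner_prob M {\<omega> \<in> space M. P n \<omega>}) \<longlonglongrightarrow> 1"
proof -
  obtain E where E: "\<And>n. E n \<in> events" "(\<lambda>n. prob (E n)) \<longlonglongrightarrow> 1" "\<forall>\<^sub>F n in sequentially. \<forall>\<omega>\<in>E n. P n \<omega>"
    using assms by (auto simp: whp_def)
  show ?thesis
  proof (rule tendsto_sandwich[OF _ _ E(2) tendsto_const])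
    show "\<forall>\<^sub>F n in sequentially. prob (E n) \<le> inner_prob M {\<omega> \<in> space M. P n \<omega>}"
      using E(3)
      by eventually_elim (intro inner_prob_ge E(1), use E(1)[THEN sets.sets_into_space] in blast)
  qed (simp add: inner_prob_le_1)
qed

end

section \<open>Coercivity of the empirical quadratic form on additive functions\<close>

text \<open>Degrees up to 2 suffice, since each of two components contributes a degree of at most
  1.\<close>

lemma (in smoothing_kernel) moment_kernel_bounds_uniform:
  "\<exists>A>0. \<forall>p\<le>2. \<forall>b z s s'. 0 < b \<longrightarrow> b * \<beta> \<le> 1 / 2 \<longrightarrow>
    \<bar>moment_kernel b p z s\<bar> \<le> A / b \<and>
    \<bar>moment_kernel b p z s - moment_kernel b p z s'\<bar> \<le> A / b\<^sup>2 * \<bar>s - s'\<bar>"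
proof -
  have "\<forall>p. \<exists>A>0. \<forall>b z s s'. 0 < b \<longrightarrow> b * \<beta> \<le> 1 / 2 \<longrightarrow>
    \<bar>moment_kernel b p z s\<bar> \<le> A / b \<and>
    \<bar>moment_kernel b p z s - moment_kernel b p z s'\<bar> \<le> A / b\<^sup>2 * \<bar>s - s'\<bar>"
    using moment_kernel_bounds by blast
  from choice[OF this] obtain A where A: "\<And>p. 0 < A p"
    "\<And>p b z s s'. 0 < b \<Longrightarrow> b * \<beta> \<le> 1 / 2 \<Longrightarrow> \<bar>moment_kernel b p z s\<bar> \<le> A p / b \<and>
    \<bar>moment_kernel b p z s - moment_kernel b p z s'\<bar> \<le> A p / b\<^sup>2 * \<bar>s - s'\<bar>"
    by blast
  have le: "A p \<le> (\<Sum>p\<le>2. A p)" if "p \<le> 2" for p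
    using that A(1) by (intro member_le_sum) (auto simp: less_imp_le)
  show ?thesis
  proof (intro exI[of _ "\<Sum>p\<le>2. A p"] conjI allI impI)
    show "0 < (\<Sum>p\<le>2. A p)"
      using A(1) by (intro sum_pos) auto
    fix p :: nat and b z s s' :: real assume *: "p \<le> 2" "0 < b" "b * \<beta> \<le> 1 / 2"
    have "A p / b \<le> (\<Sum>p\<le>2. A p) / b" "A p / b\<^sup>2 * \<bar>s - s'\<bar> \<le> (\<Sum>p\<le>2. A p) / b\<^sup>2 * \<bar>s - s'\<bar>"
      using le[OF *(1)] *(2) by (auto intro!: divide_right_mono mult_right_mono)
    then show "\<bar>moment_kernel b p z s\<bar> \<le> (\<Sum>p\<le>2. A p) / b"
      "\<bar>moment_kernel b p z s - moment_kernel b p z s'\<bar> \<le> (\<Sum>p\<le>2. A p) / b\<^sup>2 * \<bar>s - s'\<bar>"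
      using A(2)[OF *(2,3), of p z s s'] by linarith+
  qed
qed

text \<open>A depends on K only and will be fixed before n. H is a common lower bound of the
  bandwidths in which all rates are expressed; \<open>H \<le> 1\<close> allows low powers of 1 / H
  to be absorbed into higher ones.\<close>

locale bounded_kernel = smoothing_kernel_bandwidth K S B L \<alpha> \<beta> \<kappa> h
  for K S B L \<alpha> \<beta> \<kappa> and h :: "real ^ 'd::finite" +
  fixes A H :: real
  assumes A_pos: "0 < A"
    and moment_bound: "p \<le> 2 \<Longrightarrow> 0 < b \<Longrightarrow> b * \<beta> \<le> 1 / 2 \<Longrightarrow> \<bar>moment_kernel b p z s\<bar> \<le> A / b"
    and moment_lipschitz: "p \<le> 2 \<Longrightarrow> 0 < b \<Longrightarrow> b * \<beta> \<le> 1 / 2 \<Longrightarrow>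
      \<bar>moment_kernel b p z s - moment_kernel b p z s'\<bar> \<le> A / b\<^sup>2 * \<bar>s - s'\<bar>"
    and H_pos: "0 < H" and H_le_1: "H \<le> 1" and H_le: "H \<le> h $ k"
begin

lemma moment_le: "p \<le> 2 \<Longrightarrow> \<bar>moment_kernel (h $ k) p z s\<bar> \<le> A / H"
  by (rule order_trans[OF moment_bound[OF _ h_pos h_small]])
    (use A_pos H_pos H_le in \<open>auto intro!: divide_left_mono mult_pos_pos h_pos\<close>)

lemma moment_lip: "p \<le> 2 \<Longrightarrow> \<bar>moment_kernel (h $ k) p z s - moment_kernel (h $ k) p z s'\<bar> \<le> A / H\<^sup>2 * \<bar>s - s'\<bar>"
  by (rule order_trans[OF moment_lipschitz[OF _ h_pos h_small]])
    (use A_pos H_pos H_le in \<open>auto intro!: mult_right_mono divide_left_mono mult_pos_pos power_mono zero_less_power h_pos\<close>)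

lemma moment_nth_measurable:
  fixes k :: 'd
  shows "(\<lambda>p. moment_kernel b q (fst p $ k) (snd p $ k)) \<in> borel_measurable (borel \<Otimes>\<^sub>M cube_measure)"
proof -
  have "(\<lambda>p. (fst p $ k, snd p $ k)) \<in> borel \<Otimes>\<^sub>M (cube_measure :: (real ^ 'd) measure) \<rightarrow>\<^sub>M borel \<Otimes>\<^sub>M borel"
    by (intro measurable_Pair measurable_compose[OF measurable_snd measurable_cube_component]
        measurable_compose[OF measurable_fst] borel_measurable_continuous_onI continuous_intros)
  from measurable_compose[OF this moment_kernel_measurable] show ?thesis
    by simp
qed

lemma pair_kernel_measurable:
  "(\<lambda>p. pair_kernel i j (fst p) (snd p)) \<in> borel_measurable (borel \<Otimes>\<^sub>M cube_measure)"
  unfolding pair_kernel_def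
  by (cases "fst i = fst j") (auto intro!: moment_nth_measurable borel_measurable_times)

lemma deg_le: "deg i + deg j \<le> 2" "deg i \<le> 2"
  by auto

lemma pair_kernel_le:
  assumes "fst i \<noteq> fst j"
  shows "\<bar>pair_kernel i j z x\<bar> \<le> (A / H)\<^sup>2"
proof -
  have "\<bar>pair_kernel i j z x\<bar> = \<bar>moment_kernel (h $ fst i) (deg i) (z $ fst i) (x $ fst i)\<bar>
      * \<bar>moment_kernel (h $ fst j) (deg j) (z $ fst j) (x $ fst j)\<bar>"
    using assms by (simp only: pair_kernel_def if_False abs_mult)
  also have "\<dots> \<le> A / H * (A / H)"
    using A_pos H_pos by (intro mult_mono moment_le deg_le) auto
  finally show ?thesis
    by (simp add: power2_eq_square)
qed

lemma pair_kernel_bounded: "\<exists>B. \<forall>z x. \<bar>pair_kernel i j z x\<bar> \<le> B"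
proof (cases "fst i = fst j")
  case True
  have "\<bar>pair_kernel i j z x\<bar> \<le> A / H" for z x
    unfolding pair_kernel_def if_P[OF True] by (rule moment_le[OF deg_le(1)])
  then show ?thesis
    by blast
next
  case False
  then show ?thesis
    using pair_kernel_le by blast
qed

text \<open>
  An error term in one coordinate acts as a multiplication operator and has to be uniformly small;
  one in two coordinates acts as an integral operator, for which the L2 norm of the kernel suffices.
\<close>

definition pair_close :: "nat \<Rightarrow> (nat \<Rightarrow> real ^ 'd) \<Rightarrow> (real ^ 'd) measure \<Rightarrow> real \<Rightarrow> 'd \<times> bool \<Rightarrow> 'd \<times> bool \<Rightarrow> bool"
  where "pair_close n z \<mu> \<delta> i j \<longleftrightarrow>
    (if fst i = fst j then \<forall>x\<in>unit_cube. \<bar>avg_error n z \<mu> (\<lambda>z. pair_kernel i j z x)\<bar> \<le> \<delta>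
     else (LINT x|cube_measure. (avg_error n z \<mu> (\<lambda>z. pair_kernel i j z x))\<^sup>2) \<le> \<delta>\<^sup>2)"

text \<open>Both cases fail with probability of order 1 / (n H^4): on one coordinate, about H^(-2)
  grid points times a variance of order H^(-2) / n; on two, a kernel of order H^(-2). The two
  constants are added so that one bound covers both.\<close>

lemma pair_concentration:
  assumes iid: "iid_sample M n Z borel \<mu>" and \<delta>: "0 < \<delta>"
  shows "\<exists>E\<in>sets M. 1 - ((4 * A / \<delta> + 2) * (4 * A\<^sup>2 / \<delta>\<^sup>2) + A ^ 4 / \<delta>\<^sup>2) / (real n * H ^ 4) \<le> measure M E \<and>
    (\<forall>\<omega>\<in>E. pair_close n (\<lambda>i. Z i \<omega>) \<mu> \<delta> i j)"
proof -
  interpret iid_sample M n Z borel \<mu>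
    by (rule iid)
  let ?C1 = "(4 * A / \<delta> + 2) * (4 * A\<^sup>2 / \<delta>\<^sup>2)" and ?C2 = "A ^ 4 / \<delta>\<^sup>2"
  have C: "0 \<le> ?C1" "0 \<le> ?C2" "0 < real n * H ^ 4"
    using A_pos H_pos n_pos \<delta> by auto
  show ?thesis
  proof (cases "fst i = fst j")
    case True
    \<comment> \<open>The least grid size that \<open>uniform_concentration\<close> admits for the
      Lipschitz constant A / H^2.\<close>
    define m where "m = nat \<lceil>4 * (A / H\<^sup>2) / \<delta>\<rceil>"
    have pos: "0 < 4 * (A / H\<^sup>2) / \<delta>"
      using A_pos H_pos \<delta> by simp
    have m: "0 < m" "4 * (A / H\<^sup>2) / \<delta> \<le> real m" "real m \<le> 4 * (A / H\<^sup>2) / \<delta> + 1"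
      using pos unfolding m_def by linarith+
    have m4: "4 * (A / H\<^sup>2) \<le> \<delta> * real m"
      using m(2) unfolding pos_divide_le_eq[OF \<delta>] mult.commute[of \<delta>] .
    define G where "G z t = moment_kernel (h $ fst i) (deg i + deg j) (z $ fst i) t" for z :: "real ^ 'd" and t
    have Gm: "(\<lambda>z. G z t) \<in> borel_measurable borel" for t
      unfolding G_def moment_kernel_def by measurable
    have G_le: "\<bar>G z t\<bar> \<le> A / H" for z t
      unfolding G_def by (rule moment_le[OF deg_le(1)])
    have G_lip: "\<bar>G z s - G z t\<bar> \<le> A / H\<^sup>2 * \<bar>s - t\<bar>" for z s t
      unfolding G_def by (rule moment_lip[OF deg_le(1)])
    obtain E where E: "E \<in> events" "1 - real (m + 1) * (4 * (A / H)\<^sup>2 / (real n * \<delta>\<^sup>2)) \<le> prob E"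
      "\<And>\<omega> t. \<omega> \<in> E \<Longrightarrow> t \<in> {0..1} \<Longrightarrow> \<bar>avg_error n (\<lambda>i. Z i \<omega>) \<mu> (\<lambda>z. G z t)\<bar> \<le> \<delta>"
      using uniform_concentration[OF Gm G_le G_lip \<delta> m(1) m4]
      by blast
    have "real (m + 1) * (4 * (A / H)\<^sup>2 / (real n * \<delta>\<^sup>2)) \<le> ((4 * A / \<delta> + 2) / H\<^sup>2) * (4 * (A / H)\<^sup>2 / (real n * \<delta>\<^sup>2))"
    proof (rule mult_right_mono)
      have "H\<^sup>2 \<le> 1"
        using H_pos H_le_1 by (intro power_le_one) auto
      then have "2 \<le> 2 / H\<^sup>2"
        using H_pos by (simp add: pos_le_divide_eq)
      then show "real (m + 1) \<le> (4 * A / \<delta> + 2) / H\<^sup>2"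
        using m(3) by (simp add: add_divide_distrib mult.commute)
    qed simp
    also have "\<dots> = ?C1 / (real n * H ^ 4)"
      by (simp add: power_divide power2_eq_square power4_eq_xxxx mult_ac)
    also have "\<dots> \<le> (?C1 + ?C2) / (real n * H ^ 4)"
      using C by (intro divide_right_mono) auto
    finally have "1 - (?C1 + ?C2) / (real n * H ^ 4) \<le> prob E"
      using E(2) by linarith
    moreover have "pair_close n (\<lambda>i. Z i \<omega>) \<mu> \<delta> i j" if "\<omega> \<in> E" for \<omega>
      using True E(3)[OF that] by (auto simp: pair_close_def pair_kernel_def G_def mem_box_cart)
    ultimately show ?thesis
      using E(1) by blast
  next
    case False
    obtain E where E: "E \<in> events" "1 - ((A / H)\<^sup>2)\<^sup>2 / (real n * \<delta>\<^sup>2) \<le> prob E"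
      "\<And>\<omega>. \<omega> \<in> E \<Longrightarrow> (LINT x|cube_measure. (avg_error n (\<lambda>i. Z i \<omega>) \<mu> (\<lambda>z. pair_kernel i j z x))\<^sup>2) \<le> \<delta>\<^sup>2"
      using L2_concentration[OF prob_space_cube pair_kernel_measurable pair_kernel_le[OF False] \<delta>] by blast
    have "((A / H)\<^sup>2)\<^sup>2 / (real n * \<delta>\<^sup>2) = ?C2 / (real n * H ^ 4)"
      by (simp add: power_divide power2_eq_square power4_eq_xxxx mult_ac)
    also have "\<dots> \<le> (?C1 + ?C2) / (real n * H ^ 4)"
      using C by (intro divide_right_mono) auto
    finally have "1 - (?C1 + ?C2) / (real n * H ^ 4) \<le> prob E"
      using E(2) by linarith
    then show ?thesis
      using E(1,3) False by (auto simp: pair_close_def)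
  qed
qed

lemma pair_error_integral_le:
  assumes \<psi>: "has_components a \<psi>" and close: "pair_close n z \<mu> \<delta> i j" and \<delta>: "0 < \<delta>"
    and bounded: "(\<lambda>x. avg_error n z \<mu> (\<lambda>z. pair_kernel i j z x)) \<in> borel_measurable cube_measure"
      "\<And>x. x \<in> unit_cube \<Longrightarrow> \<bar>avg_error n z \<mu> (\<lambda>z. pair_kernel i j z x)\<bar> \<le> b"
  shows "\<bar>LINT x|cube_measure. avg_error n z \<mu> (\<lambda>z. pair_kernel i j z x) * (\<psi> i (x $ fst i) * \<psi> j (x $ fst j))\<bar>
    \<le> \<delta> * (4 * (l2_norm a)\<^sup>2)"
proof -
  let ?n = "4 * (l2_norm a)\<^sup>2"
  define e where "e x = avg_error n z \<mu> (\<lambda>z. pair_kernel i j z x)" for x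
  have e: "e \<in> borel_measurable cube_measure" "\<And>x. x \<in> unit_cube \<Longrightarrow> \<bar>e x\<bar> \<le> b"
    using bounded by (simp_all add: e_def[abs_def])
  have m2: "(\<lambda>s. (\<psi> l s)\<^sup>2) \<in> borel_measurable borel" for l
    using has_componentsD(1)[OF \<psi>, of l] by simp
  have sq: "sq_integrable cube_measure (\<lambda>x :: real ^ 'd. \<psi> l (x $ k))" for l k
    using has_componentsD(1,2)[OF \<psi>, of l] integral_cube_component(1)[OF m2[of l], where k = k]
    by (auto simp: sq_integrable_def intro: measurable_compose[OF measurable_cube_component])
  have I: "(LINT x|cube_measure. (\<psi> l ((x :: real ^ 'd) $ k))\<^sup>2) \<le> ?n" for l k
    using has_componentsD(3)[OF \<psi>, of l] integral_cube_component(2)[OF m2[of l], where k = k] by simp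
  have n: "0 \<le> ?n"
    by simp
  have "(LINT x|cube_measure. e x * (\<psi> i (x $ fst i) * \<psi> j (x $ fst j)))\<^sup>2 \<le> (\<delta> * ?n)\<^sup>2"
  proof (cases "fst i = fst j")
    case True
    then have e_le: "\<bar>e x\<bar> \<le> \<delta>" if "x \<in> unit_cube" for x
      using close that by (simp add: pair_close_def e_def)
    have sqe: "sq_integrable cube_measure (\<lambda>x. e x * \<psi> i (x $ fst i))"
    proof (rule sq_integrable_bound[OF sq, of _ \<delta>])
      show "(\<lambda>x. e x * \<psi> i (x $ fst i)) \<in> borel_measurable cube_measure"
        by (intro borel_measurable_times e sq_integrable_measurable sq)
      show "AE x in cube_measure. \<bar>e x * \<psi> i (x $ fst i)\<bar> \<le> \<delta> * \<bar>\<psi> i (x $ fst i)\<bar>"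
        unfolding abs_mult by (intro AE_I2 mult_right_mono e_le) (auto simp: space_cube)
    qed
    have "(LINT x|cube_measure. (e x * \<psi> i (x $ fst i)) * \<psi> j (x $ fst j))\<^sup>2
        \<le> (LINT x|cube_measure. (e x * \<psi> i (x $ fst i))\<^sup>2) * (LINT x|cube_measure. (\<psi> j (x $ fst j))\<^sup>2)"
      by (rule integral_cauchy_schwarz[OF sqe sq])
    also have "\<dots> \<le> (\<delta>\<^sup>2 * ?n) * ?n"
    proof (intro mult_mono I)
      have "(LINT x|cube_measure. (e x * \<psi> i (x $ fst i))\<^sup>2) \<le> (LINT x|cube_measure. \<delta>\<^sup>2 * (\<psi> i (x $ fst i))\<^sup>2)"
      proof (intro integral_mono sq_integrableD[OF sqe])
        show "integrable cube_measure (\<lambda>x. \<delta>\<^sup>2 * (\<psi> i (x $ fst i))\<^sup>2)"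
          using sq_integrableD[OF sq] by simp
        fix x assume "x \<in> space (cube_measure :: (real ^ 'd) measure)"
        then have "\<bar>e x\<bar>\<^sup>2 \<le> \<delta>\<^sup>2"
          by (intro power_mono e_le) (auto simp: space_cube)
        then show "(e x * \<psi> i (x $ fst i))\<^sup>2 \<le> \<delta>\<^sup>2 * (\<psi> i (x $ fst i))\<^sup>2"
          by (simp add: power_mult_distrib mult_right_mono)
      qed
      also have "\<dots> = \<delta>\<^sup>2 * (LINT x|cube_measure. (\<psi> i (x $ fst i))\<^sup>2)"
        by simp
      also have "\<dots> \<le> \<delta>\<^sup>2 * ?n"
        by (intro mult_left_mono I) simp
      finally show "(LINT x|cube_measure. (e x * \<psi> i (x $ fst i))\<^sup>2) \<le> \<delta>\<^sup>2 * ?n" .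
    qed auto
    finally show ?thesis
      by (simp add: power2_eq_square mult_ac)
  next
    case False
    \<comment> \<open>On distinct coordinates the integral of the squared product is the product of
      the integrals of the squares; on a common coordinate it could be infinite.\<close>
    define f where "f k s = (if k = fst i then (\<psi> i s)\<^sup>2 else if k = fst j then (\<psi> j s)\<^sup>2 else 1)" for k s
    have f: "integrable unit_interval (f k)" for k
      using sq_integrableD[OF has_componentsD(2)[OF \<psi>, of i]] sq_integrableD[OF has_componentsD(2)[OF \<psi>, of j]]
      by (cases "k = fst i"; cases "k = fst j") (simp_all add: f_def[abs_def])
    have prod: "(\<psi> i (x $ fst i) * \<psi> j (x $ fst j))\<^sup>2 = (\<Prod>k\<in>UNIV. f k (x $ k))" for x :: "real ^ 'd"
    proof -
      have "(\<Prod>k\<in>UNIV. f k (x $ k)) = (\<Prod>k\<in>{fst i, fst j}. f k (x $ k))"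
        by (rule prod.mono_neutral_right) (auto simp: f_def)
      then show ?thesis
        using False by (simp add: f_def power_mult_distrib)
    qed
    have sqp: "sq_integrable cube_measure (\<lambda>x. \<psi> i (x $ fst i) * \<psi> j (x $ fst j))"
      unfolding sq_integrable_def prod
      by (intro conjI cube_prod(1) f borel_measurable_times sq_integrable_measurable[OF sq])
    have "(LINT x|cube_measure. (\<psi> i (x $ fst i) * \<psi> j (x $ fst j))\<^sup>2) = (\<Prod>k\<in>UNIV. LINT s|unit_interval. f k s)"
      unfolding prod by (rule cube_prod(2)[OF f])
    also have "\<dots> = (\<Prod>k\<in>{fst i, fst j}. LINT s|unit_interval. f k s)"
      by (rule prod.mono_neutral_right) (auto simp: f_def measure_unit_interval space_restrict_space)
    also have "\<dots> = (LINT s|unit_interval. (\<psi> i s)\<^sup>2) * (LINT s|unit_interval. (\<psi> j s)\<^sup>2)"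
      using False by (simp add: f_def)
    also have "\<dots> \<le> ?n * ?n"
      by (intro mult_mono has_componentsD(3)[OF \<psi>]) auto
    finally have p_le: "(LINT x|cube_measure. (\<psi> i (x $ fst i) * \<psi> j (x $ fst j))\<^sup>2) \<le> ?n * ?n" .
    have sqe: "sq_integrable cube_measure e"
      using e by (intro sq_integrable_bound[OF cube.sq_integrable_const[of 1], of _ b])
        (auto simp: space_cube intro!: AE_I2)
    have "(LINT x|cube_measure. e x * (\<psi> i (x $ fst i) * \<psi> j (x $ fst j)))\<^sup>2
        \<le> (LINT x|cube_measure. (e x)\<^sup>2) * (LINT x|cube_measure. (\<psi> i (x $ fst i) * \<psi> j (x $ fst j))\<^sup>2)"
      by (rule integral_cauchy_schwarz[OF sqe sqp])
    also have "\<dots> \<le> \<delta>\<^sup>2 * (?n * ?n)"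
      using close False by (intro mult_mono p_le) (auto simp: pair_close_def e_def)
    finally show ?thesis
      by (simp add: power2_eq_square mult_ac)
  qed
  then have "\<bar>LINT x|cube_measure. e x * (\<psi> i (x $ fst i) * \<psi> j (x $ fst j))\<bar>\<^sup>2 \<le> (\<delta> * ?n)\<^sup>2"
    by simp
  then show ?thesis
    unfolding e_def by (rule power2_le_imp_le) (use \<delta> n in simp)
qed

text \<open>The form is its mean plus one error integral for each of the (2d)^2 pairs of components,
  each at most 4 \<delta> |a|^2. As closeness does not involve a, one event serves all additive
  tuples.\<close>

lemma empirical_form_coercive:
  assumes \<mu>: "prob_space \<mu>" "sets \<mu> = sets borel" "AE z in \<mu>. z \<in> unit_cube"
    and n: "0 < n" and X: "\<And>m. m \<in> {1..n} \<Longrightarrow> X m \<in> unit_cube"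
    and \<delta>: "0 < \<delta>" and close: "\<And>i j. pair_close n X \<mu> \<delta> i j" and a: "a \<in> F_add"
    and mean: "ennreal (c0 * (l2_norm a)\<^sup>2)
      \<le> (\<integral>\<^sup>+z. (\<integral>\<^sup>+x. ennreal (K_prod K h z x * (a x \<bullet> u_vec h z x)\<^sup>2) \<partial>cube_measure) \<partial>\<mu>)"
  shows "(c0 - (real CARD('d \<times> bool))\<^sup>2 * (4 * \<delta>)) * (l2_norm a)\<^sup>2 \<le> Q_loss n K h X (\<lambda>_. 0) a"
proof -
  interpret \<mu>: prob_space \<mu>
    by (rule \<mu>)
  interpret P: pair_prob_space \<mu> "cube_measure :: (real ^ 'd) measure"
    by (simp add: pair_prob_space_def pair_sigma_finite_def cube.sigma_finite_measure_axioms
        \<mu>.sigma_finite_measure_axioms prob_space_cube \<mu>)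
  have aF: "a \<in> F_full"
    by (rule F_add_imp_F_full[OF a])
  obtain \<psi> where \<psi>: "has_components a \<psi>"
    using F_add_components[OF a] by blast
  define T where "T i j x = \<psi> i (x $ fst i) * \<psi> j (x $ fst j)" for i j and x :: "real ^ 'd"
  define Ebar where "Ebar i j x = (LINT z|\<mu>. pair_kernel i j z x)" for i j x
  define D where "D z = (\<Sum>i\<in>UNIV. \<Sum>j\<in>UNIV. LINT x|cube_measure. pair_kernel i j z x * T i j x)" for z
  let ?err = "\<lambda>i j x. avg_error n X \<mu> (\<lambda>z. pair_kernel i j z x)"
  have m2: "(\<lambda>s. (\<psi> l s)\<^sup>2) \<in> borel_measurable borel" for l
    using has_componentsD(1)[OF \<psi>, of l] by simp
  have sq: "sq_integrable cube_measure (\<lambda>x :: real ^ 'd. \<psi> l (x $ k))" for l k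
    using has_componentsD(1,2)[OF \<psi>, of l] integral_cube_component(1)[OF m2[of l], where k = k]
    by (auto simp: sq_integrable_def intro: measurable_compose[OF measurable_cube_component])
  have T: "integrable cube_measure (T i j)" for i j
    unfolding T_def by (rule integrable_mult_sq[OF sq sq])
  have pk: "(\<lambda>p. pair_kernel i j (fst p) (snd p)) \<in> borel_measurable (\<mu> \<Otimes>\<^sub>M cube_measure)" for i j
    using pair_kernel_measurable by (simp add: measurable_cong_sets[OF sets_pair_measure_cong[OF \<mu>(2) refl] refl])
  have pkx: "(\<lambda>x. pair_kernel i j z x) \<in> borel_measurable cube_measure" for i j z
    using measurable_Pair2[OF pair_kernel_measurable, of z] by simp
  have int_pk: "integrable cube_measure (\<lambda>x. pair_kernel i j z x * T i j x)" for i j z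
  proof -
    obtain B where B: "\<And>z x. \<bar>pair_kernel i j z x\<bar> \<le> B"
      using pair_kernel_bounded by blast
    show ?thesis
    proof (rule Bochner_Integration.integrable_bound)
      show "integrable cube_measure (\<lambda>x. B * T i j x)"
        using T by simp
      show "(\<lambda>x. pair_kernel i j z x * T i j x) \<in> borel_measurable cube_measure"
        using T by (intro borel_measurable_times pkx) auto
      show "AE x in cube_measure. norm (pair_kernel i j z x * T i j x) \<le> norm (B * T i j x)"
        unfolding norm_mult by (intro AE_I2 mult_right_mono) (auto intro: order_trans[OF B])
    qed
  qed
  have int_P: "integrable (\<mu> \<Otimes>\<^sub>M cube_measure) (\<lambda>p. pair_kernel i j (fst p) (snd p) * T i j (snd p))" for i j
  proof -
    obtain B where B: "\<And>z x. \<bar>pair_kernel i j z x\<bar> \<le> B"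
      using pair_kernel_bounded by blast
    have "integrable (distr (cube_measure \<Otimes>\<^sub>M \<mu>) cube_measure fst) (T i j)"
      using T by (simp add: \<mu>.distr_pair_fst)
    then have "integrable (cube_measure \<Otimes>\<^sub>M \<mu>) (\<lambda>p. B * T i j (fst p))"
      using T by (subst (asm) integrable_distr_eq) auto
    then have "integrable (\<mu> \<Otimes>\<^sub>M cube_measure) (\<lambda>p. B * T i j (snd p))"
      using P.integrable_product_swap_iff[of "\<lambda>p. B * T i j (snd p)"] by (simp add: split_beta')
    then show ?thesis
    proof (rule Bochner_Integration.integrable_bound)
      have "T i j \<in> borel_measurable cube_measure"
        using T by auto
      then show "(\<lambda>p. pair_kernel i j (fst p) (snd p) * T i j (snd p)) \<in> borel_measurable (\<mu> \<Otimes>\<^sub>M cube_measure)"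
        by (intro borel_measurable_times pk measurable_compose[OF measurable_snd])
      show "AE p in \<mu> \<Otimes>\<^sub>M cube_measure. norm (pair_kernel i j (fst p) (snd p) * T i j (snd p)) \<le> norm (B * T i j (snd p))"
        unfolding norm_mult by (intro AE_I2 mult_right_mono) (auto intro: order_trans[OF B])
    qed
  qed
  have Ebar_m: "Ebar i j \<in> borel_measurable cube_measure" for i j
    unfolding Ebar_def
  proof (rule \<mu>.borel_measurable_lebesgue_integral)
    show "(\<lambda>(x, z). pair_kernel i j z x) \<in> borel_measurable (cube_measure \<Otimes>\<^sub>M \<mu>)"
      using measurable_compose[OF measurable_pair_swap' pk] by (simp add: split_beta')
  qed
  have err_m: "?err i j \<in> borel_measurable cube_measure" for i j
    unfolding avg_error_def Ebar_def[symmetric]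
    by (intro borel_measurable_diff borel_measurable_times borel_measurable_sum borel_measurable_const pkx Ebar_m)
  have err_b: "\<exists>B. \<forall>x. \<bar>?err i j x\<bar> \<le> B" for i j
  proof -
    obtain B where B: "\<And>z x. \<bar>pair_kernel i j z x\<bar> \<le> B"
      using pair_kernel_bounded by blast
    have "\<bar>?err i j x\<bar> \<le> B + \<bar>Ebar i j x\<bar>" for x
    proof -
      have "\<bar>\<Sum>i'=1..n. pair_kernel i j (X i') x\<bar> \<le> (\<Sum>i'=1..n. B)"
        by (rule order_trans[OF sum_abs]) (intro sum_mono B)
      then have "\<bar>1 / real n * (\<Sum>i'=1..n. pair_kernel i j (X i') x)\<bar> \<le> B"
        using n by (simp add: abs_mult field_simps)
      then show ?thesis
        unfolding avg_error_def Ebar_def by linarith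
    qed
    moreover have "\<bar>Ebar i j x\<bar> \<le> B" for x
    proof -
      have "0 \<le> B"
        using B abs_ge_zero order_trans by blast
      have "\<bar>Ebar i j x\<bar> \<le> (LINT z|\<mu>. \<bar>pair_kernel i j z x\<bar>)"
        unfolding Ebar_def by (rule integral_abs_bound)
      also have "\<dots> \<le> (LINT z|\<mu>. B)"
        using B \<open>0 \<le> B\<close> by (intro integral_mono') auto
      finally show ?thesis
        by (simp add: \<mu>.prob_space)
    qed
    ultimately have "\<bar>?err i j x\<bar> \<le> B + B" for x
      by (rule order_trans[OF _ add_left_mono])
    then show ?thesis
      by blast
  qed
  have mean_eq: "(LINT z|\<mu>. D z) = (\<Sum>i\<in>UNIV. \<Sum>j\<in>UNIV. LINT x|cube_measure. Ebar i j x * T i j x)"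
    and D_int: "integrable \<mu> D"
  proof -
    have i1: "integrable \<mu> (\<lambda>z. LINT x|cube_measure. pair_kernel i j z x * T i j x)" for i j
      using P.integrable_fst'[OF int_P[of i j]] by simp
    then show "integrable \<mu> D"
      unfolding D_def by (intro Bochner_Integration.integrable_sum)
    have "(LINT z|\<mu>. (LINT x|cube_measure. pair_kernel i j z x * T i j x)) = (LINT x|cube_measure. Ebar i j x * T i j x)" for i j
    proof -
      have "(LINT x|cube_measure. (LINT z|\<mu>. pair_kernel i j z x * T i j x)) = (LINT z|\<mu>. (LINT x|cube_measure. pair_kernel i j z x * T i j x))"
        using int_P[of i j] by (intro P.Fubini_integral) (simp add: split_beta')
      then show ?thesis
        by (simp add: Ebar_def)
    qed
    then show "(LINT z|\<mu>. D z) = (\<Sum>i\<in>UNIV. \<Sum>j\<in>UNIV. LINT x|cube_measure. Ebar i j x * T i j x)"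
      unfolding D_def using i1
      by (simp add: Bochner_Integration.integral_sum Bochner_Integration.integrable_sum)
  qed
  have int_Ebar: "integrable cube_measure (\<lambda>x. Ebar i j x * T i j x)" for i j
    using P.integrable_snd[of "\<lambda>z x. pair_kernel i j z x * T i j x"] int_P[of i j]
    by (simp add: split_beta' Ebar_def)
  \<comment> \<open>For z in the cube the inner integral in \<open>mean\<close> is D z, by the
    expansion. Outside, where \<open>moment_kernel\<close> is cut off but \<open>K_prod\<close> is
    not, \<mu> has no mass.\<close>
  have "c0 * (l2_norm a)\<^sup>2 \<le> (LINT z|\<mu>. D z)"
  proof -
    have D_nn: "AE z in \<mu>. 0 \<le> D z \<and> (\<integral>\<^sup>+x. ennreal (K_prod K h z x * (a x \<bullet> u_vec h z x)\<^sup>2) \<partial>cube_measure) = ennreal (D z)"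
      using \<mu>(3)
    proof eventually_elim
      case (elim z)
      have nonneg: "0 \<le> K_prod K h z x" for x
        unfolding K_prod_eq[OF elim]
      proof (intro prod_nonneg)
        fix k
        have "z $ k \<in> {0..1}"
          using elim by (simp add: mem_box_cart)
        then show "0 \<le> moment_kernel (h $ k) 0 (z $ k) (x $ k)"
          using mass_pos[OF h_pos h_small] K_nonneg by (simp add: moment_kernel_def less_imp_le)
      qed
      have eq: "D z = (LINT x|cube_measure. K_prod K h z x * (a x \<bullet> u_vec h z x)\<^sup>2)"
        unfolding D_def T_def by (rule local_form_expansion(2)[OF \<psi> elim aF, symmetric])
      have "(\<integral>\<^sup>+x. ennreal (K_prod K h z x * (a x \<bullet> u_vec h z x)\<^sup>2) \<partial>cube_measure)
          = ennreal (LINT x|cube_measure. K_prod K h z x * (a x \<bullet> u_vec h z x)\<^sup>2)"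
        using nonneg by (intro nn_integral_eq_integral local_form_expansion(1)[OF \<psi> elim aF]) auto
      moreover have "0 \<le> D z"
        unfolding eq using nonneg by (intro integral_nonneg_AE) auto
      ultimately show ?case
        by (simp add: eq)
    qed
    have "ennreal (c0 * (l2_norm a)\<^sup>2) \<le> (\<integral>\<^sup>+z. ennreal (D z) \<partial>\<mu>)"
      using mean D_nn by (subst nn_integral_cong_AE[symmetric]) (auto elim: eventually_mono)
    also have "\<dots> = ennreal (LINT z|\<mu>. D z)"
      using D_nn by (intro nn_integral_eq_integral D_int) (auto elim: eventually_mono)
    moreover have "0 \<le> (LINT z|\<mu>. D z)"
      using D_nn by (intro integral_nonneg_AE) (auto elim: eventually_mono)
    ultimately show ?thesis
      by simp
  qed
  moreover have "Q_loss n K h X (\<lambda>_. 0) a - (LINT z|\<mu>. D z) = (\<Sum>i\<in>UNIV. \<Sum>j\<in>UNIV. LINT x|cube_measure. ?err i j x * T i j x)"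
  proof -
    have "Q_loss n K h X (\<lambda>_. 0) a = 1 / real n * (\<Sum>m=1..n. \<Sum>i\<in>UNIV. \<Sum>j\<in>UNIV. LINT x|cube_measure. pair_kernel i j (X m) x * T i j x)"
      unfolding T_def by (rule Q_loss_expansion[OF \<psi> aF X])
    also have "(\<Sum>m=1..n. \<Sum>i\<in>UNIV. \<Sum>j\<in>UNIV. LINT x|cube_measure. pair_kernel i j (X m) x * T i j x)
        = (\<Sum>i\<in>UNIV. \<Sum>j\<in>UNIV. \<Sum>m=1..n. LINT x|cube_measure. pair_kernel i j (X m) x * T i j x)"
      by (subst sum.swap) (intro sum.cong refl sum.swap)
    finally have "Q_loss n K h X (\<lambda>_. 0) a - (LINT z|\<mu>. D z)
        = (\<Sum>i\<in>UNIV. \<Sum>j\<in>UNIV. 1 / real n * (\<Sum>m=1..n. LINT x|cube_measure. pair_kernel i j (X m) x * T i j x)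
          - (LINT x|cube_measure. Ebar i j x * T i j x))"
      unfolding mean_eq sum_subtractf sum_distrib_left by simp
    also have "\<dots> = (\<Sum>i\<in>UNIV. \<Sum>j\<in>UNIV. LINT x|cube_measure. ?err i j x * T i j x)"
    proof (intro sum.cong refl)
      fix i j
      have "(LINT x|cube_measure. ?err i j x * T i j x)
          = (LINT x|cube_measure. 1 / real n * (\<Sum>m=1..n. pair_kernel i j (X m) x * T i j x) - Ebar i j x * T i j x)"
        by (intro Bochner_Integration.integral_cong refl)
          (simp add: avg_error_def Ebar_def left_diff_distrib sum_distrib_right)
      also have "\<dots> = (LINT x|cube_measure. 1 / real n * (\<Sum>m=1..n. pair_kernel i j (X m) x * T i j x))
          - (LINT x|cube_measure. Ebar i j x * T i j x)"
        by (intro Bochner_Integration.integral_diff integrable_mult_right Bochner_Integration.integrable_sum int_pk int_Ebar)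
      also have "(LINT x|cube_measure. 1 / real n * (\<Sum>m=1..n. pair_kernel i j (X m) x * T i j x))
          = 1 / real n * (\<Sum>m=1..n. LINT x|cube_measure. pair_kernel i j (X m) x * T i j x)"
        unfolding integral_mult_right_zero
        by (intro arg_cong2[where f = "(*)"] refl Bochner_Integration.integral_sum int_pk)
      finally show "1 / real n * (\<Sum>m=1..n. LINT x|cube_measure. pair_kernel i j (X m) x * T i j x)
          - (LINT x|cube_measure. Ebar i j x * T i j x) = (LINT x|cube_measure. ?err i j x * T i j x)" ..
    qed
    finally show ?thesis .
  qed
  moreover have "\<bar>\<Sum>i\<in>UNIV. \<Sum>j\<in>UNIV. LINT x|cube_measure. ?err i j x * T i j x\<bar>
      \<le> (real CARD('d \<times> bool))\<^sup>2 * (4 * \<delta>) * (l2_norm a)\<^sup>2"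
  proof -
    have "\<bar>LINT x|cube_measure. ?err i j x * T i j x\<bar> \<le> \<delta> * (4 * (l2_norm a)\<^sup>2)" for i j
    proof -
      obtain B where "\<And>x. \<bar>?err i j x\<bar> \<le> B"
        using err_b by blast
      from pair_error_integral_le[OF \<psi> close \<delta> err_m this] show ?thesis
        unfolding T_def .
    qed
    then have "\<bar>\<Sum>i\<in>UNIV. \<Sum>j\<in>UNIV. LINT x|cube_measure. ?err i j x * T i j x\<bar>
        \<le> (\<Sum>i\<in>(UNIV :: ('d \<times> bool) set). \<Sum>j\<in>(UNIV :: ('d \<times> bool) set). \<delta> * (4 * (l2_norm a)\<^sup>2))"
      by (intro order_trans[OF sum_abs] sum_mono)
    also have "\<dots> = (real CARD('d \<times> bool))\<^sup>2 * (4 * \<delta>) * (l2_norm a)\<^sup>2"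
      by (simp add: power2_eq_square mult_ac)
    finally show ?thesis .
  qed
  ultimately show ?thesis
    unfolding left_diff_distrib by linarith
qed

text \<open>The bounds found here, (A / H)^d and (d + 1) / H, grow as H decreases; this does no
  harm, as they are used for one fixed sample at a time.\<close>

lemma sample_bounded_design:
  assumes X: "\<And>m. m \<in> {1..n} \<Longrightarrow> X m \<in> unit_cube"
  shows "\<exists>C U. bounded_design {1..n} (\<lambda>i x. K_prod K h (X i) x / real n) (\<lambda>i. u_vec h (X i)) C U"
proof (intro exI, unfold_locales)
  fix i assume i: "i \<in> {1..n}"
  have n: "1 \<le> real n"
    using i by simp
  have mk: "0 \<le> moment_kernel (h $ k) 0 (X i $ k) s" "moment_kernel (h $ k) 0 (X i $ k) s \<le> A / H" for k s
  proof -
    have "X i $ k \<in> {0..1}"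
      using X[OF i] by (simp add: mem_box_cart)
    then show "0 \<le> moment_kernel (h $ k) 0 (X i $ k) s"
      using mass_pos[OF h_pos h_small] K_nonneg by (simp add: moment_kernel_def less_imp_le)
    show "moment_kernel (h $ k) 0 (X i $ k) s \<le> A / H"
      using moment_le[of 0 k "X i $ k" s] by simp
  qed
  show "(\<lambda>x. K_prod K h (X i) x / real n) \<in> borel_measurable cube_measure"
    using K_prod_measurable[OF X[OF i]] by (intro borel_measurable_divide) auto
  fix x :: "real ^ 'd" assume x: "x \<in> unit_cube"
  have K0: "0 \<le> K_prod K h (X i) x"
    unfolding K_prod_eq[OF X[OF i]] by (intro prod_nonneg mk)
  then show "0 \<le> K_prod K h (X i) x / real n"
    by simp
  have "K_prod K h (X i) x / real n \<le> K_prod K h (X i) x / 1"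
    using K0 n by (intro divide_left_mono) auto
  also have "\<dots> \<le> (\<Prod>k\<in>(UNIV :: 'd set). A / H)"
    unfolding K_prod_eq[OF X[OF i]] div_by_1 by (intro prod_mono) (auto simp: mk)
  finally show "K_prod K h (X i) x / real n \<le> (\<Prod>k\<in>(UNIV :: 'd set). A / H)" .
  have "norm (u_vec h (X i) x) \<le> (\<Sum>l\<in>UNIV. \<bar>u_vec h (X i) x $ l\<bar>)"
    by (rule norm_le_l1_cart)
  also have "\<dots> \<le> (\<Sum>l\<in>(UNIV :: 'd option set). 1 / H)"
  proof (rule sum_mono)
    fix l :: "'d option"
    have H1: "1 \<le> 1 / H"
      using H_pos H_le_1 by simp
    show "\<bar>u_vec h (X i) x $ l\<bar> \<le> 1 / H"
    proof (cases l)
      case None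
      then show ?thesis
        using H1 by (simp add: u_vec_def)
    next
      case (Some k)
      have "0 \<le> x $ k" "x $ k \<le> 1" "0 \<le> X i $ k" "X i $ k \<le> 1"
        using x X[OF i] by (simp_all add: mem_box_cart)
      then have "\<bar>X i $ k - x $ k\<bar> / h $ k \<le> 1 / H"
        using H_pos H_le[of k] by (intro frac_le) auto
      then show ?thesis
        using Some h_pos[of k] by (simp add: u_vec_def abs_divide)
    qed
  qed
  finally show "norm (u_vec h (X i) x) \<le> (\<Sum>l\<in>(UNIV :: 'd option set). 1 / H)" .
next
  fix i l show "(\<lambda>x. u_vec h (X i) x $ l) \<in> borel_measurable cube_measure"
    by (cases l) (simp_all add: u_vec_def)
qed simp

end

text \<open>Each rescaled kernel integrates to 1 in x, so the loss of the zero tuple involves the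
  responses alone.\<close>

lemma (in smoothing_kernel_bandwidth) Q_loss_0:
  assumes X: "\<And>m. m \<in> {1..n} \<Longrightarrow> X m \<in> unit_cube"
  shows "Q_loss n K h X Y (\<lambda>x. 0) = 1 / real n * (\<Sum>i=1..n. (Y i)\<^sup>2)"
proof -
  have K1: "integrable cube_measure (K_prod K h (X i))" "(LINT x|cube_measure. K_prod K h (X i) x) = 1"
    if "i \<in> {1..n}" for i
    using K_prod_marginal[OF X[OF that], of "{}"] by (simp_all add: measure_unit_cube space_cube)
  have "Q_loss n K h X Y (\<lambda>x. 0) = (LINT x|cube_measure. (\<Sum>i=1..n. (Y i)\<^sup>2 / real n * K_prod K h (X i) x))"
    unfolding Q_loss_def sum_distrib_left
    by (intro Bochner_Integration.integral_cong refl sum.cong) simp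
  also have "\<dots> = (\<Sum>i=1..n. LINT x|cube_measure. (Y i)\<^sup>2 / real n * K_prod K h (X i) x)"
    using K1 by (intro Bochner_Integration.integral_sum integrable_mult_right) auto
  also have "\<dots> = (\<Sum>i=1..n. (Y i)\<^sup>2 / real n)"
    using K1 by (intro sum.cong) auto
  finally show ?thesis
    by (simp add: sum_distrib_left)
qed

section \<open>Rates and constants\<close>

text \<open>K is positive at some point other than 0, at its absolute value by symmetry, and on an
  interval to the right of that by Lipschitz continuity.\<close>

lemma kernel_constants:
  fixes K :: "real \<Rightarrow> real"
  assumes nonneg: "\<And>u. 0 \<le> K u" and bounded: "bounded (range K)"
    and support: "\<exists>C1>0. closure {u. K u \<noteq> 0} = {- C1..C1}"
    and symmetric: "\<And>u. K (- u) = K u" and lipschitz: "\<exists>L. L-lipschitz_on UNIV K"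
  shows "\<exists>S B L \<alpha> \<beta> \<kappa>. smoothing_kernel K S B L \<alpha> \<beta> \<kappa>"
proof -
  obtain S where S: "0 < S" "closure {u. K u \<noteq> 0} = {- S..S}"
    using support by blast
  obtain B where B: "\<And>u. \<bar>K u\<bar> \<le> B"
    using bounded unfolding bounded_iff by auto
  obtain L where L: "L-lipschitz_on UNIV K"
    using lipschitz by blast
  have L0: "0 \<le> L"
    using L by (rule lipschitz_on_nonneg)
  have lip: "\<bar>K u - K v\<bar> \<le> L * \<bar>u - v\<bar>" for u v
    using lipschitz_onD[OF L, of u v] by (simp add: dist_real_def)
  have zero: "K u = 0" if "S < \<bar>u\<bar>" for u
  proof (rule ccontr)
    assume "K u \<noteq> 0"
    then have "u \<in> closure {u. K u \<noteq> 0}"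
      using closure_subset[of "{u. K u \<noteq> 0}"] by auto
    then show False
      using that unfolding S(2) by auto
  qed
  \<comment> \<open>Otherwise the support would be contained in {0}, but it contains S > 0.\<close>
  have "\<exists>u. u \<noteq> 0 \<and> K u \<noteq> 0"
  proof (rule ccontr)
    assume "\<nexists>u. u \<noteq> 0 \<and> K u \<noteq> 0"
    then have "closure {u. K u \<noteq> 0} \<subseteq> closure {0}"
      by (intro closure_mono) auto
    moreover have "S \<in> closure {u. K u \<noteq> 0}"
      using S by simp
    ultimately show False
      using S(1) by auto
  qed
  then obtain u where u: "u \<noteq> 0" "K u \<noteq> 0"
    by blast
  have Ku: "0 < K \<bar>u\<bar>"
    using u(2) nonneg[of u] symmetric[of u] by (cases "0 \<le> u") auto
  \<comment> \<open>Over this length K loses at most half of its value; L + 1 avoids a division by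
    0.\<close>
  define d where "d = K \<bar>u\<bar> / (2 * (L + 1))"
  have d: "0 < d"
    using Ku L0 by (simp add: d_def)
  have "K \<bar>u\<bar> / 2 \<le> K v" if "\<bar>u\<bar> \<le> v" "v \<le> \<bar>u\<bar> + d" for v
  proof -
    have "K \<bar>u\<bar> - K v \<le> L * \<bar>\<bar>u\<bar> - v\<bar>"
      using lip[of "\<bar>u\<bar>" v] by linarith
    also have "\<dots> \<le> (L + 1) * d"
      using that L0 by (intro mult_mono) auto
    also have "\<dots> = K \<bar>u\<bar> / 2"
    proof -
      have "2 * L + 2 \<noteq> 0"
        using L0 by simp
      then show ?thesis
        by (simp add: d_def field_simps)
    qed
    finally show ?thesis
      by linarith
  qed
  then have "smoothing_kernel K S B L \<bar>u\<bar> (\<bar>u\<bar> + d) (K \<bar>u\<bar> / 2)"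
    using nonneg B lip S(1) zero symmetric u(1) d Ku
    by unfold_locales (auto intro: abs_le_D1)
  then show ?thesis
    by blast
qed

lemma (in prob_space) second_moment_average_bound:
  fixes Y :: "nat \<Rightarrow> 'a \<Rightarrow> real"
  assumes Y: "\<And>i. i \<ge> 1 \<Longrightarrow> integrable M (\<lambda>\<omega>. (Y i \<omega>)\<^sup>2)" "\<And>i. i \<ge> 1 \<Longrightarrow> expectation (\<lambda>\<omega>. (Y i \<omega>)\<^sup>2) = V"
    and n: "0 < n" and c: "0 < c"
  shows "{\<omega> \<in> space M. c \<le> 1 / real n * (\<Sum>i=1..n. (Y i \<omega>)\<^sup>2)} \<in> events"
    and "prob {\<omega> \<in> space M. c \<le> 1 / real n * (\<Sum>i=1..n. (Y i \<omega>)\<^sup>2)} \<le> V / c"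
proof -
  let ?A = "\<lambda>\<omega>. 1 / real n * (\<Sum>i=1..n. (Y i \<omega>)\<^sup>2)"
  have A: "integrable M ?A"
    using Y(1) by (intro integrable_mult_right Bochner_Integration.integrable_sum) auto
  then have [measurable]: "?A \<in> borel_measurable M"
    by auto
  show "{\<omega> \<in> space M. c \<le> ?A \<omega>} \<in> events"
    by measurable
  have "expectation ?A = 1 / real n * (\<Sum>i=1..n. expectation (\<lambda>\<omega>. (Y i \<omega>)\<^sup>2))"
    unfolding integral_mult_right_zero
    using Y(1) by (subst Bochner_Integration.integral_sum) auto
  also have "\<dots> = V"
    using n Y(2) by simp
  finally have "expectation ?A = V" .
  then show "prob {\<omega> \<in> space M. c \<le> ?A \<omega>} \<le> V / c"
    using integral_Markov_inequality_measure[OF A, of "space M" c] c by (auto simp: sum_nonneg)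
qed

text \<open>A positive liminf gives each coordinate a constant that works eventually; the least of
  these finitely many constants serves all. The cap at 1 is there for
  \<open>H \<le> 1\<close>.\<close>

lemma bandwidth_lower_bound:
  fixes h :: "nat \<Rightarrow> real ^ 'd::finite"
  assumes order: "\<And>k. Liminf sequentially (\<lambda>n. ereal (real n powr (1/5) * h n $ k)) > 0"
  shows "\<exists>c. 0 < c \<and> c \<le> 1 \<and> (\<forall>\<^sub>F n in sequentially. \<forall>k. c * real n powr (- 1/5) \<le> h n $ k)"
proof -
  have "\<forall>k. \<exists>c. 0 < c \<and> (\<forall>\<^sub>F n in sequentially. c < real n powr (1/5) * h n $ k)"
  proof
    fix k
    obtain c where c: "0 < ereal c" "ereal c < Liminf sequentially (\<lambda>n. ereal (real n powr (1/5) * h n $ k))"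
      using ereal_dense2[OF order[of k]] by (auto simp: zero_ereal_def)
    then show "\<exists>c. 0 < c \<and> (\<forall>\<^sub>F n in sequentially. c < real n powr (1/5) * h n $ k)"
      using less_LiminfD[OF c(2)] by (intro exI[of _ c]) simp
  qed
  from choice[OF this] obtain c where c: "\<And>k. 0 < c k"
    "\<And>k. \<forall>\<^sub>F n in sequentially. c k < real n powr (1/5) * h n $ k"
    by blast
  define c0 where "c0 = min 1 (Min (range c))"
  have c0: "0 < c0" "c0 \<le> 1" "c0 \<le> c k" for k
    using c(1) by (auto simp: c0_def intro: min.coboundedI2 Min_le)
  have "\<forall>\<^sub>F n in sequentially. \<forall>k. c k < real n powr (1/5) * h n $ k"
    using c(2) by (intro eventually_all_finite)
  then have "\<forall>\<^sub>F n in sequentially. \<forall>k. c0 * real n powr (- 1/5) \<le> h n $ k"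
    using eventually_gt_at_top[of 0]
  proof eventually_elim
    case (elim n)
    show ?case
    proof
      fix k
      have "c0 * real n powr (- 1/5) \<le> (real n powr (1/5) * h n $ k) * real n powr (- 1/5)"
        using elim c0(3)[of k] by (intro mult_right_mono) (auto intro: less_imp_le order_trans)
      also have "\<dots> = h n $ k * (real n powr (1/5) * real n powr (- 1/5))"
        by (simp only: mult_ac)
      also have "real n powr (1/5) * real n powr (- 1/5) = 1"
        using elim(2) by (simp flip: powr_add)
      finally show "c0 * real n powr (- 1/5) \<le> h n $ k"
        by simp
    qed
  qed
  then show ?thesis
    using c0(1,2) by blast
qed

theorem theorem1:
  fixes M :: "'a measure"
    and X :: "nat \<Rightarrow> 'a \<Rightarrow> real ^ ('d::finite)"
    and eps Y :: "nat \<Rightarrow> 'a \<Rightarrow> real"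
    and r_true f :: "real ^ 'd \<Rightarrow> real"
    and \<sigma> :: real
    and K :: "real \<Rightarrow> real"
    and h :: "nat \<Rightarrow> real ^ 'd"
  assumes prob: "prob_space M"
    and indep: "prob_space.indep_vars M (\<lambda>_. borel) (\<lambda>i \<omega>. (X i \<omega>, eps i \<omega>)) {1..}"
    and ident: "\<And>i. i \<ge> 1 \<Longrightarrow>
      distr M borel (\<lambda>\<omega>. (X i \<omega>, eps i \<omega>)) = distr M borel (\<lambda>\<omega>. (X 1 \<omega>, eps 1 \<omega>))"
    and density: "\<And>i. i \<ge> 1 \<Longrightarrow> distributed M lborel (X i) (\<lambda>x. ennreal (f x))"
    and X_eps_indep: "\<And>i. i \<ge> 1 \<Longrightarrow> prob_space.indep_set M
      {X i -` A \<inter> space M | A. A \<in> sets borel} {eps i -` B \<inter> space M | B. B \<in> sets borel}"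
    and eps_sq_integrable: "\<And>i. i \<ge> 1 \<Longrightarrow> integrable M (\<lambda>\<omega>. (eps i \<omega>)\<^sup>2)"
    and eps_mean: "\<And>i. i \<ge> 1 \<Longrightarrow> prob_space.expectation M (eps i) = 0"
    and eps_variance: "\<And>i. i \<ge> 1 \<Longrightarrow> prob_space.variance M (eps i) = \<sigma>\<^sup>2"
    and r_true_measurable: "r_true \<in> borel_measurable borel"
    and Y_def: "\<And>i \<omega>. Y i \<omega> = r_true (X i \<omega>) + eps i \<omega>"
    and h_pos: "\<And>n k. h n $ k > 0"
    and h_same_order: "\<exists>c>0. \<exists>C. \<forall>n j k. c \<le> h n $ j / h n $ k \<and> h n $ j / h n $ k \<le> C"
    and B1_nonneg: "\<And>u. K u \<ge> 0"
    and B1_bounded: "bounded (range K)"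
    and B1_support: "\<exists>C1>0. closure {u. K u \<noteq> 0} = {- C1..C1}"
    and B1_symmetric: "\<And>u. K (- u) = K u"
    and B1_lipschitz: "\<exists>L. L-lipschitz_on UNIV K"
    and B2'_support: "\<And>x. x \<notin> unit_cube \<Longrightarrow> f x = 0"
    and B2'_bounds: "\<exists>c>0. \<exists>C. \<forall>x\<in>unit_cube. c \<le> f x \<and> f x \<le> C"
    and B3': "\<exists>\<theta>>5/2. \<forall>i\<ge>1. integrable M (\<lambda>\<omega>. \<bar>Y i \<omega>\<bar> powr \<theta>)"
    and C1_lim: "\<And>k. (\<lambda>n. h n $ k) \<longlonglongrightarrow> 0"
    and C1_order: "\<And>k. Liminf sequentially (\<lambda>n. ereal (real n powr (1/5) * h n $ k)) > 0"
  shows "(\<lambda>n. inner_prob M {\<omega> \<in> space M.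
            estimators_defined n K (h n) (\<lambda>i. X i \<omega>) (\<lambda>i. Y i \<omega>) \<and>
            Limsup at_top (\<lambda>R. ereal (R * estimator_dist n K (h n) (\<lambda>i. X i \<omega>) (\<lambda>i. Y i \<omega>) R)) < \<infinity>})
          \<longlonglongrightarrow> 1 \<and>
         (\<forall>R :: nat \<Rightarrow> real. (\<forall>n. R n > 0) \<longrightarrow>
           big_OP M (\<lambda>n \<omega>. estimator_dist n K (h n) (\<lambda>i. X i \<omega>) (\<lambda>i. Y i \<omega>) (R n))
                    (\<lambda>n \<omega>. inverse (R n) * op_norm (S_op n K (h n) (\<lambda>i. X i \<omega>))))"
proof -
  interpret prob_space M
    by (rule prob)
  obtain S B L \<alpha> \<beta> \<kappa> where kernel: "smoothing_kernel K S B L \<alpha> \<beta> \<kappa>"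
    using kernel_constants[OF B1_nonneg B1_bounded B1_support B1_symmetric B1_lipschitz] by blast
  interpret smoothing_kernel K S B L \<alpha> \<beta> \<kappa>
    by (rule kernel)
  obtain A where A: "0 < A" "\<And>p b z s s'. p \<le> 2 \<Longrightarrow> 0 < b \<Longrightarrow> b * \<beta> \<le> 1 / 2 \<Longrightarrow>
    \<bar>moment_kernel b p z s\<bar> \<le> A / b \<and>
    \<bar>moment_kernel b p z s - moment_kernel b p z s'\<bar> \<le> A / b\<^sup>2 * \<bar>s - s'\<bar>"
    using moment_kernel_bounds_uniform by blast
  define \<mu> where "\<mu> = density lborel (\<lambda>x. ennreal (f x))"

  \<comment> \<open>The law and the independence of the observations\<close>
  have pair_m: "(\<lambda>\<omega>. (X i \<omega>, eps i \<omega>)) \<in> borel_measurable M" if "i \<ge> 1" for i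
    using indep that by (auto simp: indep_vars_def)
  have Xm: "X i \<in> borel_measurable M" if "i \<ge> 1" for i
    using distributed_measurable[OF density[OF that]] by simp
  have fm: "(\<lambda>x. ennreal (f x)) \<in> borel_measurable borel"
    using distributed_borel_measurable[OF density[of 1]] by simp
  have fm': "(\<lambda>x. ennreal (f x)) \<in> borel_measurable lborel"
    using fm by simp
  have X_distr: "distr M borel (X i) = \<mu>" if "i \<ge> 1" for i
    using distributed_distr_eq_density[OF density[OF that]] unfolding \<mu>_def
    by (simp add: distr_cong[of M M borel lborel])
  have \<mu>_sets: "sets \<mu> = sets borel"
    by (simp add: \<mu>_def)
  have \<mu>_prob: "prob_space \<mu>"
    using prob_space_distr[OF Xm[of 1]] X_distr[of 1] by simp
  have \<mu>_cube: "AE z in \<mu>. z \<in> unit_cube"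
    unfolding \<mu>_def AE_density[OF fm']
  proof (intro AE_I2 impI)
    fix x assume "0 < ennreal (f x)"
    then show "x \<in> unit_cube"
      using B2'_support[of x] by (cases "x \<in> unit_cube") auto
  qed
  have X_indep: "indep_vars (\<lambda>_. borel) X {1..n}" for n
  proof -
    have "indep_vars (\<lambda>_. borel) (\<lambda>i \<omega>. fst (X i \<omega>, eps i \<omega>)) {1..}"
      by (rule indep_vars_compose2[OF indep])
        (intro borel_measurable_continuous_onI continuous_intros)
    then have "indep_vars (\<lambda>_. borel) X {1..}"
      by simp
    then show ?thesis
      by (rule indep_vars_subset) auto
  qed
  have iid: "iid_sample M n X borel \<mu>" if "0 < n" for n
    using that X_indep[of n] X_distr by unfold_locales auto

  \<comment> \<open>Coercivity of the mean and the admissible error\<close>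
  obtain c where c: "0 < c" "\<And>z. z \<in> unit_cube \<Longrightarrow> c \<le> f z"
    using B2'_bounds by blast
  have fc: "\<And>z. z \<in> unit_cube \<Longrightarrow> ennreal c \<le> ennreal (f z)"
    by (intro ennreal_leI c(2))
  obtain c0 where c0: "0 < c0" "\<And>h a. (\<forall>k. 0 < h $ k \<and> h $ k * \<beta> \<le> 1 / 2) \<Longrightarrow> a \<in> F_full \<Longrightarrow>
    ennreal (c0 * (l2_norm a)\<^sup>2)
      \<le> (\<integral>\<^sup>+z. (\<integral>\<^sup>+x. ennreal (K_prod K h z x * (a x \<bullet> u_vec h z x)\<^sup>2) \<partial>cube_measure) \<partial>\<mu>)"
    using form_mean_coercive[OF fm c(1) fc] unfolding \<mu>_def by auto
  define N where "N = (real CARD('d \<times> bool))\<^sup>2 * 4"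
  have N: "0 < N"
    by (simp add: N_def)
  \<comment> \<open>The total error N \<delta> uses up half of c0; the other half is the coercivity
    constant of the sample.\<close>
  define \<delta> where "\<delta> = c0 / (2 * N)"
  have \<delta>: "0 < \<delta>"
    using c0(1) N by (simp add: \<delta>_def)

  \<comment> \<open>Bandwidths for large n\<close>
  obtain b where b: "0 < b" "b \<le> 1" "\<forall>\<^sub>F n in sequentially. \<forall>k. b * real n powr (- 1/5) \<le> h n $ k"
    using bandwidth_lower_bound[OF C1_order] by blast
  define H where "H n = b * real n powr (- 1/5)" for n
  have "\<forall>\<^sub>F n in sequentially. \<forall>k. h n $ k * \<beta> \<le> 1 / 2"
  proof (intro eventually_all_finite)
    fix k
    have "(\<lambda>n. h n $ k * \<beta>) \<longlonglongrightarrow> 0 * \<beta>"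
      by (intro tendsto_intros C1_lim)
    then have "\<forall>\<^sub>F n in sequentially. h n $ k * \<beta> < 1 / 2"
      by (rule order_tendstoD) simp
    then show "\<forall>\<^sub>F n in sequentially. h n $ k * \<beta> \<le> 1 / 2"
      by eventually_elim simp
  qed
  then have ev: "\<forall>\<^sub>F n in sequentially. 0 < n \<and> bounded_kernel K S B L \<alpha> \<beta> \<kappa> (h n) A (H n)"
    using b(3) eventually_gt_at_top[of 0]
  proof eventually_elim
    case (elim n)
    have "real n powr (- 1/5) \<le> real n powr 0"
      using elim(3) by (intro powr_mono) auto
    then have "H n \<le> 1"
      using b(1,2) elim(3) mult_le_one[of b "real n powr (- 1/5)"] by (simp add: H_def)
    moreover have "0 < H n"
      using b(1) elim(3) by (simp add: H_def)
    moreover have "H n \<le> h n $ k" for k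
      using elim(2) by (simp add: H_def)
    ultimately have "bounded_kernel K S B L \<alpha> \<beta> \<kappa> (h n) A (H n)"
      using elim(1) A h_pos by unfold_locales auto
    then show ?case
      using elim(3) by simp
  qed

  \<comment> \<open>Failure probabilities of order 1 / (n H^4), that is n^(-1/5)\<close>
  define C where "C = (4 * A / \<delta> + 2) * (4 * A\<^sup>2 / \<delta>\<^sup>2) + A ^ 4 / \<delta>\<^sup>2"
  have rate: "(\<lambda>n. C / (real n * H n ^ 4)) \<longlonglongrightarrow> 0"
  proof (rule Lim_transform_eventually)
    show "(\<lambda>n. (C / b ^ 4) * real n powr (- 1/5)) \<longlonglongrightarrow> 0"
      by (intro tendsto_mult_right_zero tendsto_neg_powr filterlim_real_sequentially) simp
    show "\<forall>\<^sub>F n in sequentially. (C / b ^ 4) * real n powr (- 1/5) = C / (real n * H n ^ 4)"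
      using eventually_gt_at_top[of 0]
    proof eventually_elim
      case (elim n)
      have "real n * H n ^ 4 = b ^ 4 * (real n powr 1 * (real n powr (- 1/5)) ^ 4)"
        using elim by (simp add: H_def power_mult_distrib)
      also have "real n powr 1 * (real n powr (- 1/5)) ^ 4 = real n powr (1/5)"
      proof -
        have "(real n powr (- 1/5)) ^ 4 = real n powr (- 4/5)"
          using elim by (subst powr_power) auto
        then show ?thesis
          by (simp only: powr_add[symmetric]) simp
      qed
      finally show ?case
        by (simp add: powr_minus_divide)
    qed
  qed
  have close: "whp M (\<lambda>n \<omega>. bounded_kernel.pair_close K (h n) n (\<lambda>i. X i \<omega>) \<mu> \<delta> i j)" for i j
  proof (rule whpI[OF _ rate])
    show "\<forall>\<^sub>F n in sequentially. \<exists>E\<in>events. 1 - C / (real n * H n ^ 4) \<le> prob E \<and>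
      (\<forall>\<omega>\<in>E. bounded_kernel.pair_close K (h n) n (\<lambda>i. X i \<omega>) \<mu> \<delta> i j)"
      using ev
    proof eventually_elim
      case (elim n)
      interpret bounded_kernel K S B L \<alpha> \<beta> \<kappa> "h n" A "H n"
        using elim by simp
      show ?case
        unfolding C_def using elim by (intro pair_concentration iid \<delta>) auto
    qed
  qed
  have in_cube: "whp M (\<lambda>n \<omega>. \<forall>m\<in>{1..n}. X m \<omega> \<in> unit_cube)"
  proof (rule whp_AE)
    fix n
    show "AE \<omega> in M. \<forall>m\<in>{1..n}. X m \<omega> \<in> unit_cube"
    proof (rule AE_finite_allI)
      fix m assume "m \<in> {1..n}"
      then have m: "m \<ge> 1"
        by simp
      have "AE z in distr M borel (X m). z \<in> unit_cube"
        unfolding X_distr[OF m] by (rule \<mu>_cube)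
      then show "AE \<omega> in M. X m \<omega> \<in> unit_cube"
        by (rule AE_distrD[OF Xm[OF m]])
    qed simp
  qed

  \<comment> \<open>The deterministic bound, for all R at once, on events of probability tending to
    1\<close>
  define bound where "bound n \<omega> \<longleftrightarrow> estimators_defined n K (h n) (\<lambda>i. X i \<omega>) (\<lambda>i. Y i \<omega>) \<and>
    0 \<le> op_norm (S_op n K (h n) (\<lambda>i. X i \<omega>)) \<and>
    (\<forall>R>0. estimator_dist n K (h n) (\<lambda>i. X i \<omega>) (\<lambda>i. Y i \<omega>) R
      \<le> 2 * sqrt ((1 / real n * (\<Sum>i=1..n. (Y i \<omega>)\<^sup>2)) / (c0 / 2))
        * (inverse R * op_norm (S_op n K (h n) (\<lambda>i. X i \<omega>))))" for n \<omega>
  have "whp M (\<lambda>n \<omega>. (\<forall>ij\<in>UNIV. bounded_kernel.pair_close K (h n) n (\<lambda>i. X i \<omega>) \<mu> \<delta> (fst ij) (snd ij))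
      \<and> (\<forall>m\<in>{1..n}. X m \<omega> \<in> unit_cube))"
    by (intro whp_conj whp_finite_all in_cube close) simp
  then have whp_bound: "whp M bound"
  proof (rule whp_mono)
    show "\<forall>\<^sub>F n in sequentially. \<forall>\<omega>\<in>space M.
      (\<forall>ij\<in>UNIV. bounded_kernel.pair_close K (h n) n (\<lambda>i. X i \<omega>) \<mu> \<delta> (fst ij) (snd ij))
      \<and> (\<forall>m\<in>{1..n}. X m \<omega> \<in> unit_cube) \<longrightarrow> bound n \<omega>"
      using ev
    proof (eventually_elim, intro ballI impI)
      fix n \<omega> assume n: "0 < n \<and> bounded_kernel K S B L \<alpha> \<beta> \<kappa> (h n) A (H n)"
        and good: "(\<forall>ij\<in>UNIV. bounded_kernel.pair_close K (h n) n (\<lambda>i. X i \<omega>) \<mu> \<delta> (fst ij) (snd ij))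
          \<and> (\<forall>m\<in>{1..n}. X m \<omega> \<in> unit_cube)"
      interpret bounded_kernel K S B L \<alpha> \<beta> \<kappa> "h n" A "H n"
        using n by simp
      have cl: "pair_close n (\<lambda>i. X i \<omega>) \<mu> \<delta> i j" for i j
        using good by (metis UNIV_I fst_conv snd_conv)
      have X: "X m \<omega> \<in> unit_cube" if "m \<in> {1..n}" for m
        using good that by blast
      have coercive: "c0 / 2 * (l2_norm a)\<^sup>2 \<le> Q_loss n K (h n) (\<lambda>i. X i \<omega>) (\<lambda>_. 0) a" if a: "a \<in> F_add" for a
      proof -
        have "(c0 - (real CARD('d \<times> bool))\<^sup>2 * (4 * \<delta>)) * (l2_norm a)\<^sup>2 \<le> Q_loss n K (h n) (\<lambda>i. X i \<omega>) (\<lambda>_. 0) a"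
          by (rule empirical_form_coercive[OF \<mu>_prob \<mu>_sets \<mu>_cube _ X \<delta> cl a])
            (use n h_small h_pos a in \<open>auto intro!: c0(2) F_add_imp_F_full\<close>)
        moreover have "c0 - (real CARD('d \<times> bool))\<^sup>2 * (4 * \<delta>) = c0 / 2"
        proof -
          have "(real CARD('d \<times> bool))\<^sup>2 * (4 * \<delta>) = N * \<delta>"
            by (simp only: N_def mult.assoc)
          also have "\<dots> = c0 / 2"
            using N by (simp add: \<delta>_def)
          finally show ?thesis
            by simp
        qed
        ultimately show ?thesis
          by (simp only:)
      qed
      obtain C' U where design: "bounded_design {1..n} (\<lambda>i x. K_prod K (h n) (X i \<omega>) x / real n) (\<lambda>i. u_vec (h n) (X i \<omega>)) C' U"
        using sample_bounded_design[of n "\<lambda>i. X i \<omega>", OF X] by blast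
      have c2: "0 < c0 / 2"
        using c0(1) by simp
      have Q0: "Q_loss n K (h n) (\<lambda>i. X i \<omega>) (\<lambda>i. Y i \<omega>) (\<lambda>x. 0) = 1 / real n * (\<Sum>i=1..n. (Y i \<omega>)\<^sup>2)"
        by (rule Q_loss_0[OF X])
      show "bound n \<omega>"
        unfolding bound_def Q0[symmetric]
        by (intro conjI allI impI estimator_bound[OF design c2 coercive])
    qed
  qed

  \<comment> \<open>Fixed n, with R tending to infinity\<close>
  have "(\<lambda>n. inner_prob M {\<omega> \<in> space M.
            estimators_defined n K (h n) (\<lambda>i. X i \<omega>) (\<lambda>i. Y i \<omega>) \<and>
            Limsup at_top (\<lambda>R. ereal (R * estimator_dist n K (h n) (\<lambda>i. X i \<omega>) (\<lambda>i. Y i \<omega>) R)) < \<infinity>})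
          \<longlonglongrightarrow> 1"
  proof (rule whp_inner_prob[OF whp_mono[OF whp_bound]], intro always_eventually allI ballI impI conjI)
    fix n \<omega> assume bound: "bound n \<omega>"
    then show "estimators_defined n K (h n) (\<lambda>i. X i \<omega>) (\<lambda>i. Y i \<omega>)"
      by (simp add: bound_def)
    let ?op = "op_norm (S_op n K (h n) (\<lambda>i. X i \<omega>))"
    let ?c = "2 * sqrt ((1 / real n * (\<Sum>i=1..n. (Y i \<omega>)\<^sup>2)) / (c0 / 2))"
    have "Limsup at_top (\<lambda>R. ereal (R * estimator_dist n K (h n) (\<lambda>i. X i \<omega>) (\<lambda>i. Y i \<omega>) R)) \<le> ereal (?c * ?op)"
    proof (rule Limsup_bounded)
      show "\<forall>\<^sub>F R in at_top. ereal (R * estimator_dist n K (h n) (\<lambda>i. X i \<omega>) (\<lambda>i. Y i \<omega>) R) \<le> ereal (?c * ?op)"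
        using eventually_gt_at_top[of 0]
      proof eventually_elim
        case (elim R)
        have "R * estimator_dist n K (h n) (\<lambda>i. X i \<omega>) (\<lambda>i. Y i \<omega>) R \<le> R * (?c * (inverse R * ?op))"
          using bound elim by (intro mult_left_mono) (auto simp: bound_def)
        also have "\<dots> = ?c * ?op"
          using elim by simp
        finally show ?case
          by simp
      qed
    qed
    then show "Limsup at_top (\<lambda>R. ereal (R * estimator_dist n K (h n) (\<lambda>i. X i \<omega>) (\<lambda>i. Y i \<omega>) R)) < \<infinity>"
      by (rule le_less_trans) simp
  qed

  \<comment> \<open>Stochastic order along a sequence R n\<close>
  moreover have "big_OP M (\<lambda>n \<omega>. estimator_dist n K (h n) (\<lambda>i. X i \<omega>) (\<lambda>i. Y i \<omega>) (R n))
      (\<lambda>n \<omega>. inverse (R n) * op_norm (S_op n K (h n) (\<lambda>i. X i \<omega>)))"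
    if R: "\<And>n. R n > 0" for R :: "nat \<Rightarrow> real"
    unfolding big_OP_def
  proof (intro allI impI)
    fix \<eta> :: real assume \<eta>: "0 < \<eta>"
    have Ym: "Y i \<in> borel_measurable M" if "i \<ge> 1" for i
    proof -
      have "(\<lambda>\<omega>. snd (X i \<omega>, eps i \<omega>)) \<in> borel_measurable M"
        by (rule measurable_compose[OF pair_m[OF that]]) (intro borel_measurable_continuous_onI continuous_intros)
      then have "(\<lambda>\<omega>. r_true (X i \<omega>) + eps i \<omega>) \<in> borel_measurable M"
        using measurable_compose[OF Xm[OF that] r_true_measurable] by simp
      then show ?thesis
        unfolding Y_def[abs_def] .
    qed
    obtain \<theta> where \<theta>: "\<theta> > 5/2" "\<And>i. i \<ge> 1 \<Longrightarrow> integrable M (\<lambda>\<omega>. \<bar>Y i \<omega>\<bar> powr \<theta>)"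
      using B3' by blast
    \<comment> \<open>As \<theta> exceeds 2, y^2 is at most 1 where |y| \<le> 1 and at most
      |y|^\<theta> elsewhere.\<close>
    have Y2: "integrable M (\<lambda>\<omega>. (Y i \<omega>)\<^sup>2)" if "i \<ge> 1" for i
    proof (rule Bochner_Integration.integrable_bound)
      show "integrable M (\<lambda>\<omega>. 1 + \<bar>Y i \<omega>\<bar> powr \<theta>)"
        using \<theta>(2)[OF that] by simp
      show "(\<lambda>\<omega>. (Y i \<omega>)\<^sup>2) \<in> borel_measurable M"
        using Ym[OF that] by simp
      show "AE \<omega> in M. norm ((Y i \<omega>)\<^sup>2) \<le> norm (1 + \<bar>Y i \<omega>\<bar> powr \<theta>)"
      proof (rule AE_I2)
        fix \<omega>
        let ?y = "\<bar>Y i \<omega>\<bar>"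
        have "?y\<^sup>2 \<le> 1 + ?y powr \<theta>"
        proof (cases "?y \<le> 1")
          case True
          then have "?y\<^sup>2 \<le> 1"
            by (intro power_le_one) auto
          then show ?thesis
            using powr_ge_zero[of ?y \<theta>] by linarith
        next
          case False
          then have "?y\<^sup>2 = ?y powr 2"
            by (simp add: powr_numeral)
          also have "\<dots> \<le> ?y powr \<theta>"
            using False \<theta>(1) by (intro powr_mono) auto
          finally show ?thesis
            by simp
        qed
        then show "norm ((Y i \<omega>)\<^sup>2) \<le> norm (1 + ?y powr \<theta>)"
          by simp
      qed
    qed
    define V where "V = expectation (\<lambda>\<omega>. (Y 1 \<omega>)\<^sup>2)"
    have EY2: "expectation (\<lambda>\<omega>. (Y i \<omega>)\<^sup>2) = V" if "i \<ge> 1" for i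
    proof -
      \<comment> \<open>The squared response is one fixed function of the pair, so equal laws of the
        pairs give equal second moments.\<close>
      define g where "g p = (r_true (fst p) + snd p)\<^sup>2" for p :: "(real ^ 'd) \<times> real"
      have g: "g \<in> borel_measurable borel"
        unfolding g_def using r_true_measurable
        by (intro borel_measurable_power borel_measurable_add measurable_compose[OF _ r_true_measurable]
            borel_measurable_continuous_onI continuous_intros)
      have "expectation (\<lambda>\<omega>. (Y i \<omega>)\<^sup>2) = integral\<^sup>L (distr M borel (\<lambda>\<omega>. (X i \<omega>, eps i \<omega>))) g" if "i \<ge> 1" for i
        by (subst integral_distr[OF pair_m[OF that] g]) (simp add: g_def Y_def)
      then show ?thesis
        unfolding V_def using that ident[OF that] by simp
    qed
    have V: "0 \<le> V"
      unfolding V_def by (intro integral_nonneg_AE) auto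
    \<comment> \<open>Markov's inequality at level c1 costs at most \<eta>/2; the summand 1 keeps c1
      positive if V = 0.\<close>
    define c1 where "c1 = 2 * V / \<eta> + 1"
    have c1: "0 < c1" "V / c1 \<le> \<eta> / 2"
      using V \<eta> by (auto simp: c1_def field_simps add_nonneg_pos)
    obtain E where E: "\<And>n. E n \<in> events" "(\<lambda>n. prob (E n)) \<longlonglongrightarrow> 1" "\<forall>\<^sub>F n in sequentially. \<forall>\<omega>\<in>E n. bound n \<omega>"
      using whp_bound by (auto simp: whp_def)
    have E_ge: "\<forall>\<^sub>F n in sequentially. 1 - \<eta> / 2 < prob (E n)"
      by (rule order_tendstoD(1)[OF E(2)]) (use \<eta> in simp)
    let ?C = "2 * sqrt (c1 / (c0 / 2))"
    have "\<forall>\<^sub>F n in sequentially. 1 - \<eta> \<le> inner_prob M {\<omega> \<in> space M.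
        \<bar>estimator_dist n K (h n) (\<lambda>i. X i \<omega>) (\<lambda>i. Y i \<omega>) (R n)\<bar>
          \<le> ?C * \<bar>inverse (R n) * op_norm (S_op n K (h n) (\<lambda>i. X i \<omega>))\<bar>}"
      using E_ge E(3) eventually_gt_at_top[of 0]
    proof eventually_elim
      case (elim n)
      \<comment> \<open>The event that Q 0 is large. It is removed from \<open>E n\<close>, and each
        of the two events contributes at most \<eta>/2 to the failure probability.\<close>
      let ?F = "{\<omega> \<in> space M. c1 \<le> 1 / real n * (\<Sum>i=1..n. (Y i \<omega>)\<^sup>2)}"
      have F: "?F \<in> events"
        by (rule second_moment_average_bound[where Y = Y, OF Y2 EY2 elim(3) c1(1)])
      have "prob ?F \<le> V / c1"
        by (rule second_moment_average_bound[where Y = Y, OF Y2 EY2 elim(3) c1(1)])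
      also note c1(2)
      finally have prob_F: "prob ?F \<le> \<eta> / 2" .
      have "prob (E n) \<le> prob ((E n - ?F) \<union> ?F)"
        using E(1) F by (intro finite_measure_mono) auto
      also have "\<dots> \<le> prob (E n - ?F) + prob ?F"
        using E(1) F by (intro measure_Un_le) auto
      finally have "1 - \<eta> \<le> prob (E n - ?F)"
        using elim(1) prob_F by linarith
      also have "\<dots> \<le> inner_prob M {\<omega> \<in> space M.
        \<bar>estimator_dist n K (h n) (\<lambda>i. X i \<omega>) (\<lambda>i. Y i \<omega>) (R n)\<bar>
          \<le> ?C * \<bar>inverse (R n) * op_norm (S_op n K (h n) (\<lambda>i. X i \<omega>))\<bar>}"
      proof (rule inner_prob_ge)
        show "E n - ?F \<in> events"
          using E(1) F by auto
        show "E n - ?F \<subseteq> {\<omega> \<in> space M.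
          \<bar>estimator_dist n K (h n) (\<lambda>i. X i \<omega>) (\<lambda>i. Y i \<omega>) (R n)\<bar>
            \<le> ?C * \<bar>inverse (R n) * op_norm (S_op n K (h n) (\<lambda>i. X i \<omega>))\<bar>}"
        proof
          fix \<omega> assume \<omega>: "\<omega> \<in> E n - ?F"
          then have sp: "\<omega> \<in> space M"
            using sets.sets_into_space[OF E(1)] by blast
          let ?op = "inverse (R n) * op_norm (S_op n K (h n) (\<lambda>i. X i \<omega>))"
          let ?d = "estimator_dist n K (h n) (\<lambda>i. X i \<omega>) (\<lambda>i. Y i \<omega>) (R n)"
          have bd: "bound n \<omega>"
            using elim(2) \<omega> by blast
          have op: "0 \<le> ?op"
            using bd R[of n] by (simp add: bound_def)
          have "?d \<le> 2 * sqrt ((1 / real n * (\<Sum>i=1..n. (Y i \<omega>)\<^sup>2)) / (c0 / 2)) * ?op"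
            using bd R[of n] by (simp add: bound_def)
          also have "\<dots> \<le> ?C * ?op"
            using \<omega> sp op c0(1) by (intro mult_right_mono mult_left_mono real_sqrt_le_mono divide_right_mono) auto
          finally have "?d \<le> ?C * \<bar>?op\<bar>"
            using op by simp
          moreover have "0 \<le> ?d"
            unfolding estimator_dist_def by (rule l2_norm_nonneg)
          ultimately show "\<omega> \<in> {\<omega> \<in> space M.
            \<bar>estimator_dist n K (h n) (\<lambda>i. X i \<omega>) (\<lambda>i. Y i \<omega>) (R n)\<bar>
              \<le> ?C * \<bar>inverse (R n) * op_norm (S_op n K (h n) (\<lambda>i. X i \<omega>))\<bar>}"
            using sp by simp
        qed
      qed
      finally show ?case .
    qed
    then show "\<exists>C. \<forall>\<^sub>F n in sequentially. 1 - \<eta> \<le> inner_prob M {\<omega> \<in> space M.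
        \<bar>estimator_dist n K (h n) (\<lambda>i. X i \<omega>) (\<lambda>i. Y i \<omega>) (R n)\<bar>
          \<le> C * \<bar>inverse (R n) * op_norm (S_op n K (h n) (\<lambda>i. X i \<omega>))\<bar>}"
      by (rule exI[of _ ?C])
  qed
  ultimately show ?thesis
    by blast
qed

end
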